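(* Let $\alpha\in\mathbb{R}$, $T>0$, and let $\kappa\in\mathbb{R}$ satisfy $-\kappa T^2<\tfrac32\pi^2$. Put $\alpha_+:=\max\{0,\alpha\}$. There exists $n_0>\tfrac1\pi T\sqrt{\alpha_+}$ such that for every integer $n\ge n_0$ the following holds. Let $x_n(t)$ denote the unique periodic orbit of the standard Duffing equation $x''+\alpha x+x^3=0$ with minimal period $p=2T/n$ and positive Hamiltonian $H=\tfrac12(x')^2+\tfrac12\alpha x^2+\tfrac14x^4$. Then $x_n(t)$ is a periodic solution of the delayed feedback controlled equation $$x''(t)+\alpha x(t)+x^3(t)=\kappa\,\bigl(x(t)-(-1)^nx(t-T)\bigr),$$ and, as such, $x_n$ is linearly stable if and only if $\kappa<0$, and linearly unstable if and only if $\kappa>0$.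
   Context: Uniqueness of $x_n$ is up to time shift. Periodic orbits of $x''+\alpha x+x^3=0$ with $H>0$ satisfy $x(t+p/2)=-x(t)$, where $p$ is the minimal period; hence $x_n(t-T)=(-1)^nx_n(t)$ and the control term on the right-hand side vanishes on $x_n$ (the control is noninvasive). Linear (in)stability. Write the controlled equation as a first order system for $\mathbf{x}=(x,x')$ with phase space $\mathcal{X}=C^0([-T,0],\mathbb{R}^2)$, $\mathbf{x}_t(\vartheta)=\mathbf{x}(t+\vartheta)$ for $-T\le\vartheta\le0$. For a periodic solution $x$ of minimal period $p$, let $\Pi:\mathcal{X}\to\mathcal{X}$, $\mathbf{y}_0\mapsto\mathbf{y}_p$, be the time-$p$ map of the linearized equation $y''(t)+(\alpha-\kappa)y(t)+(-1)^n\kappa\,y(t-T)+3x(t)^2y(t)=0$, $\mathbf{y}=(y,y')$. Some power of $\Pi$ is compact. The nonzero eigenvalues of $\Pi$ (on the complexification of $\mathcal{X}$) are the Floquet multipliers of $x$. The value $1$ is always a (trivial) Floquet multiplier, with eigenvector given by the time derivative of the periodic solution. The periodic solution is called linearly stable if the trivial Floquet multiplier $1$ is algebraically simple and all other Floquet multipliers $\mu$ satisfy $|\mu|<1$. It is called linearly unstable if there is a Floquet multiplier with $|\mu|>1$. *)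

theory Defs
  imports "HOL-Analysis.Analysis" "HOL-Library.Function_Algebras"
begin

definition duffing_solution :: "real \<Rightarrow> (real \<Rightarrow> real) \<Rightarrow> bool" where
  "duffing_solution \<alpha> x \<longleftrightarrow>
     (\<forall>t. (x has_real_derivative deriv x t) (at t)) \<and>
     (\<forall>t. (deriv x has_real_derivative - \<alpha> * x t - x t ^ 3) (at t))"

definition hamiltonian :: "real \<Rightarrow> real \<Rightarrow> real \<Rightarrow> real" where
  "hamiltonian \<alpha> u v = v\<^sup>2 / 2 + \<alpha> * u\<^sup>2 / 2 + u ^ 4 / 4"

definition minimal_period :: "real \<Rightarrow> (real \<Rightarrow> real) \<Rightarrow> bool" where
  "minimal_period p x \<longleftrightarrow>
     0 < p \<and> (\<forall>t. x (t + p) = x t) \<and> (\<forall>q. 0 < q \<and> q < p \<longrightarrow> \<not> (\<forall>t. x (t + q) = x t))"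

text \<open>A parametrised orbit: time shifts of \<open>x\<close> satisfy the predicate together with \<open>x\<close>.\<close>

definition duffing_periodic_orbit :: "real \<Rightarrow> real \<Rightarrow> (real \<Rightarrow> real) \<Rightarrow> bool" where
  "duffing_periodic_orbit \<alpha> p x \<longleftrightarrow>
     duffing_solution \<alpha> x \<and> minimal_period p x \<and> (\<forall>t. hamiltonian \<alpha> (x t) (deriv x t) > 0)"

definition controlled_solution ::
    "real \<Rightarrow> real \<Rightarrow> real \<Rightarrow> nat \<Rightarrow> (real \<Rightarrow> real) \<Rightarrow> bool" where
  "controlled_solution \<alpha> \<kappa> T n x \<longleftrightarrow>
     (\<forall>t. (x has_real_derivative deriv x t) (at t)) \<and>
     (\<forall>t. (deriv x has_real_derivative
             \<kappa> * (x t - (-1) ^ n * x (t - T)) - \<alpha> * x t - x t ^ 3) (at t))"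

text \<open>
  The complexified phase space: the complexification of the space of continuous functions
  from \<open>[-T, 0]\<close> to \<open>\<real>\<^sup>2\<close> is the space of continuous functions from \<open>[-T, 0]\<close> to \<open>\<complex>\<^sup>2\<close>.
  They are represented as total functions vanishing outside \<open>[-T, 0]\<close> (no continuity is
  required across the end points), so that equality and the pointwise operations of functions
  are those of the phase space.
\<close>

definition phase_space :: "real \<Rightarrow> (real \<Rightarrow> complex ^ 2) set" where
  "phase_space T = {\<phi>. continuous_on {-T..0} \<phi> \<and> (\<forall>\<theta>. \<theta> \<notin> {-T..0} \<longrightarrow> \<phi> \<theta> = 0)}"

definition cscale :: "complex \<Rightarrow> (real \<Rightarrow> complex ^ 2) \<Rightarrow> real \<Rightarrow> complex ^ 2" where
  "cscale c \<phi> = (\<lambda>\<theta>. c *s \<phi> \<theta>)"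

interpretation cfun: vector_space cscale
  by unfold_locales
    (simp_all add: cscale_def fun_eq_iff vector_add_ldistrib vector_sadd_rdistrib
      vector_smult_assoc)

text \<open>
  The linearization \<open>y'' + (\<alpha> - \<kappa>) y + (-1)\<^sup>n \<kappa> y(t - T) + 3 x(t)\<^sup>2 y = 0\<close> along \<open>x\<close>, as a first
  order system for \<open>(y, y')\<close> with initial history \<open>\<phi>\<close>. At \<open>t = 0\<close> the derivative is one-sided.
\<close>

definition linearized_solution ::
    "real \<Rightarrow> real \<Rightarrow> real \<Rightarrow> nat \<Rightarrow> (real \<Rightarrow> real) \<Rightarrow> (real \<Rightarrow> complex ^ 2) \<Rightarrow> (real \<Rightarrow> complex ^ 2) \<Rightarrow> bool"
  where
  "linearized_solution \<alpha> \<kappa> T n x \<phi> y \<longleftrightarrow>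
     continuous_on {-T..} y \<and> (\<forall>\<theta>\<in>{-T..0}. y \<theta> = \<phi> \<theta>) \<and>
     (\<forall>t\<ge>0. (y has_vector_derivative
        vector [y t $ 2,
                - of_real (\<alpha> - \<kappa>) * y t $ 1 - (-1) ^ n * of_real \<kappa> * y (t - T) $ 1
                  - 3 * of_real (x t ^ 2) * y t $ 1])
        (at t within {0..}))"

text \<open>
  The time-\<open>p\<close> map. A solution is determined by \<open>\<phi>\<close> on \<open>[-T, \<infinity>)\<close> only, so \<open>SOME\<close> picks an
  arbitrary extension to times before \<open>-T\<close>, which the map does not see since \<open>p > 0\<close>.
\<close>

definition monodromy ::
    "real \<Rightarrow> real \<Rightarrow> real \<Rightarrow> nat \<Rightarrow> real \<Rightarrow> (real \<Rightarrow> real) \<Rightarrow> (real \<Rightarrow> complex ^ 2) \<Rightarrow> real \<Rightarrow> complex ^ 2"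
  where
  "monodromy \<alpha> \<kappa> T n p x \<phi> =
     (\<lambda>\<theta>. if \<theta> \<in> {-T..0} then (SOME y. linearized_solution \<alpha> \<kappa> T n x \<phi> y) (p + \<theta>) else 0)"

definition floquet_multiplier ::
    "real \<Rightarrow> real \<Rightarrow> real \<Rightarrow> nat \<Rightarrow> real \<Rightarrow> (real \<Rightarrow> real) \<Rightarrow> complex \<Rightarrow> bool" where
  "floquet_multiplier \<alpha> \<kappa> T n p x \<mu> \<longleftrightarrow>
     \<mu> \<noteq> 0 \<and> (\<exists>\<phi>\<in>phase_space T. \<phi> \<noteq> 0 \<and> monodromy \<alpha> \<kappa> T n p x \<phi> = cscale \<mu> \<phi>)"

definition generalized_eigenspace ::
    "real \<Rightarrow> real \<Rightarrow> real \<Rightarrow> nat \<Rightarrow> real \<Rightarrow> (real \<Rightarrow> real) \<Rightarrow> complex \<Rightarrow> (real \<Rightarrow> complex ^ 2) set" where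
  "generalized_eigenspace \<alpha> \<kappa> T n p x \<mu> =
     {\<phi> \<in> phase_space T. \<exists>k. ((\<lambda>\<psi>. monodromy \<alpha> \<kappa> T n p x \<psi> - cscale \<mu> \<psi>) ^^ k) \<phi> = 0}"

definition algebraically_simple ::
    "real \<Rightarrow> real \<Rightarrow> real \<Rightarrow> nat \<Rightarrow> real \<Rightarrow> (real \<Rightarrow> real) \<Rightarrow> complex \<Rightarrow> bool" where
  "algebraically_simple \<alpha> \<kappa> T n p x \<mu> \<longleftrightarrow>
     floquet_multiplier \<alpha> \<kappa> T n p x \<mu> \<and> cfun.dim (generalized_eigenspace \<alpha> \<kappa> T n p x \<mu>) = 1"

text \<open>In the following two notions, \<open>p\<close> is meant to be the minimal period of \<open>x\<close>.\<close>

definition linearly_stable ::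
    "real \<Rightarrow> real \<Rightarrow> real \<Rightarrow> nat \<Rightarrow> real \<Rightarrow> (real \<Rightarrow> real) \<Rightarrow> bool" where
  "linearly_stable \<alpha> \<kappa> T n p x \<longleftrightarrow>
     algebraically_simple \<alpha> \<kappa> T n p x 1 \<and>
     (\<forall>\<mu>. floquet_multiplier \<alpha> \<kappa> T n p x \<mu> \<and> \<mu> \<noteq> 1 \<longrightarrow> norm \<mu> < 1)"

definition linearly_unstable ::
    "real \<Rightarrow> real \<Rightarrow> real \<Rightarrow> nat \<Rightarrow> real \<Rightarrow> (real \<Rightarrow> real) \<Rightarrow> bool" where
  "linearly_unstable \<alpha> \<kappa> T n p x \<longleftrightarrow>
     (\<exists>\<mu>. floquet_multiplier \<alpha> \<kappa> T n p x \<mu> \<and> norm \<mu> > 1)"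

end

theory Submission
  imports Defs
begin

text \<open>
  In the coordinate \<open>x = A sin \<theta>\<close> the Duffing orbits of positive energy satisfy a first order
  equation \<open>\<theta>' = g(\<theta>) > 0\<close>. This gives the half period \<open>\<integral>\<^sub>0\<^sup>\<pi> 1/g\<close>, strictly decreasing in \<open>A\<close>,
  and hence existence and uniqueness of \<open>x\<^sub>n\<close>.

  Let \<open>q = T/n\<close> be the half period of \<open>x\<^sub>n\<close>. Up to a square root of the multiplier, a Floquet
  eigenfunction satisfies \<open>y(t + q) = - \<nu> y(t)\<close>, so that the delayed term becomes an instantaneous one
  and \<open>y\<close> solves Hill's equation \<open>y'' + (\<alpha> + 3 x\<^sub>n\<^sup>2) y = \<kappa> (1 - \<nu>\<^sup>-\<^sup>n) y\<close> on one half period. After rescaling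
  to half period 1 the right-hand side is of order \<open>n\<^sup>-\<^sup>2\<close>, and perturbing from the pair \<open>u'\<close>, \<open>u + t u'\<close>
  (exact for \<open>\<alpha> = 0\<close>) yields \<open>\<nu> - 1 = \<nu> K n\<^sup>-\<^sup>2 (\<nu>\<^sup>-\<^sup>1 + \<dots> + \<nu>\<^sup>-\<^sup>n) + O(|\<nu>| n\<^sup>-\<^sup>2)\<close> with \<open>K = \<kappa> T\<^sup>2/3\<close>.
  For \<open>K < 0\<close>, multipliers \<open>\<nu> = exp(w/n) \<noteq> 1\<close> outside the open unit disk would produce in the limit a root
  \<open>w \<noteq> 0\<close>, \<open>Re w \<ge> 0\<close>, of \<open>w\<^sup>2 = K (1 - exp(-w))\<close>. But \<open>|w|\<^sup>2 \<le> 2|K| < \<pi>\<^sup>2\<close> forces \<open>|Im w| < \<pi>\<close>, where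
  the imaginary part of that equation has no solution. For \<open>K > 0\<close> the intermediate value theorem
  gives a real \<open>\<nu> > 1\<close>.
\<close>

section \<open>Delay differential equations with Lipschitz right-hand side\<close>

text \<open>The half period q = T/n tends to 0, and u(t) = q x(q t) solves the Duffing equation with
  \<epsilon> = \<alpha> q^2 and has half period 1, so the bounds on u are uniform in n and
  everything perturbs from \<epsilon> = 0. There the uncontrolled half-period map is, up to sign, a
  Jordan block with eigenvalue 1: u' comes from time shifts, and u + t u' is the derivative at c = 1
  of the scaled solution c u(c t). The obstacle is uniformity near \<nu> = 1, where the trivial
  multiplier sits. It is overcome because 1 - \<nu>^-n contains the factor \<nu> - 1, which cancels
  from the first boundary relation. The factor 1/3 in K is the ratio of the integral of u'^2 to the
  Wronskian of the pair. Simplicity of the multiplier 1 needs two further facts: \<nu> = -1 also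
  squares to 1 and has to be excluded, and a Jordan chain would make the control force Hill's
  equation resonantly, which is impossible for \<kappa> \<noteq> 0. At \<kappa> = 0 the generalized
  eigenspace has at least two dimensions while no multiplier leaves the closed unit disk, so the
  orbit is neither linearly stable nor linearly unstable.\<close>

lemma gronwall_zero:
  fixes w :: "real \<Rightarrow> 'a::real_inner"
  assumes "a \<le> b" "w a = 0"
    and der: "\<And>t. t \<in> {a..b} \<Longrightarrow> (w has_vector_derivative w' t) (at t within {a..b})"
    and bound: "\<And>t. t \<in> {a..b} \<Longrightarrow> norm (w' t) \<le> M * norm (w t)"
    and "t \<in> {a..b}"
  shows "w t = 0"
proof -
  define E where "E t = exp (- 2 * M * t) * (w t \<bullet> w t)" for t
  have E_der: "(E has_real_derivative
      exp (- 2 * M * s) * (2 * (w s \<bullet> w' s)) - 2 * M * exp (- 2 * M * s) * (w s \<bullet> w s))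
      (at s within {a..b})" if "s \<in> {a..b}" for s
    unfolding E_def has_real_derivative_iff_has_vector_derivative
    apply (rule has_vector_derivative_eq_rhs)
     apply (rule has_vector_derivative_mult)
      apply (rule has_real_derivative_iff_has_vector_derivative[THEN iffD1])
      apply (rule derivative_eq_intros refl)+
     apply (rule bounded_bilinear.has_vector_derivative[OF bounded_bilinear_inner der[OF that] der[OF that]])
    by (simp add: inner_commute algebra_simps)
  have nonpos: "exp (- 2 * M * s) * (2 * (w s \<bullet> w' s)) - 2 * M * exp (- 2 * M * s) * (w s \<bullet> w s) \<le> 0"
    if "s \<in> {a..b}" for s
  proof -
    have "w s \<bullet> w' s \<le> norm (w s) * norm (w' s)"
      by (rule norm_cauchy_schwarz)
    also have "\<dots> \<le> norm (w s) * (M * norm (w s))"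
      by (intro mult_left_mono bound that) simp
    also have "\<dots> = M * (w s \<bullet> w s)"
      by (simp add: dot_square_norm power2_eq_square)
    finally have "exp (- 2 * M * s) * (w s \<bullet> w' s) \<le> exp (- 2 * M * s) * (M * (w s \<bullet> w s))"
      by (intro mult_left_mono) auto
    then show ?thesis by (simp add: algebra_simps)
  qed
  have "E a \<ge> E t"
  proof (rule DERIV_nonpos_imp_decreasing_open[of a t])
    show "a \<le> t" using assms(5) by simp
    show "\<exists>y. DERIV E s :> y \<and> y \<le> 0" if "a < s" "s < t" for s
    proof -
      have s: "s \<in> {a..b}" and "at s within {a..b} = at s"
        using that assms(5) by (auto intro: at_within_Icc_at)
      then show ?thesis using E_der[OF s] nonpos[OF s] by metis
    qed
    have "continuous_on {a..b} E"
      by (rule DERIV_continuous_on[OF E_der])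
    then show "continuous_on {a..t} E"
      using assms(5) by (elim continuous_on_subset) auto
  qed
  moreover have "E a = 0" using assms by (simp add: E_def)
  ultimately have "w t \<bullet> w t \<le> 0"
    unfolding E_def by (simp add: mult_le_0_iff)
  then show ?thesis by (metis inner_ge_zero inner_eq_zero_iff order_antisym)
qed

lemma integral_has_vector_derivative_atLeast:
  fixes f :: "real \<Rightarrow> 'a::banach"
  assumes "continuous_on {a..} f" "a \<le> x"
  shows "((\<lambda>u. integral {a..u} f) has_vector_derivative f x) (at x within {a..})"
proof -
  have "((\<lambda>u. integral {a..u} f) has_vector_derivative f x) (at x within {a..x+1})"
    using assms by (intro integral_has_vector_derivative continuous_on_subset[OF assms(1)]) auto
  moreover have "at x within {a..x+1} = at x within {a..}"
    by (rule at_within_nhd[where S="{..<x+1}"]) auto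
  ultimately show ?thesis by simp
qed

lemma delay_ivp_exists:
  fixes f :: "real \<Rightarrow> 'a \<Rightarrow> 'a \<Rightarrow> 'a::banach"
  assumes "T \<ge> 0" "M > 0"
    and cont: "\<And>v w. continuous_on {0..} v \<Longrightarrow> continuous_on {0..} w \<Longrightarrow>
      continuous_on {0..} (\<lambda>t. f t (v t) (w t))"
    and zero: "\<And>t. t \<ge> 0 \<Longrightarrow> f t 0 0 = 0"
    and lip: "\<And>t v w v' w'. t \<ge> 0 \<Longrightarrow>
      norm (f t v w - f t v' w') \<le> M * (norm (v - v') + norm (w - w'))"
    and phi: "continuous_on {-T..0} \<phi>"
  obtains y where "continuous_on UNIV y" "\<forall>\<theta>\<in>{-T..0}. y \<theta> = \<phi> \<theta>"
    "\<forall>t\<ge>0. (y has_vector_derivative f t (y t) (y (t - T))) (at t within {0..})"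
proof -
  define K where "K = 4 * M"
  have "K > 0" using assms by (simp add: K_def)
  define e where "e s = exp (K * max 0 s)" for s
  have e_pos: "e s > 0" and e_ge1: "e s \<ge> 1" for s
    using \<open>K > 0\<close> by (auto simp: e_def)
  have e_mono: "e s \<le> e t" if "s \<le> t" for s t
    using \<open>K > 0\<close> that unfolding e_def by (auto intro!: mult_left_mono)
  \<comment> \<open>The history is continued by its end values, which makes it bounded and
    continuous on the whole line.\<close>
  define \<phi>0 where "\<phi>0 s = \<phi> (max (-T) (min s 0))" for s
  have phi0_cont: "continuous_on A \<phi>0" for A
    unfolding \<phi>0_def using \<open>T \<ge> 0\<close>
    by (intro continuous_on_compose2[OF phi] continuous_intros) auto
  have "bounded (\<phi> ` {-T..0})"
    by (intro compact_imp_bounded compact_continuous_image phi) auto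
  then obtain B where B: "norm (\<phi> s) \<le> B" if "s \<in> {-T..0}" for s
    unfolding bounded_iff by blast
  have phi0_le: "norm (\<phi>0 s) \<le> B" for s
    unfolding \<phi>0_def using \<open>T \<ge> 0\<close> by (intro B) auto
  then have "B \<ge> 0" by (meson norm_ge_zero order_trans)
  \<comment> \<open>The unknown \<open>z\<close> is the deviation of the solution from
    \<open>\<phi>0\<close>, divided by the weight; this quotient is bounded although solutions may
    grow exponentially.\<close>
  define Y :: "(real \<Rightarrow>\<^sub>C 'a) \<Rightarrow> real \<Rightarrow> 'a"
    where "Y z s = \<phi>0 s + e s *\<^sub>R apply_bcontfun z s" for z s
  have Y_cont: "continuous_on A (Y z)" for A z
    unfolding Y_def e_def by (intro continuous_intros phi0_cont) auto
  have YT_cont: "continuous_on A (\<lambda>s. Y z (s - T))" for A z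
    by (rule continuous_on_compose2[OF Y_cont[of UNIV]]) (auto intro!: continuous_intros)
  define r where "r z s = f s (Y z s) (Y z (s - T))" for z s
  have r_cont: "continuous_on {0..} (r z)" for z
    unfolding r_def by (intro cont Y_cont YT_cont)
  have r_int: "r z integrable_on {0..t}" for z t
    by (rule integrable_continuous_real) (rule continuous_on_subset[OF r_cont], auto)
  have e_int: "((\<lambda>s. c * e s) has_integral c * (e t - 1) / K) {0..t}" if "t \<ge> 0" for c t
  proof -
    have "((\<lambda>s. c * exp (K * s)) has_integral (c * exp (K * t) / K - c * exp (K * 0) / K)) {0..t}"
      using that \<open>K > 0\<close>
      by (intro fundamental_theorem_of_calculus)
        (auto simp: has_real_derivative_iff_has_vector_derivative[symmetric]
          intro!: derivative_eq_intros)
    then have "((\<lambda>s. c * exp (K * s)) has_integral c * (e t - 1) / K) {0..t}"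
      using that by (simp add: e_def algebra_simps diff_divide_distrib)
    then show ?thesis
      by (rule has_integral_eq[rotated]) (simp add: e_def)
  qed
  have r_bound: "norm (r z s) \<le> (2 * M * (B + norm z)) * e s" if "s \<ge> 0" for z s
  proof -
    have *: "norm (Y z u) \<le> (B + norm z) * e s" if "u \<le> s" for u
    proof -
      have "norm (Y z u) \<le> norm (\<phi>0 u) + e u * norm (apply_bcontfun z u)"
        unfolding Y_def using norm_triangle_ineq[of "\<phi>0 u"] e_pos[of u] by (metis abs_of_pos norm_scaleR)
      also have "\<dots> \<le> B * e s + e s * norm z"
      proof (intro add_mono mult_mono)
        have "norm (\<phi>0 u) \<le> B * 1" using phi0_le by simp
        also have "\<dots> \<le> B * e s" by (intro mult_left_mono e_ge1 \<open>B \<ge> 0\<close>)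
        finally show "norm (\<phi>0 u) \<le> B * e s" .
      qed (use that e_mono norm_bounded e_pos in \<open>auto intro: less_imp_le\<close>)
      finally show ?thesis by (simp add: algebra_simps)
    qed
    have "norm (r z s) \<le> M * (norm (Y z s) + norm (Y z (s - T)))"
      using lip[OF that, of "Y z s" "Y z (s - T)" 0 0] zero[OF that] by (simp add: r_def)
    also have "\<dots> \<le> M * ((B + norm z) * e s + (B + norm z) * e s)"
      using \<open>M > 0\<close> \<open>T \<ge> 0\<close> by (intro mult_left_mono add_mono *) auto
    finally show ?thesis by (simp add: algebra_simps)
  qed
  have r_diff: "norm (r z s - r z' s) \<le> (2 * M * dist z z') * e s" if "s \<ge> 0" for z z' s
  proof -
    have *: "norm (Y z u - Y z' u) \<le> dist z z' * e s" if "u \<le> s" for u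
    proof -
      have "norm (Y z u - Y z' u) = e u * dist (apply_bcontfun z u) (apply_bcontfun z' u)"
        using e_pos[of u] by (simp add: Y_def dist_norm flip: scaleR_diff_right)
      also have "\<dots> \<le> e s * dist z z'"
        using that e_mono dist_bounded e_pos by (intro mult_mono) (auto intro: less_imp_le)
      finally show ?thesis by (simp add: mult.commute)
    qed
    have "norm (r z s - r z' s) \<le> M * (norm (Y z s - Y z' s) + norm (Y z (s - T) - Y z' (s - T)))"
      using lip[OF that] by (simp add: r_def)
    also have "\<dots> \<le> M * (dist z z' * e s + dist z z' * e s)"
      using \<open>M > 0\<close> \<open>T \<ge> 0\<close> by (intro mult_left_mono add_mono *) auto
    finally show ?thesis by (simp add: algebra_simps)
  qed
  define J where "J z t = integral {0..t} (r z)" for z t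
  have J_der: "(J z has_vector_derivative r z t) (at t within {0..})" if "t \<ge> 0" for z t
    unfolding J_def using that by (intro integral_has_vector_derivative_atLeast r_cont)
  have J_cont: "continuous_on {0..} (J z)" for z
    using J_der by (intro continuous_on_vector_derivative) auto
  define G where "G z t = (1 / e t) *\<^sub>R J z (max 0 t)" for z t
  have scaled_int: "norm ((1 / e t) *\<^sub>R integral {0..max 0 t} g) \<le> c / K"
    if g: "g integrable_on {0..max 0 t}" and le: "\<And>s. s \<ge> 0 \<Longrightarrow> norm (g s) \<le> c * e s" for g :: "real \<Rightarrow> 'a" and c t
  proof -
    have "0 \<le> c * e 0" using le[of 0] by (meson norm_ge_zero order_refl order_trans)
    then have "c \<ge> 0" using e_pos[of 0] by (simp add: zero_le_mult_iff)
    have "norm (integral {0..max 0 t} g) \<le> integral {0..max 0 t} (\<lambda>s. c * e s)"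
      using e_int[of "max 0 t" c] le
      by (intro integral_norm_bound_integral g) (auto intro: has_integral_integrable)
    also have "\<dots> = c * (e (max 0 t) - 1) / K"
      by (rule integral_unique) (rule e_int, simp)
    also have "\<dots> \<le> c * e t / K"
      using \<open>c \<ge> 0\<close> \<open>K > 0\<close> by (intro divide_right_mono mult_left_mono) (auto simp: e_def)
    finally have "(1 / e t) * norm (integral {0..max 0 t} g) \<le> (1 / e t) * (c * e t / K)"
      using e_pos[of t] by (intro mult_left_mono) auto
    then show ?thesis using e_pos[of t] by (simp add: abs_of_pos)
  qed
  have G_in: "G z \<in> bcontfun" for z
  proof (rule bcontfun_normI)
    show "continuous_on UNIV (G z)"
      unfolding G_def using e_pos unfolding e_def
      by (intro continuous_intros continuous_on_compose2[OF J_cont]) (auto simp: less_imp_neq[symmetric])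
    show "norm (G z t) \<le> (2 * M * (B + norm z)) / K" for t
      unfolding G_def J_def by (intro scaled_int r_int r_bound)
  qed
  have G_diff: "dist (Bcontfun (G z)) (Bcontfun (G z')) \<le> 1/2 * dist z z'" for z z'
  proof (rule dist_bound)
    fix t
    have "dist (G z t) (G z' t) = norm ((1 / e t) *\<^sub>R integral {0..max 0 t} (\<lambda>s. r z s - r z' s))"
      unfolding G_def J_def dist_norm by (simp add: integral_diff r_int scaleR_diff_right)
    also have "\<dots> \<le> (2 * M * dist z z') / K"
      by (intro scaled_int r_diff integrable_diff r_int)
    also have "\<dots> = 1/2 * dist z z'" using \<open>M > 0\<close> by (simp add: K_def)
    finally show "dist (apply_bcontfun (Bcontfun (G z)) t) (apply_bcontfun (Bcontfun (G z')) t)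
        \<le> 1/2 * dist z z'"
      by (simp add: Bcontfun_inverse[OF G_in])
  qed
  have "\<exists>!z. Bcontfun (G z) = z"
    by (rule banach_fix_type[of "1/2"]) (use G_diff in auto)
  then obtain z where "Bcontfun (G z) = z" by auto
  then have z: "apply_bcontfun z t = G z t" for t
    by (metis Bcontfun_inverse[OF G_in])
  have Yneg: "Y z s = \<phi>0 s" if "s \<le> 0" for s
    using that by (simp add: Y_def z G_def J_def max_def)
  have Ypos: "Y z s = \<phi> 0 + J z s" if "s \<ge> 0" for s
    using that e_pos[of s] \<open>T \<ge> 0\<close> by (simp add: Y_def z G_def \<phi>0_def max_def)
  show thesis
  proof
    show "continuous_on UNIV (Y z)" by (rule Y_cont)
    show "\<forall>\<theta>\<in>{-T..0}. Y z \<theta> = \<phi> \<theta>" by (auto simp: Yneg \<phi>0_def)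
    show "\<forall>t\<ge>0. (Y z has_vector_derivative f t (Y z t) (Y z (t - T))) (at t within {0..})"
    proof (intro allI impI)
      fix t :: real assume "t \<ge> 0"
      have "((\<lambda>s. \<phi> 0 + J z s) has_vector_derivative r z t) (at t within {0..})"
        by (rule derivative_eq_intros J_der \<open>t \<ge> 0\<close> refl)+ simp
      then have "(Y z has_vector_derivative r z t) (at t within {0..})"
        by (rule has_vector_derivative_transform[rotated 2]) (use \<open>t \<ge> 0\<close> Ypos in auto)
      then show "(Y z has_vector_derivative f t (Y z t) (Y z (t - T))) (at t within {0..})"
        by (simp add: r_def)
    qed
  qed
qed

text \<open>Method of steps: on each interval of length T the delayed values are already known to
  agree, so the difference satisfies an ordinary Gronwall inequality.\<close>

lemma delay_ivp_unique:
  fixes f :: "real \<Rightarrow> 'a \<Rightarrow> 'a \<Rightarrow> 'a::real_inner"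
  assumes "T > 0"
    and lip: "\<And>t v w v' w'. t \<ge> 0 \<Longrightarrow>
      norm (f t v w - f t v' w') \<le> M * (norm (v - v') + norm (w - w'))"
    and init: "\<And>s. s \<in> {-T..0} \<Longrightarrow> y s = z s"
    and y: "\<And>t. t \<ge> 0 \<Longrightarrow> (y has_vector_derivative f t (y t) (y (t - T))) (at t within {0..})"
    and z: "\<And>t. t \<ge> 0 \<Longrightarrow> (z has_vector_derivative f t (z t) (z (t - T))) (at t within {0..})"
    and "t \<ge> - T"
  shows "y t = z t"
proof -
  have steps: "\<forall>t\<in>{-T..real k * T}. y t = z t" for k :: nat
  proof (induction k)
    case 0
    then show ?case using init by simp
  next
    case (Suc k)
    let ?a = "real k * T" and ?b = "real (Suc k) * T"
    have a: "?a \<ge> 0" using \<open>T > 0\<close> by simp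
    show ?case
    proof
      fix t assume t: "t \<in> {-T..?b}"
      show "y t = z t"
      proof (cases "t \<le> ?a")
        case True
        then show ?thesis using Suc t by auto
      next
        case False
        have "(\<lambda>t. y t - z t) t = 0"
        proof (rule gronwall_zero)
          show "?a \<le> ?b" using \<open>T > 0\<close> by (simp add: algebra_simps)
          have "- T \<le> ?a" using a \<open>T > 0\<close> by linarith
          then have "?a \<in> {-T..?a}" by simp
          then show "y ?a - z ?a = 0" using Suc by simp
          show "((\<lambda>t. y t - z t) has_vector_derivative
              f s (y s) (y (s - T)) - f s (z s) (z (s - T))) (at s within {?a..?b})"
            if "s \<in> {?a..?b}" for s
            using that a
            by (intro has_vector_derivative_diff has_vector_derivative_within_subset[OF y]
                has_vector_derivative_within_subset[OF z]) auto
          show "norm (f s (y s) (y (s - T)) - f s (z s) (z (s - T))) \<le> M * norm (y s - z s)"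
            if "s \<in> {?a..?b}" for s
          proof -
            have "- T \<le> s - T" "s - T \<le> ?a"
              using that a unfolding atLeastAtMost_iff by (linarith, simp add: algebra_simps)
            then have "y (s - T) = z (s - T)" using Suc by simp
            then show ?thesis using lip[of s "y s" "y (s - T)" "z s" "z (s - T)"] that a by auto
          qed
          show "t \<in> {?a..?b}" using False t by auto
        qed
        then show ?thesis by simp
      qed
    qed
  qed
  obtain k :: nat where "t / T < real k" using reals_Archimedean2 by blast
  then have "t \<le> real k * T" using \<open>T > 0\<close> by (simp add: field_simps)
  then show ?thesis using steps[of k] \<open>t \<ge> - T\<close> by auto
qed

section \<open>Periodic orbits of the Duffing equation\<close>

lemma duffing_solutionI:
  assumes "\<And>t. (x has_real_derivative v t) (at t)"
    and "\<And>t. (v has_real_derivative - \<alpha> * x t - x t ^ 3) (at t)"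
  shows "duffing_solution \<alpha> x" "deriv x = v"
proof -
  show "deriv x = v" using assms(1) by (auto intro: DERIV_imp_deriv)
  then show "duffing_solution \<alpha> x" using assms by (simp add: duffing_solution_def)
qed

text \<open>Three values of c matter: 1 is a time shift, -1 a time reversal, and the half period of
  an orbit normalises that half period to 1.\<close>

lemma duffing_affine:
  assumes "duffing_solution \<alpha> x"
  shows "duffing_solution (\<alpha> * c\<^sup>2) (\<lambda>t. c * x (c * t + s))"
    and "deriv (\<lambda>t. c * x (c * t + s)) = (\<lambda>t. c\<^sup>2 * deriv x (c * t + s))"
proof -
  have x: "(x has_real_derivative deriv x t) (at t)"
    "(deriv x has_real_derivative - \<alpha> * x t - x t ^ 3) (at t)" for t
    using assms by (auto simp: duffing_solution_def)
  have 1: "((\<lambda>t. c * x (c * t + s)) has_real_derivative c\<^sup>2 * deriv x (c * t + s)) (at t)" for t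
    by (rule derivative_eq_intros DERIV_chain2[OF x(1)] refl)+ (simp add: power2_eq_square)
  have 2: "((\<lambda>t. c\<^sup>2 * deriv x (c * t + s)) has_real_derivative
      - (\<alpha> * c\<^sup>2) * (c * x (c * t + s)) - (c * x (c * t + s)) ^ 3) (at t)" for t
    by (rule derivative_eq_intros DERIV_chain2[OF x(2)] refl)+
      (simp add: power2_eq_square power3_eq_cube algebra_simps)
  show "duffing_solution (\<alpha> * c\<^sup>2) (\<lambda>t. c * x (c * t + s))"
    "deriv (\<lambda>t. c * x (c * t + s)) = (\<lambda>t. c\<^sup>2 * deriv x (c * t + s))"
    using duffing_solutionI[OF 1 2] by auto
qed

lemma duffing_continuous:
  assumes "duffing_solution \<alpha> x"
  shows "continuous_on S x" "continuous_on S (deriv x)"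
  using assms unfolding duffing_solution_def
  by (blast intro: DERIV_isCont continuous_at_imp_continuous_on)+

text \<open>The cubic term is only locally Lipschitz; a common bound of both solutions on the
  compact interval supplies the Gronwall constant.\<close>

lemma duffing_unique_forward:
  assumes x: "duffing_solution \<alpha> x" and z: "duffing_solution \<alpha> z"
    and init: "x 0 = z 0" "deriv x 0 = deriv z 0" and "t \<ge> 0"
  shows "x t = z t"
proof -
  have "bounded (x ` {0..t} \<union> z ` {0..t})"
    using duffing_continuous[OF x] duffing_continuous[OF z]
    by (auto intro!: compact_imp_bounded compact_continuous_image)
  then obtain C where C: "\<And>y. y \<in> x ` {0..t} \<union> z ` {0..t} \<Longrightarrow> norm y \<le> C"
    unfolding bounded_iff by blast
  have "C \<ge> 0" using C[of "x 0"] \<open>t \<ge> 0\<close> by (force intro: order_trans[OF abs_ge_zero])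
  define w where "w s = (x s - z s, deriv x s - deriv z s)" for s
  define w' where "w' s = (deriv x s - deriv z s,
    (- \<alpha> * x s - x s ^ 3) - (- \<alpha> * z s - z s ^ 3))" for s
  have "w t = 0"
  proof (rule gronwall_zero[where a=0 and b=t and w'=w' and M="1 + \<bar>\<alpha>\<bar> + 3 * C\<^sup>2"])
    show "w 0 = 0" by (simp add: w_def init zero_prod_def)
    show "(w has_vector_derivative w' s) (at s within {0..t})" for s
      unfolding w_def w'_def using x z
      by (auto simp: duffing_solution_def has_real_derivative_iff_has_vector_derivative
          intro!: has_vector_derivative_Pair has_vector_derivative_diff
          intro: has_vector_derivative_at_within)
    show "norm (w' s) \<le> (1 + \<bar>\<alpha>\<bar> + 3 * C\<^sup>2) * norm (w s)" if "s \<in> {0..t}" for s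
    proof -
      define d where "d = x s - z s"
      have b: "\<bar>x s\<bar> \<le> C" "\<bar>z s\<bar> \<le> C" using C[of "x s"] C[of "z s"] that by auto
      have "(- \<alpha> * x s - x s ^ 3) - (- \<alpha> * z s - z s ^ 3) = - (\<alpha> + (x s * x s + x s * z s + z s * z s)) * d"
        by (simp add: d_def algebra_simps power3_eq_cube)
      also have "\<bar>\<dots>\<bar> \<le> (\<bar>\<alpha>\<bar> + 3 * C\<^sup>2) * \<bar>d\<bar>"
      proof -
        have "\<bar>x s * x s\<bar> \<le> C * C" "\<bar>x s * z s\<bar> \<le> C * C" "\<bar>z s * z s\<bar> \<le> C * C"
          unfolding abs_mult using b \<open>C \<ge> 0\<close> by (intro mult_mono; simp)+
        then have "\<bar>\<alpha> + (x s * x s + x s * z s + z s * z s)\<bar> \<le> \<bar>\<alpha>\<bar> + 3 * C\<^sup>2"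
          unfolding power2_eq_square by linarith
        then show ?thesis by (simp add: abs_mult mult_right_mono)
      qed
      also have "\<dots> \<le> (\<bar>\<alpha>\<bar> + 3 * C\<^sup>2) * norm (w s)"
        using norm_fst_le[of "x s - z s" "deriv x s - deriv z s"] by (intro mult_left_mono) (auto simp: w_def d_def)
      finally have "norm (w' s) \<le> norm (w s) + (\<bar>\<alpha>\<bar> + 3 * C\<^sup>2) * norm (w s)"
        unfolding w'_def using norm_snd_le[of "deriv x s - deriv z s" "x s - z s"] norm_Pair_le
        by (smt (verit, best) real_norm_def snd_conv w_def)
      then show ?thesis by (simp add: algebra_simps)
    qed
  qed (use \<open>t \<ge> 0\<close> in auto)
  then show ?thesis by (simp add: w_def zero_prod_def)
qed

lemma duffing_unique:
  assumes x: "duffing_solution \<alpha> x" and z: "duffing_solution \<alpha> z"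
    and init: "x 0 = z 0" "deriv x 0 = deriv z 0"
  shows "x t = z t"
proof (cases "t \<ge> 0")
  case True
  then show ?thesis using duffing_unique_forward assms by blast
next
  case False
  show ?thesis
    using duffing_unique_forward[OF duffing_affine(1)[OF x, of "-1" 0] duffing_affine(1)[OF z, of "-1" 0], of "-t"]
      duffing_affine(2)[OF x, of "-1" 0] duffing_affine(2)[OF z, of "-1" 0] init False by simp
qed

lemma hamiltonian_const:
  assumes "duffing_solution \<alpha> x"
  shows "hamiltonian \<alpha> (x t) (deriv x t) = hamiltonian \<alpha> (x 0) (deriv x 0)"
proof -
  have x: "(x has_real_derivative deriv x t) (at t)"
    "(deriv x has_real_derivative - \<alpha> * x t - x t ^ 3) (at t)" for t
    using assms by (auto simp: duffing_solution_def)
  have "((\<lambda>t. hamiltonian \<alpha> (x t) (deriv x t)) has_real_derivative 0) (at t)" for t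
    unfolding hamiltonian_def
    by (auto intro!: derivative_eq_intros x simp: field_simps power3_eq_cube power2_eq_square)
  then show ?thesis by (rule DERIV_isconst_all[OF allI])
qed

lemma minimal_period_unique:
  "minimal_period p x \<Longrightarrow> minimal_period q x \<Longrightarrow> p = q"
  unfolding minimal_period_def by (metis linorder_neqE)

text \<open>Integrals over empty intervals are 0, so the difference is the oriented integral from 0
  to t for either sign of t.\<close>

lemma integral_signed_has_derivative:
  fixes h :: "real \<Rightarrow> real"
  assumes h: "continuous_on UNIV h"
  shows "((\<lambda>t. integral {0..t} h - integral {t..0} h) has_real_derivative h t) (at t)"
proof -
  define N where "N = \<bar>t\<bar> + 1"
  have N: "- N \<le> 0" by (simp add: N_def)
  have int: "h integrable_on {a..b}" for a b
    by (intro integrable_continuous_real continuous_on_subset[OF h]) auto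
  have eq: "integral {-N..u} h - integral {-N..0} h = integral {0..u} h - integral {u..0} h"
    if "u \<in> {-N..N}" for u
  proof (cases "u \<ge> 0")
    case True
    then show ?thesis
      using Henstock_Kurzweil_Integration.integral_combine[where f=h and a="-N" and c=0 and b=u] int N by (cases "u = 0") auto
  next
    case False
    then show ?thesis
      using Henstock_Kurzweil_Integration.integral_combine[where f=h and a="-N" and c=u and b=0] int that by auto
  qed
  have der: "((\<lambda>u. integral {-N..u} h - integral {-N..0} h) has_real_derivative h t)
      (at t within {-N..N})"
    by (rule derivative_eq_intros refl integral_has_real_derivative continuous_on_subset[OF h])+
      (auto simp: N_def)
  have "t \<in> {-N..N}" by (auto simp: N_def)
  then have "((\<lambda>t. integral {0..t} h - integral {t..0} h) has_real_derivative h t)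
      (at t within {-N..N})"
    unfolding has_real_derivative_iff_has_vector_derivative
    by (rule has_vector_derivative_transform[OF _ _
          der[unfolded has_real_derivative_iff_has_vector_derivative]]) (rule eq[symmetric])
  moreover have "at t within {-N..N} = at t"
    by (rule at_within_Icc_at) (auto simp: N_def)
  ultimately show ?thesis by simp
qed

text \<open>
  In the coordinate \<open>x = A sin \<theta>\<close> the orbit of amplitude \<open>A\<close> moves with a speed \<open>\<theta>' > 0\<close>
  that depends on \<open>\<theta>\<close> only; this is the energy identity divided by \<open>A\<^sup>2 cos\<^sup>2 \<theta>\<close>.
\<close>

definition angular_speed :: "real \<Rightarrow> real \<Rightarrow> real \<Rightarrow> real" where
  "angular_speed \<alpha> A \<theta> = sqrt (\<alpha> + A\<^sup>2 * (1 + (sin \<theta>)\<^sup>2) / 2)"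

definition angular_time :: "real \<Rightarrow> real \<Rightarrow> real \<Rightarrow> real" where
  "angular_time \<alpha> A \<theta> =
     integral {0..\<theta>} (\<lambda>s. 1 / angular_speed \<alpha> A s) - integral {\<theta>..0} (\<lambda>s. 1 / angular_speed \<alpha> A s)"

definition half_period :: "real \<Rightarrow> real \<Rightarrow> real" where
  "half_period \<alpha> A = angular_time \<alpha> A pi"

definition duffing_orbit :: "real \<Rightarrow> real \<Rightarrow> real \<Rightarrow> real" where
  "duffing_orbit \<alpha> A t = A * sin (inv (angular_time \<alpha> A) t)"

text \<open>The orbit of amplitude A has energy A^2/2 (\<alpha> + A^2/2), so the second assumption
  says that the energy is positive.\<close>

locale duffing_amplitude =
  fixes \<alpha> A :: real
  assumes A_pos: "A > 0" and \<alpha>A_pos: "\<alpha> + A\<^sup>2 / 2 > 0"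
begin

abbreviation g where "g \<equiv> angular_speed \<alpha> A"
abbreviation G where "G \<equiv> angular_time \<alpha> A"
abbreviation \<rho> where "\<rho> \<equiv> half_period \<alpha> A"
abbreviation \<Theta> where "\<Theta> \<equiv> inv (angular_time \<alpha> A)"
abbreviation X where "X \<equiv> duffing_orbit \<alpha> A"

lemma g_arg: "\<alpha> + A\<^sup>2 / 2 \<le> \<alpha> + A\<^sup>2 * (1 + (sin \<theta>)\<^sup>2) / 2"
  "\<alpha> + A\<^sup>2 * (1 + (sin \<theta>)\<^sup>2) / 2 \<le> \<alpha> + A\<^sup>2"
proof -
  have "A\<^sup>2 * 1 \<le> A\<^sup>2 * (1 + (sin \<theta>)\<^sup>2)" "A\<^sup>2 * (1 + (sin \<theta>)\<^sup>2) \<le> A\<^sup>2 * 2"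
    by (intro mult_left_mono; simp add: abs_square_le_1)+
  then show "\<alpha> + A\<^sup>2 / 2 \<le> \<alpha> + A\<^sup>2 * (1 + (sin \<theta>)\<^sup>2) / 2"
    "\<alpha> + A\<^sup>2 * (1 + (sin \<theta>)\<^sup>2) / 2 \<le> \<alpha> + A\<^sup>2" by auto
qed

lemma g_bounds: "sqrt (\<alpha> + A\<^sup>2 / 2) \<le> g \<theta>" "g \<theta> \<le> sqrt (\<alpha> + A\<^sup>2)" "g \<theta> > 0"
  using g_arg[of \<theta>] \<alpha>A_pos by (auto simp: angular_speed_def intro: real_sqrt_le_mono)

lemma g_power2: "(g \<theta>)\<^sup>2 = \<alpha> + A\<^sup>2 * (1 + (sin \<theta>)\<^sup>2) / 2"
  using g_arg[of \<theta>] \<alpha>A_pos by (simp add: angular_speed_def)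

lemma G_deriv: "(G has_real_derivative 1 / g \<theta>) (at \<theta>)"
  unfolding angular_time_def
proof (rule integral_signed_has_derivative)
  have "g \<theta> \<noteq> 0" for \<theta> using g_bounds(3)[of \<theta>] by simp
  then show "continuous_on UNIV (\<lambda>s. 1 / g s)"
    unfolding angular_speed_def by (intro continuous_intros) auto
qed

lemma G_0: "G 0 = 0"
  by (simp add: angular_time_def)

lemma G_mono: "\<theta> < \<theta>' \<Longrightarrow> G \<theta> < G \<theta>'"
  using G_deriv g_bounds(3) by (metis DERIV_pos_imp_increasing divide_pos_pos zero_less_one)

lemma \<rho>_pos: "\<rho> > 0"
  using G_mono[of 0 pi] by (simp add: half_period_def G_0)

lemma G_shift: "G (\<theta> + pi) = G \<theta> + \<rho>"
proof -
  have "((\<lambda>\<theta>. G (\<theta> + pi) - G \<theta>) has_real_derivative 0) (at \<theta>)" for \<theta>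
    by (rule derivative_eq_intros G_deriv DERIV_chain2[OF G_deriv] refl)+
      (simp add: angular_speed_def)
  then have "G (\<theta> + pi) - G \<theta> = G (0 + pi) - G 0" by (rule DERIV_isconst_all[OF allI])
  then show ?thesis by (simp add: half_period_def G_0)
qed

text \<open>By \<open>G_shift\<close> the value at k pi is k times the half period, so
  \<open>G\<close> is unbounded in both directions.\<close>

lemma G_surj: "\<exists>\<theta>. G \<theta> = t"
proof -
  have k: "G (real k * pi) = real k * \<rho>" "G (- real k * pi) = - real k * \<rho>" for k
  proof (induction k)
    case (Suc k)
    { case 1 then show ?case using G_shift[of "real k * pi"] Suc(1) by (simp add: algebra_simps) }
    { case 2 then show ?case using G_shift[of "- real (Suc k) * pi"] Suc(2) by (simp add: algebra_simps) }
  qed (auto simp: G_0)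
  obtain k :: nat where "\<bar>t\<bar> / \<rho> < real k" using reals_Archimedean2 by blast
  then have "\<bar>t\<bar> \<le> real k * \<rho>" using \<rho>_pos by (simp add: field_simps)
  then have "\<exists>\<theta>\<ge>- real k * pi. \<theta> \<le> real k * pi \<and> G \<theta> = t"
    by (intro IVT') (use \<open>\<bar>t\<bar> \<le> real k * \<rho>\<close> \<rho>_pos in \<open>auto simp: k[simplified] abs_le_iff intro!: DERIV_continuous_on has_field_derivative_at_within[OF G_deriv]\<close>)
  then show ?thesis by blast
qed

lemma \<Theta>_inverse: "G (\<Theta> t) = t" "\<Theta> (G \<theta>) = \<theta>"
proof -
  have "inj G" by (rule linorder_injI) (use G_mono in force)
  moreover have "surj G" using G_surj by (metis surjI)
  ultimately show "G (\<Theta> t) = t" "\<Theta> (G \<theta>) = \<theta>" by (auto simp: surj_f_inv_f)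
qed

lemma \<Theta>_deriv: "(\<Theta> has_real_derivative g (\<Theta> t)) (at t)"
proof -
  have "(\<Theta> has_derivative (*) (g (\<Theta> t))) (at (G (\<Theta> t)))"
  proof (rule has_derivative_inverse_strong[where S=UNIV and f'="(*) (1 / g (\<Theta> t))" and f=G])
    show "(G has_derivative (*) (1 / g (\<Theta> t))) (at (\<Theta> t))"
      using G_deriv by (simp add: has_field_derivative_def)
    show "(*) (1 / g (\<Theta> t)) \<circ> (*) (g (\<Theta> t)) = id"
      using g_bounds(3)[of "\<Theta> t"] by (auto simp: fun_eq_iff)
  qed (auto simp: \<Theta>_inverse intro!: DERIV_continuous_on has_field_derivative_at_within[OF G_deriv])
  then show ?thesis by (simp add: \<Theta>_inverse has_field_derivative_def)
qed

lemma \<Theta>_shift: "\<Theta> (t + \<rho>) = \<Theta> t + pi"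
  by (metis G_shift \<Theta>_inverse)

lemma g_deriv: "(g has_real_derivative A\<^sup>2 * sin \<theta> * cos \<theta> / (2 * g \<theta>)) (at \<theta>)"
proof -
  have "0 < \<alpha> + A\<^sup>2 * (1 + (sin \<theta>)\<^sup>2) / 2" using g_arg[of \<theta>] \<alpha>A_pos by linarith
  then show ?thesis
    unfolding angular_speed_def
    by (auto intro!: derivative_eq_intros simp: field_simps)
qed

lemma orbit_solution: "duffing_solution \<alpha> X"
  and orbit_deriv: "deriv X = (\<lambda>t. A * cos (\<Theta> t) * g (\<Theta> t))"
proof -
  have 1: "(X has_real_derivative A * cos (\<Theta> t) * g (\<Theta> t)) (at t)" for t
    unfolding duffing_orbit_def
    by (rule derivative_eq_intros DERIV_chain2[OF DERIV_sin] \<Theta>_deriv refl)+ simp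
  have 2: "((\<lambda>t. A * cos (\<Theta> t) * g (\<Theta> t)) has_real_derivative - \<alpha> * X t - X t ^ 3) (at t)" for t
  proof -
    define s c where "s = sin (\<Theta> t)" and "c = cos (\<Theta> t)"
    have c2: "c\<^sup>2 = 1 - s\<^sup>2" unfolding s_def c_def by (rule cos_squared_eq)
    have "((\<lambda>t. A * cos (\<Theta> t) * g (\<Theta> t)) has_real_derivative
      A * (- s * g (\<Theta> t)) * g (\<Theta> t) + A * c * (A\<^sup>2 * s * c / (2 * g (\<Theta> t)) * g (\<Theta> t))) (at t)"
      unfolding s_def c_def
      by (rule derivative_eq_intros DERIV_chain2[OF DERIV_cos] DERIV_chain2[OF g_deriv] \<Theta>_deriv refl)+ simp
    also have "A * (- s * g (\<Theta> t)) * g (\<Theta> t) + A * c * (A\<^sup>2 * s * c / (2 * g (\<Theta> t)) * g (\<Theta> t))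
      = - A * s * (g (\<Theta> t))\<^sup>2 + A ^ 3 * s * c\<^sup>2 / 2"
      using g_bounds(3)[of "\<Theta> t"] by (simp add: power2_eq_square power3_eq_cube)
    also have "\<dots> = - \<alpha> * X t - X t ^ 3"
      unfolding g_power2 c2 duffing_orbit_def s_def[symmetric]
      by (simp add: field_simps power2_eq_square power3_eq_cube)
    finally show ?thesis .
  qed
  show "duffing_solution \<alpha> X" "deriv X = (\<lambda>t. A * cos (\<Theta> t) * g (\<Theta> t))"
    using duffing_solutionI[OF 1 2] by auto
qed

lemma orbit_antiperiodic: "X (t + \<rho>) = - X t"
  by (simp add: duffing_orbit_def \<Theta>_shift)

text \<open>A shorter period would bring the orbit back to its maximum at an angle strictly between
  pi/2 and pi/2 + 2 pi, where the sine is never 1.\<close>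

lemma orbit_minimal_period: "minimal_period (2 * \<rho>) X"
  unfolding minimal_period_def
proof (intro conjI allI impI notI)
  show "0 < 2 * \<rho>" using \<rho>_pos by simp
  show "X (t + 2 * \<rho>) = X t" for t
    using orbit_antiperiodic[of "t + \<rho>"] orbit_antiperiodic[of t] by (simp add: algebra_simps)
  fix q assume q: "0 < q \<and> q < 2 * \<rho>" and per: "\<forall>t. X (t + q) = X t"
  define \<theta> where "\<theta> = \<Theta> (G (pi / 2) + q)"
  have G\<theta>: "G \<theta> = G (pi / 2) + q" by (simp add: \<theta>_def \<Theta>_inverse)
  have "A * sin \<theta> = A * sin (pi / 2)"
    using per[rule_format, of "G (pi / 2)"] by (simp add: duffing_orbit_def \<theta>_def \<Theta>_inverse)
  then have "sin \<theta> = 1" using A_pos by simp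
  have "pi / 2 < \<theta>"
    using G\<theta> q G_mono[of \<theta> "pi / 2"] by (metis add.commute less_add_same_cancel2 linorder_neqE_linordered_idom order_less_asym)
  moreover have "\<theta> < pi / 2 + 2 * pi"
  proof -
    have "G (pi / 2 + 2 * pi) = G (pi / 2) + 2 * \<rho>"
      using G_shift[of "pi / 2 + pi"] G_shift[of "pi / 2"] by (simp add: algebra_simps)
    then have "\<not> pi / 2 + 2 * pi < \<theta>" "G \<theta> \<noteq> G (pi / 2 + 2 * pi)"
      using G\<theta> q G_mono[of "pi / 2 + 2 * pi" \<theta>] by auto
    then show ?thesis by (metis linorder_neqE_linordered_idom)
  qed
  moreover obtain m :: int where "\<theta> - pi / 2 = m * 2 * pi"
    using \<open>sin \<theta> = 1\<close> cos_one_2pi_int[of "\<theta> - pi / 2"] by (auto simp: cos_diff)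
  ultimately have "0 < real_of_int m * pi" "real_of_int m * pi < 1 * pi" by linarith+
  then have "0 < real_of_int m" "real_of_int m < 1" by (simp_all add: zero_less_mult_iff)
  then show False by simp
qed

lemma orbit_hamiltonian: "hamiltonian \<alpha> (X t) (deriv X t) = \<alpha> * A\<^sup>2 / 2 + A ^ 4 / 4"
proof -
  have "\<Theta> 0 = 0" using \<Theta>_inverse(2)[of 0] G_0 by simp
  then show ?thesis
    using hamiltonian_const[OF orbit_solution, of t] g_power2[of 0]
    by (simp add: hamiltonian_def orbit_deriv duffing_orbit_def power_mult_distrib algebra_simps
      power2_eq_square power4_eq_xxxx)
qed

lemma orbit_energy_pos: "\<alpha> * A\<^sup>2 / 2 + A ^ 4 / 4 > 0"
proof -
  have "0 < A\<^sup>2 / 2 * (\<alpha> + A\<^sup>2 / 2)" using A_pos \<alpha>A_pos by simp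
  also have "\<dots> = \<alpha> * A\<^sup>2 / 2 + A ^ 4 / 4" by (simp add: algebra_simps power2_eq_square power4_eq_xxxx)
  finally show ?thesis .
qed

lemma orbit_periodic_orbit: "duffing_periodic_orbit \<alpha> (2 * \<rho>) X"
  unfolding duffing_periodic_orbit_def
  by (auto simp: orbit_solution orbit_minimal_period orbit_hamiltonian orbit_energy_pos)

text \<open>By the mean value theorem the half period is pi divided by the angular speed at some
  angle.\<close>

lemma half_period_bounds: "pi / sqrt (\<alpha> + A\<^sup>2) \<le> \<rho>" "\<rho> \<le> pi / sqrt (\<alpha> + A\<^sup>2 / 2)"
proof -
  obtain \<theta> where "G pi - G 0 = (pi - 0) * (1 / g \<theta>)"
    using MVT2[of 0 pi G "\<lambda>\<theta>. 1 / g \<theta>"] G_deriv pi_gt_zero by blast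
  then have \<rho>: "\<rho> = pi / g \<theta>" by (simp add: half_period_def G_0)
  show "pi / sqrt (\<alpha> + A\<^sup>2) \<le> \<rho>" "\<rho> \<le> pi / sqrt (\<alpha> + A\<^sup>2 / 2)"
    unfolding \<rho> using g_bounds[of \<theta>] \<alpha>A_pos less_le_trans[OF g_bounds(3) g_bounds(2)]
    by (auto intro!: divide_left_mono mult_pos_pos)
qed

end

section \<open>Classification by amplitude; uniqueness and existence of periodic orbits\<close>

lemma half_period_strict_decreasing:
  assumes "0 < A" "A < B" "\<alpha> + A\<^sup>2 / 2 > 0"
  shows "half_period \<alpha> B < half_period \<alpha> A"
proof -
  have AB: "A\<^sup>2 < B\<^sup>2" using assms by (intro power_strict_mono) auto
  interpret A: duffing_amplitude \<alpha> A using assms by unfold_locales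
  interpret B: duffing_amplitude \<alpha> B using assms AB by unfold_locales auto
  have "angular_time \<alpha> A 0 - angular_time \<alpha> B 0 < angular_time \<alpha> A pi - angular_time \<alpha> B pi"
  proof (rule DERIV_pos_imp_increasing[of 0 pi "\<lambda>\<theta>. angular_time \<alpha> A \<theta> - angular_time \<alpha> B \<theta>"])
    show "\<exists>y. ((\<lambda>\<theta>. angular_time \<alpha> A \<theta> - angular_time \<alpha> B \<theta>) has_real_derivative y) (at \<theta>) \<and> 0 < y"
      for \<theta>
    proof (intro exI conjI)
      show "((\<lambda>\<theta>. angular_time \<alpha> A \<theta> - angular_time \<alpha> B \<theta>) has_real_derivative
          1 / angular_speed \<alpha> A \<theta> - 1 / angular_speed \<alpha> B \<theta>) (at \<theta>)"
        by (intro derivative_intros A.G_deriv B.G_deriv)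
      have "A\<^sup>2 * (1 + (sin \<theta>)\<^sup>2) < B\<^sup>2 * (1 + (sin \<theta>)\<^sup>2)"
        using AB by (intro mult_strict_right_mono) (auto intro: add_pos_nonneg)
      then have "angular_speed \<alpha> A \<theta> < angular_speed \<alpha> B \<theta>"
        unfolding angular_speed_def by (intro real_sqrt_less_mono) auto
      then show "0 < 1 / angular_speed \<alpha> A \<theta> - 1 / angular_speed \<alpha> B \<theta>"
        using A.g_bounds(3)[of \<theta>] by (simp add: frac_less2)
    qed
  qed auto
  then show ?thesis by (simp add: half_period_def A.G_0 B.G_0)
qed

text \<open>The energy determines the amplitude, the initial point determines the phase, and
  uniqueness for the initial value problem identifies the orbit with the explicit one.\<close>

lemma duffing_periodic_orbit_classification:
  assumes "duffing_periodic_orbit \<alpha> p x"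
  obtains A s where "duffing_amplitude \<alpha> A" "p = 2 * half_period \<alpha> A"
    "\<And>t. x t = duffing_orbit \<alpha> A (t + s)"
proof -
  define H where "H = hamiltonian \<alpha> (x 0) (deriv x 0)"
  have x: "duffing_solution \<alpha> x" and "minimal_period p x" and "H > 0"
    using assms by (auto simp: duffing_periodic_orbit_def H_def)
  \<comment> \<open>\<open>B\<close> is to be the square of the amplitude: the positive root of
    \<open>\<alpha> * B / 2 + B\<^sup>2 / 4 = H\<close>.\<close>
  define B where "B = - \<alpha> + sqrt (\<alpha>\<^sup>2 + 4 * H)"
  have sq: "(sqrt (\<alpha>\<^sup>2 + 4 * H))\<^sup>2 = \<alpha>\<^sup>2 + 4 * H" using \<open>H > 0\<close> by simp
  have "sqrt (\<alpha>\<^sup>2) < sqrt (\<alpha>\<^sup>2 + 4 * H)" using \<open>H > 0\<close> by (intro real_sqrt_less_mono) auto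
  then have "\<bar>\<alpha>\<bar> < sqrt (\<alpha>\<^sup>2 + 4 * H)" by simp
  then have B: "B > 0" "\<alpha> + B / 2 > 0" unfolding B_def by (auto simp: field_simps abs_less_iff)
  have BH: "\<alpha> * B / 2 + B\<^sup>2 / 4 = H"
    using sq by (simp add: B_def power2_eq_square field_simps)
  define A where "A = sqrt B"
  have A2: "A\<^sup>2 = B" using B by (simp add: A_def)
  interpret duffing_amplitude \<alpha> A using B by unfold_locales (auto simp: A_def)
  have energy: "(deriv x 0)\<^sup>2 = (A\<^sup>2 - (x 0)\<^sup>2) * (\<alpha> + (A\<^sup>2 + (x 0)\<^sup>2) / 2)"
    using BH unfolding H_def hamiltonian_def A2[symmetric]
    by (simp add: power2_eq_square power4_eq_xxxx field_simps) 
  have le: "(x 0)\<^sup>2 \<le> A\<^sup>2"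
  proof (rule ccontr)
    assume "\<not> ?thesis"
    then have "A\<^sup>2 - (x 0)\<^sup>2 < 0" "\<alpha> + (A\<^sup>2 + (x 0)\<^sup>2) / 2 > 0"
      using \<alpha>A_pos zero_le_power2[of "x 0"] unfolding add_divide_distrib by linarith+
    then have "(deriv x 0)\<^sup>2 < 0" unfolding energy by (rule mult_neg_pos)
    then show False by simp
  qed
  define r where "r = x 0 / A"
  have r: "r\<^sup>2 \<le> 1" and x0: "x 0 = A * r" using le A_pos by (auto simp: r_def power_divide)
  \<comment> \<open>\<open>c\<close> and \<open>r\<close> are the candidates for cosine and sine of
    the phase, read off from the formulas for velocity and position; the energy identity puts them
    on the unit circle.\<close>
  define c where "c = deriv x 0 / (A * sqrt (\<alpha> + A\<^sup>2 * (1 + r\<^sup>2) / 2))"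
  have arg: "\<alpha> + A\<^sup>2 * (1 + r\<^sup>2) / 2 > 0"
  proof -
    have "A\<^sup>2 * 1 \<le> A\<^sup>2 * (1 + r\<^sup>2)" by (intro mult_left_mono) auto
    then show ?thesis using \<alpha>A_pos by simp
  qed
  have "(deriv x 0)\<^sup>2 = A\<^sup>2 * (1 - r\<^sup>2) * (\<alpha> + A\<^sup>2 * (1 + r\<^sup>2) / 2)"
    unfolding energy x0 by (simp add: algebra_simps power_mult_distrib)
  then have "r\<^sup>2 + c\<^sup>2 = 1"
    using arg A_pos by (simp add: c_def power_divide power_mult_distrib)
  then obtain \<theta> where \<theta>: "c = cos \<theta>" "r = sin \<theta>"
    using sincos_total_2pi[of c r] by (metis add.commute)
  have "deriv x 0 = A * cos \<theta> * g \<theta>"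
    using arg A_pos unfolding \<theta>(1)[symmetric] angular_speed_def \<theta>(2)[symmetric] by (simp add: c_def)
  have shift: "duffing_solution \<alpha> (\<lambda>t. X (t + G \<theta>))" "deriv (\<lambda>t. X (t + G \<theta>)) = (\<lambda>t. deriv X (t + G \<theta>))"
    using duffing_affine[OF orbit_solution, of 1 "G \<theta>"] by auto
  have eq: "x t = X (t + G \<theta>)" for t
  proof (rule duffing_unique[OF x shift(1)])
    show "x 0 = X (0 + G \<theta>)" using x0 \<theta> by (simp add: duffing_orbit_def \<Theta>_inverse)
    show "deriv x 0 = deriv (\<lambda>t. X (t + G \<theta>)) 0"
      using \<open>deriv x 0 = A * cos \<theta> * g \<theta>\<close> by (simp add: shift orbit_deriv \<Theta>_inverse)
  qed
  have period_iff: "(\<forall>t. X (t + q) = X t) \<longleftrightarrow> (\<forall>t. x (t + q) = x t)" for q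
  proof -
    have "X t = x (t - G \<theta>)" for t by (simp add: eq)
    then show ?thesis unfolding eq by (metis add.assoc add.commute diff_add_cancel)
  qed
  have "minimal_period (2 * \<rho>) x"
    using orbit_minimal_period unfolding minimal_period_def period_iff .
  then have "p = 2 * \<rho>" using \<open>minimal_period p x\<close> minimal_period_unique by blast
  then show thesis using that eq duffing_amplitude_axioms by blast
qed

lemma duffing_periodic_orbit_unique:
  assumes "duffing_periodic_orbit \<alpha> p x" "duffing_periodic_orbit \<alpha> p z"
  shows "\<exists>s. \<forall>t. z t = x (t + s)"
proof -
  from assms(1) obtain A s where A: "duffing_amplitude \<alpha> A" "p = 2 * half_period \<alpha> A"
    "\<And>t. x t = duffing_orbit \<alpha> A (t + s)"
    by (rule duffing_periodic_orbit_classification) blast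
  from assms(2) obtain B r where B: "duffing_amplitude \<alpha> B" "p = 2 * half_period \<alpha> B"
    "\<And>t. z t = duffing_orbit \<alpha> B (t + r)"
    by (rule duffing_periodic_orbit_classification) blast
  have "A = B"
    using half_period_strict_decreasing[of A B \<alpha>] half_period_strict_decreasing[of B A \<alpha>] A(1,2) B(1,2)
    unfolding duffing_amplitude_def by (cases A B rule: linorder_cases) auto
  then have "z t = x (t + (r - s))" for t using A(3) B(3) by (simp add: algebra_simps)
  then show ?thesis by blast
qed

text \<open>The half period depends continuously on the amplitude, so it suffices to find amplitudes
  with half period at least q and at most q.\<close>

lemma duffing_periodic_orbit_exists:
  assumes "0 < q" "q * sqrt (3 * \<bar>\<alpha>\<bar> + 1) \<le> pi"
  shows "\<exists>x. duffing_periodic_orbit \<alpha> (2 * q) x"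
proof -
  \<comment> \<open>This amplitude has positive energy for either sign of \<alpha> and satisfies
    \<open>\<alpha> + A\<^sup>2 \<le> 3 * \<bar>\<alpha>\<bar> + 1\<close>, the quantity in the
    smallness condition on q.\<close>
  define A where "A = sqrt (2 * \<bar>\<alpha>\<bar> + 1)"
  have A2: "A\<^sup>2 = 2 * \<bar>\<alpha>\<bar> + 1" by (simp add: A_def)
  have amp: "duffing_amplitude \<alpha> C" if "C \<ge> A" for C
  proof
    have "A > 0" by (simp add: A_def)
    then show "C > 0" using that by simp
    have "C\<^sup>2 \<ge> A\<^sup>2" using that \<open>A > 0\<close> by (intro power_mono) auto
    then show "\<alpha> + C\<^sup>2 / 2 > 0" using A2 by (simp add: field_simps)
  qed
  interpret A: duffing_amplitude \<alpha> A by (rule amp) simp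
  \<comment> \<open>Large enough that
    \<open>(pi / q)\<^sup>2 \<le> \<alpha> + B\<^sup>2 / 2\<close>, which brings the upper bound for
    the half period down to q.\<close>
  define B where "B = A + sqrt (2 * (pi / q)\<^sup>2 + 2 * \<bar>\<alpha>\<bar>)"
  have "A \<le> B" by (simp add: B_def)
  interpret B: duffing_amplitude \<alpha> B by (rule amp) fact
  have qA: "q \<le> half_period \<alpha> A"
  proof -
    have "q * sqrt (\<alpha> + A\<^sup>2) \<le> q * sqrt (3 * \<bar>\<alpha>\<bar> + 1)"
      using \<open>0 < q\<close> by (intro mult_left_mono real_sqrt_le_mono) (auto simp: A2)
    then have "q * sqrt (\<alpha> + A\<^sup>2) \<le> pi" using assms(2) by simp
    moreover have "sqrt (\<alpha> + A\<^sup>2) > 0" using A.g_bounds(2,3)[of 0] by linarith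
    ultimately have "q \<le> pi / sqrt (\<alpha> + A\<^sup>2)" by (simp add: field_simps)
    then show ?thesis using A.half_period_bounds(1) by linarith
  qed
  have qB: "half_period \<alpha> B \<le> q"
  proof -
    have "(sqrt (2 * (pi / q)\<^sup>2 + 2 * \<bar>\<alpha>\<bar>))\<^sup>2 \<le> B\<^sup>2"
      using A.A_pos unfolding B_def by (intro power_mono) auto
    then have "(pi / q)\<^sup>2 \<le> \<alpha> + B\<^sup>2 / 2" by (simp add: field_simps)
    then have "pi / q \<le> sqrt (\<alpha> + B\<^sup>2 / 2)" by (rule real_le_rsqrt)
    then have "pi / sqrt (\<alpha> + B\<^sup>2 / 2) \<le> q"
      using \<open>0 < q\<close> B.\<alpha>A_pos by (simp add: field_simps)
    then show ?thesis using B.half_period_bounds(2) by linarith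
  qed
  have "continuous_on {A..B} (half_period \<alpha>)"
  proof -
    have "continuous_on {A..B} (\<lambda>C. integral (cbox 0 pi) (\<lambda>s. 1 / angular_speed \<alpha> C s))"
    proof (rule integral_continuous_on_param)
      have "angular_speed \<alpha> C s \<noteq> 0" if "C \<in> {A..B}" for C s
        using duffing_amplitude.g_bounds(3)[OF amp, of C s] that by auto
      then show "continuous_on ({A..B} \<times> cbox 0 pi) (\<lambda>(C, s). 1 / angular_speed \<alpha> C s)"
        unfolding angular_speed_def split_beta
        by (intro continuous_intros) auto
    qed
    then show ?thesis by (simp add: half_period_def angular_time_def)
  qed
  then obtain C where "C \<ge> A" "half_period \<alpha> C = q"
    using IVT2'[of "half_period \<alpha>" B q A] qA qB \<open>A \<le> B\<close> by blast
  then show ?thesis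
    using duffing_amplitude.orbit_periodic_orbit[OF amp, of C] by blast
qed

section \<open>Hill's equation along a rescaled orbit\<close>

lemma has_vector_derivative_increment_le:
  fixes f :: "real \<Rightarrow> 'a::banach"
  assumes der: "\<And>s. s \<in> {a..b} \<Longrightarrow> (f has_vector_derivative f' s) (at s within {a..b})"
    and bound: "\<And>s. s \<in> {a..b} \<Longrightarrow> norm (f' s) \<le> B" and "B \<ge> 0" and t: "t \<in> {a..b}"
  shows "norm (f t - f a) \<le> B * (t - a)"
proof -
  have "(f' has_integral f t - f a) {a..t}"
    using t by (intro fundamental_theorem_of_calculus has_vector_derivative_within_subset[OF der]) auto
  then have "norm (f t - f a) \<le> B * measure lborel {a..t}"
    by (rule has_integral_bound_real[OF \<open>B \<ge> 0\<close> finite.emptyI]) (use bound t in auto)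
  then show ?thesis using t by simp
qed

lemma has_vector_derivative_of_real':
  assumes "(f has_real_derivative d) (at t)"
  shows "((\<lambda>t. of_real (f t) :: 'a::real_normed_field) has_vector_derivative of_real d) (at t within S)"
  using assms has_field_derivative_at_within[OF assms, of S]
  unfolding has_real_derivative_iff_has_vector_derivative
  by (auto dest: bounded_linear.has_vector_derivative[OF bounded_linear_of_real])

lemma abs_integral_unit_le:
  fixes f :: "real \<Rightarrow> 'a::banach"
  assumes "continuous_on {0..1} f" "\<And>t. t \<in> {0..1} \<Longrightarrow> norm (f t) \<le> B"
  shows "norm (integral {0..1} f) \<le> B"
  using integral_bound[of 0 1 f B] assms by simp

text \<open>
  Hill's equation \<open>y'' + (\<epsilon> + 3 u\<^sup>2) y = b y + f\<close> on the unit interval, where \<open>u\<close> is a Duffing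
  solution rescaled to half period 1. The pair \<open>\<phi> = u'\<close>, \<open>\<psi> = u + t u'\<close> solves the homogeneous
  equation for \<open>\<epsilon> = b = 0\<close>, and \<open>\<psi> (t + 1) = - \<psi> t - \<phi> t\<close>.
\<close>

definition hill_solution ::
  "real \<Rightarrow> (real \<Rightarrow> real) \<Rightarrow> 'a \<Rightarrow> (real \<Rightarrow> 'a) \<Rightarrow> (real \<Rightarrow> 'a) \<Rightarrow> (real \<Rightarrow> 'a::real_normed_field) \<Rightarrow> bool" where
  "hill_solution \<epsilon> u b f y v \<longleftrightarrow> (\<forall>t\<in>{0..1}.
     (y has_vector_derivative v t) (at t within {0..1}) \<and>
     (v has_vector_derivative (b - of_real (\<epsilon> + 3 * (u t)\<^sup>2)) * y t + f t) (at t within {0..1}))"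

text \<open>The quantity bounded below by 1 is the Wronskian of the pair (see \<open>D_eq\<close>),
  so the pair stays uniformly independent. One constant C dominates all other data, which keeps the
  estimates down to powers of C.\<close>

locale hill =
  fixes \<epsilon> C :: real and u :: "real \<Rightarrow> real"
  assumes u_sol: "duffing_solution \<epsilon> u"
    and u_anti: "u (t + 1) = - u t"
    and \<epsilon>_le: "\<bar>\<epsilon>\<bar> \<le> 1" and C_ge: "C \<ge> 1"
    and u_le: "\<bar>u t\<bar> \<le> C"
    and \<phi>_le: "t \<in> {0..1} \<Longrightarrow> \<bar>deriv u t\<bar> \<le> C"
    and \<psi>_le: "t \<in> {0..1} \<Longrightarrow> \<bar>u t + t * deriv u t\<bar> \<le> C"
    and D_ge': "4 * hamiltonian \<epsilon> (u 0) (deriv u 0) - \<epsilon> * (u t)\<^sup>2 \<ge> 1"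
    and h_le: "hamiltonian \<epsilon> (u 0) (deriv u 0) \<le> C"
begin

definition \<phi> where "\<phi> t = deriv u t"
definition \<phi>' where "\<phi>' t = - \<epsilon> * u t - u t ^ 3"
definition \<psi> where "\<psi> t = u t + t * \<phi> t"
definition \<psi>' where "\<psi>' t = 2 * \<phi> t + t * \<phi>' t"
definition D where "D t = \<phi> t * \<psi>' t - \<phi>' t * \<psi> t"

text \<open>\<open>P\<close> and \<open>R\<close> are variation-of-constants coordinates: Wronskians
  with \<open>\<phi>\<close> and \<open>\<psi>\<close>, the second divided by \<open>D\<close>.
  Along homogeneous solutions with \<epsilon> = b = 0 both are constant.\<close>

definition P where "P y v t = of_real (\<phi> t) * v t - of_real (\<phi>' t) * y t"
definition R where "R y v t = (of_real (\<psi> t) * v t - of_real (\<psi>' t) * y t) / of_real (D t)"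

lemma u_deriv: "(u has_real_derivative \<phi> t) (at t)"
  using u_sol by (simp add: duffing_solution_def \<phi>_def)

lemma \<phi>_deriv: "(\<phi> has_real_derivative \<phi>' t) (at t)"
  using u_sol by (simp add: duffing_solution_def \<phi>_def[abs_def] \<phi>'_def)

lemma \<phi>'_deriv: "(\<phi>' has_real_derivative - (\<epsilon> + 3 * (u t)\<^sup>2) * \<phi> t) (at t)"
  unfolding \<phi>'_def by (auto intro!: derivative_eq_intros u_deriv simp: algebra_simps)

lemma \<psi>_deriv: "(\<psi> has_real_derivative \<psi>' t) (at t)"
  unfolding \<psi>_def by (auto intro!: derivative_eq_intros u_deriv \<phi>_deriv simp: \<psi>'_def)

text \<open>The scaled solution c u(c t) solves the equation with coefficient \<epsilon> c^2;
  differentiating this coefficient at c = 1 produces the residual -2 \<epsilon> u.\<close>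

lemma \<psi>'_deriv: "(\<psi>' has_real_derivative - (\<epsilon> + 3 * (u t)\<^sup>2) * \<psi> t - 2 * \<epsilon> * u t) (at t)"
  unfolding \<psi>'_def
  by (rule derivative_eq_intros \<phi>_deriv \<phi>'_deriv refl)+
    (simp add: \<phi>'_def \<psi>_def algebra_simps power2_eq_square power3_eq_cube)

lemma D_eq: "D t = 4 * hamiltonian \<epsilon> (u 0) (deriv u 0) - \<epsilon> * (u t)\<^sup>2"
  unfolding hamiltonian_const[OF u_sol, of t, symmetric]
  by (simp add: D_def \<psi>'_def \<psi>_def \<phi>'_def \<phi>_def[symmetric] hamiltonian_def algebra_simps
      power2_eq_square power3_eq_cube power4_eq_xxxx)

lemma D_ge: "D t \<ge> 1"
  using D_ge' by (simp add: D_eq)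

lemma D_nonzero: "of_real (D t) \<noteq> (0::'a::real_normed_field)"
  using D_ge[of t] by simp

lemma D_deriv: "(D has_real_derivative - 2 * \<epsilon> * u t * \<phi> t) (at t)"
  unfolding D_eq by (auto intro!: derivative_eq_intros u_deriv)

lemma \<phi>_anti: "\<phi> (t + 1) = - \<phi> t"
proof -
  have "((\<lambda>t. - u (t + 1)) has_real_derivative - \<phi> (t + 1)) (at t)"
    by (auto intro!: derivative_eq_intros DERIV_chain2[OF u_deriv])
  then have "(u has_real_derivative - \<phi> (t + 1)) (at t)" by (simp add: u_anti)
  then show ?thesis using u_deriv DERIV_unique by fastforce
qed

lemma boundary:
  "u 1 = - u 0" "\<phi> 1 = - \<phi> 0" "\<phi>' 1 = - \<phi>' 0" "\<psi> 1 = - \<psi> 0 - \<phi> 0" "\<psi>' 1 = - \<psi>' 0 - \<phi>' 0" "D 1 = D 0"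
  using u_anti[of 0] \<phi>_anti[of 0] by (auto simp: \<phi>'_def \<psi>_def \<psi>'_def D_eq)

lemma bounds: "t \<in> {0..1} \<Longrightarrow> \<bar>\<phi> t\<bar> \<le> C" "t \<in> {0..1} \<Longrightarrow> \<bar>\<psi> t\<bar> \<le> C"
  using \<phi>_le \<psi>_le by (auto simp: \<phi>_def \<psi>_def)

lemma D_le: "D t \<le> 5 * C\<^sup>2"
proof -
  have "\<bar>\<epsilon>\<bar> * (u t)\<^sup>2 \<le> 1 * C\<^sup>2"
    using \<epsilon>_le abs_le_square_iff[of "u t" C] u_le[of t] C_ge by (intro mult_mono) auto
  then have "- \<epsilon> * (u t)\<^sup>2 \<le> C\<^sup>2" by (metis abs_le_D2 abs_mult abs_power2 minus_mult_left mult_1)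
  moreover have "C \<le> C\<^sup>2" using C_ge by (simp add: power2_eq_square)
  ultimately show ?thesis using h_le by (simp add: D_eq)
qed

lemma continuous_basis [continuous_intros]:
  "continuous_on S u" "continuous_on S \<phi>" "continuous_on S \<psi>"
  by (meson DERIV_continuous_on has_field_derivative_at_within u_deriv \<phi>_deriv \<psi>_deriv)+

lemma reconstruct:
  fixes y v :: "real \<Rightarrow> 'a::real_normed_field"
  shows "y t = of_real (\<psi> t) * P y v t / of_real (D t) - of_real (\<phi> t) * R y v t"
    and "v t = of_real (\<psi>' t) * P y v t / of_real (D t) - of_real (\<phi>' t) * R y v t"
proof -
  have D: "of_real (D t) \<noteq> (0::'a)" by (rule D_nonzero)
  then have R: "R y v t * of_real (D t) = of_real (\<psi> t) * v t - of_real (\<psi>' t) * y t"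
    by (simp add: R_def)
  have "y t * of_real (D t) = of_real (\<psi> t) * P y v t - of_real (\<phi> t) * (R y v t * of_real (D t))"
    "v t * of_real (D t) = of_real (\<psi>' t) * P y v t - of_real (\<phi>' t) * (R y v t * of_real (D t))"
    unfolding R P_def by (simp_all add: D_def algebra_simps)
  then show "y t = of_real (\<psi> t) * P y v t / of_real (D t) - of_real (\<phi> t) * R y v t"
    "v t = of_real (\<psi>' t) * P y v t / of_real (D t) - of_real (\<phi>' t) * R y v t"
    using D by (simp_all add: field_simps)
qed

text \<open>Since \<open>\<phi>\<close> changes sign over the half period and \<open>\<psi>\<close>
  becomes -\<psi> - \<phi>, the multiplier condition takes the form of a Jordan block in (P, R). The
  inhomogeneous multiple of \<open>\<phi>\<close> shifts only \<open>R\<close>; it serves the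
  generalized eigenfunctions.\<close>

lemma boundary_iff:
  fixes y v :: "real \<Rightarrow> 'a::real_normed_field"
  shows "y 1 = - \<nu> * y 0 - c * of_real (\<phi> 0) \<and> v 1 = - \<nu> * v 0 - c * of_real (\<phi>' 0) \<longleftrightarrow>
   P y v 1 = \<nu> * P y v 0 \<and> R y v 1 = \<nu> * (R y v 0 + P y v 0 / of_real (D 0)) - c"
proof
  assume y: "y 1 = - \<nu> * y 0 - c * of_real (\<phi> 0) \<and> v 1 = - \<nu> * v 0 - c * of_real (\<phi>' 0)"
  have "R y v 1 * of_real (D 0) = (\<nu> * (R y v 0 + P y v 0 / of_real (D 0)) - c) * of_real (D 0)"
  proof -
    have RD: "R y v 0 * of_real (D 0) = of_real (\<psi> 0) * v 0 - of_real (\<psi>' 0) * y 0"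
      "R y v 1 * of_real (D 0) = of_real (\<psi> 1) * v 1 - of_real (\<psi>' 1) * y 1"
      using D_nonzero[of 0, where 'a='a] by (simp_all add: R_def boundary)
    have "(\<nu> * (R y v 0 + P y v 0 / of_real (D 0)) - c) * of_real (D 0)
        = \<nu> * (R y v 0 * of_real (D 0) + P y v 0) - c * of_real (D 0)"
      using D_nonzero[of 0, where 'a='a] by (simp add: field_simps)
    also have "\<dots> = R y v 1 * of_real (D 0)"
      unfolding RD y[THEN conjunct1] y[THEN conjunct2] boundary
      by (simp add: P_def D_def algebra_simps)
    finally show ?thesis by (rule sym)
  qed
  then have "R y v 1 = \<nu> * (R y v 0 + P y v 0 / of_real (D 0)) - c"
    using D_nonzero mult_right_cancel by blast
  moreover have "P y v 1 = \<nu> * P y v 0"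
    unfolding P_def y[THEN conjunct1] y[THEN conjunct2] boundary by (simp add: algebra_simps)
  ultimately show "P y v 1 = \<nu> * P y v 0 \<and> R y v 1 = \<nu> * (R y v 0 + P y v 0 / of_real (D 0)) - c"
    by simp
next
  assume PR: "P y v 1 = \<nu> * P y v 0 \<and> R y v 1 = \<nu> * (R y v 0 + P y v 0 / of_real (D 0)) - c"
  define p r where "p = P y v 0" and "r = R y v 0"
  have D: "of_real (D 0) \<noteq> (0::'a)" by (rule D_nonzero)
  have 0: "y 0 = of_real (\<psi> 0) * p / of_real (D 0) - of_real (\<phi> 0) * r"
    "v 0 = of_real (\<psi>' 0) * p / of_real (D 0) - of_real (\<phi>' 0) * r"
    unfolding p_def r_def by (rule reconstruct)+
  have "P y v 1 = \<nu> * p" "R y v 1 = \<nu> * (r + p / of_real (D 0)) - c"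
    using PR by (simp_all add: p_def r_def)
  then have 1: "y 1 = of_real (\<psi> 1) * (\<nu> * p) / of_real (D 1) - of_real (\<phi> 1) * (\<nu> * (r + p / of_real (D 0)) - c)"
    "v 1 = of_real (\<psi>' 1) * (\<nu> * p) / of_real (D 1) - of_real (\<phi>' 1) * (\<nu> * (r + p / of_real (D 0)) - c)"
    by (metis reconstruct(1), metis reconstruct(2))
  show "y 1 = - \<nu> * y 0 - c * of_real (\<phi> 0) \<and> v 1 = - \<nu> * v 0 - c * of_real (\<phi>' 0)"
    unfolding 0 1 boundary using D by (simp add: field_simps)
qed

text \<open>Two errors of order \<epsilon> enter the derivative of \<open>R\<close>:
  \<open>\<psi>\<close> is not an exact solution and \<open>D\<close> is not constant. Their parts
  proportional to \<open>R\<close> cancel, so the remaining error is driven by \<open>P\<close>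
  alone.\<close>

lemma
  fixes y :: "real \<Rightarrow> 'a::real_normed_field"
  assumes "hill_solution \<epsilon> u b f y v" "t \<in> {0..1}"
  shows P_deriv: "(P y v has_vector_derivative of_real (\<phi> t) * (b * y t + f t)) (at t within {0..1})"
    and R_deriv: "(R y v has_vector_derivative of_real (\<psi> t) * (b * y t + f t) / of_real (D t)
       + of_real (2 * \<epsilon> * u t * \<psi> t / (D t)\<^sup>2) * P y v t) (at t within {0..1})"
proof -
  have yv: "(y has_vector_derivative v t) (at t within {0..1})"
    "(v has_vector_derivative (b - of_real (\<epsilon> + 3 * (u t)\<^sup>2)) * y t + f t) (at t within {0..1})"
    using assms by (auto simp: hill_solution_def)
  note [derivative_intros] = has_vector_derivative_of_real'[OF \<phi>_deriv] has_vector_derivative_of_real'[OF \<phi>'_deriv]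
    has_vector_derivative_of_real'[OF \<psi>_deriv] has_vector_derivative_of_real'[OF \<psi>'_deriv] yv
    has_vector_derivative_mult has_vector_derivative_diff
  show "(P y v has_vector_derivative of_real (\<phi> t) * (b * y t + f t)) (at t within {0..1})"
    unfolding P_def
    by (rule has_vector_derivative_eq_rhs, (rule derivative_intros)+) (simp add: algebra_simps)
  have Q: "((\<lambda>t. of_real (\<psi> t) * v t - of_real (\<psi>' t) * y t) has_vector_derivative
      of_real (\<psi> t) * (b * y t + f t) + of_real (2 * \<epsilon> * u t) * y t) (at t within {0..1})"
    by (rule has_vector_derivative_eq_rhs, (rule derivative_intros)+) (simp add: algebra_simps)
  have R_eq: "R y v = (\<lambda>t. (of_real (\<psi> t) * v t - of_real (\<psi>' t) * y t) * of_real (1 / D t))"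
    by (simp add: R_def fun_eq_iff divide_inverse)
  have "((\<lambda>t. 1 / D t) has_real_derivative 2 * \<epsilon> * u t * \<phi> t / (D t)\<^sup>2) (at t)"
    using D_ge[of t] by (auto intro!: derivative_eq_intros D_deriv simp: power2_eq_square)
  then have der: "((\<lambda>t. (of_real (\<psi> t) * v t - of_real (\<psi>' t) * y t) * of_real (1 / D t)) has_vector_derivative
     (of_real (\<psi> t) * v t - of_real (\<psi>' t) * y t) * of_real (2 * \<epsilon> * u t * \<phi> t / (D t)\<^sup>2)
     + (of_real (\<psi> t) * (b * y t + f t) + of_real (2 * \<epsilon> * u t) * y t) * of_real (1 / D t)) (at t within {0..1})"
    by (intro has_vector_derivative_mult Q has_vector_derivative_of_real')
  have e1: "(of_real (\<psi> t) * v t - of_real (\<psi>' t) * y t) * of_real (2 * \<epsilon> * u t * \<phi> t / (D t)\<^sup>2)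
     = R y v t * of_real (2 * \<epsilon> * u t * \<phi> t / D t)"
    using D_nonzero[of t, where 'a='a] by (simp add: R_def power2_eq_square)
  have e2: "of_real (2 * \<epsilon> * u t) * y t * of_real (1 / D t)
    = of_real (2 * \<epsilon> * u t * \<psi> t / (D t)\<^sup>2) * P y v t - R y v t * of_real (2 * \<epsilon> * u t * \<phi> t / D t)"
    using D_nonzero[of t, where 'a='a] unfolding reconstruct(1)[of y t v]
    by (simp add: field_simps power2_eq_square)
  show "(R y v has_vector_derivative of_real (\<psi> t) * (b * y t + f t) / of_real (D t)
       + of_real (2 * \<epsilon> * u t * \<psi> t / (D t)\<^sup>2) * P y v t) (at t within {0..1})"
    by (rule has_vector_derivative_eq_rhs[OF der[folded R_eq]],
        simp only: distrib_right[of "of_real (\<psi> t) * (b * y t + f t)"] e1 e2) (simp add: divide_inverse)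
qed

lemma hill_continuous:
  assumes "hill_solution \<epsilon> u b f y v"
  shows "continuous_on {0..1} y" "continuous_on {0..1} v"
  using assms by (auto simp: hill_solution_def intro: continuous_on_vector_derivative)

lemma P_increment:
  fixes y :: "real \<Rightarrow> 'a::{real_normed_field,banach}"
  assumes sol: "hill_solution \<epsilon> u b f y v" and t: "t \<in> {0..1}"
    and N: "\<And>s. s \<in> {0..1} \<Longrightarrow> norm (y s) \<le> N" and F: "\<And>s. s \<in> {0..1} \<Longrightarrow> norm (f s) \<le> F"
  shows "norm (P y v t - P y v 0) \<le> C * (norm b * N + F)"
    and "norm (R y v t - R y v 0) \<le> 3 * C ^ 3 * (norm b * N + F) + 2 * \<bar>\<epsilon>\<bar> * C\<^sup>2 * norm (P y v 0)"
proof -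
  define G where "G = norm b * N + F"
  have le_G: "norm (b * y s + f s) \<le> G" if "s \<in> {0..1}" for s
  proof -
    have "norm (b * y s + f s) \<le> norm b * norm (y s) + norm (f s)"
      by (metis norm_mult norm_triangle_ineq)
    also have "\<dots> \<le> G" unfolding G_def using N F that by (intro add_mono mult_left_mono) auto
    finally show ?thesis .
  qed
  have "G \<ge> 0" by (rule order_trans[OF norm_ge_zero le_G[of 0]]) simp
  have P: "norm (P y v s - P y v 0) \<le> C * G" if "s \<in> {0..1}" for s
  proof -
    have "norm (P y v s - P y v 0) \<le> (C * G) * (s - 0)"
    proof (rule has_vector_derivative_increment_le[OF P_deriv[OF sol]])
      show "norm (of_real (\<phi> r) * (b * y r + f r)) \<le> C * G" if "r \<in> {0..1}" for r
        unfolding norm_mult using bounds that le_G C_ge by (intro mult_mono) auto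
    qed (use that C_ge \<open>G \<ge> 0\<close> in auto)
    also have "\<dots> \<le> C * G * 1" using that C_ge \<open>G \<ge> 0\<close> by (intro mult_left_mono) auto
    finally show ?thesis by simp
  qed
  then show "norm (P y v t - P y v 0) \<le> C * (norm b * N + F)" using t by (simp add: G_def)
  define B where "B = C * G + 2 * \<bar>\<epsilon>\<bar> * C\<^sup>2 * (norm (P y v 0) + C * G)"
  have "B \<ge> 0" using C_ge \<open>G \<ge> 0\<close> by (simp add: B_def)
  have "norm (R y v t - R y v 0) \<le> B * (t - 0)"
  proof (rule has_vector_derivative_increment_le[OF R_deriv[OF sol] _ \<open>B \<ge> 0\<close> t])
    fix s :: real assume s: "s \<in> {0..1}"
    have D: "\<bar>D s\<bar> \<ge> 1" "(D s)\<^sup>2 \<ge> 1" using D_ge[of s] by auto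
    have 1: "norm (of_real (\<psi> s) * (b * y s + f s) / of_real (D s)) \<le> C * G"
    proof -
      have "\<bar>\<psi> s\<bar> * norm (b * y s + f s) / \<bar>D s\<bar> \<le> \<bar>\<psi> s\<bar> * norm (b * y s + f s) / 1"
        using D by (intro divide_left_mono) auto
      also have "\<dots> \<le> C * G"
        using bounds s le_G C_ge by (auto intro!: mult_mono)
      finally show ?thesis by (simp add: norm_divide norm_mult)
    qed
    have "norm (P y v s) \<le> norm (P y v 0) + C * G"
      using P[OF s] norm_triangle_sub[of "P y v s" "P y v 0"] by simp
    moreover have "\<bar>2 * \<epsilon> * u s * \<psi> s / (D s)\<^sup>2\<bar> \<le> 2 * \<bar>\<epsilon>\<bar> * C\<^sup>2"
    proof -
      have "\<bar>2 * \<epsilon> * u s * \<psi> s / (D s)\<^sup>2\<bar> \<le> \<bar>2 * \<epsilon> * u s * \<psi> s\<bar> / 1"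
        unfolding abs_divide using D by (intro divide_left_mono) auto
      also have "\<dots> \<le> 2 * \<bar>\<epsilon>\<bar> * (C * C)"
        using u_le[of s] bounds(2)[OF s] C_ge unfolding abs_mult
        by (auto simp: mult.assoc intro!: mult_left_mono mult_mono)
      finally show ?thesis by (simp add: power2_eq_square)
    qed
    ultimately have 2: "norm (of_real (2 * \<epsilon> * u s * \<psi> s / (D s)\<^sup>2) * P y v s)
        \<le> 2 * \<bar>\<epsilon>\<bar> * C\<^sup>2 * (norm (P y v 0) + C * G)"
      unfolding norm_mult norm_of_real by (intro mult_mono) auto
    show "norm (of_real (\<psi> s) * (b * y s + f s) / of_real (D s) + of_real (2 * \<epsilon> * u s * \<psi> s / (D s)\<^sup>2) * P y v s) \<le> B"
      unfolding B_def by (intro norm_triangle_mono 1 2)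
  qed
  also have "\<dots> \<le> B * 1" using t \<open>B \<ge> 0\<close> by (intro mult_left_mono) auto
  also have "B * 1 = C * G + 2 * (\<bar>\<epsilon>\<bar> * (C ^ 3 * G)) + 2 * \<bar>\<epsilon>\<bar> * C\<^sup>2 * norm (P y v 0)"
    by (simp add: B_def algebra_simps power2_eq_square power3_eq_cube)
  also have "\<dots> \<le> C ^ 3 * G + 2 * (1 * (C ^ 3 * G)) + 2 * \<bar>\<epsilon>\<bar> * C\<^sup>2 * norm (P y v 0)"
    using C_ge \<epsilon>_le \<open>G \<ge> 0\<close> power_increasing[of 1 3 C]
    by (intro add_mono mult_left_mono mult_right_mono) auto
  finally show "norm (R y v t - R y v 0) \<le> 3 * C ^ 3 * (norm b * N + F) + 2 * \<bar>\<epsilon>\<bar> * C\<^sup>2 * norm (P y v 0)"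
    by (simp add: G_def algebra_simps)
qed

text \<open>If P(0) and the forcing are small, then \<open>P\<close> stays small and
  \<open>R\<close> hardly moves, so by \<open>reconstruct\<close> y is close to -R(0)
  \<phi>.\<close>

lemma hill_approx:
  fixes y :: "real \<Rightarrow> 'a::{real_normed_field,banach}"
  assumes sol: "hill_solution \<epsilon> u b f y v" and t: "t \<in> {0..1}"
    and N: "\<And>s. s \<in> {0..1} \<Longrightarrow> norm (y s) \<le> N" and F: "\<And>s. s \<in> {0..1} \<Longrightarrow> norm (f s) \<le> F"
  shows "norm (y t + of_real (\<phi> t) * R y v 0) \<le> 3 * C ^ 3 * norm (P y v 0) + 4 * C ^ 4 * (norm b * N + F)"
proof -
  define G where "G = norm b * N + F"
  note PR = P_increment[OF sol t N F, folded G_def]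
  have "0 \<le> norm b * norm (y 0) + norm (f 0)" by simp
  also have "\<dots> \<le> G" unfolding G_def by (intro add_mono mult_left_mono N F) auto
  finally have "G \<ge> 0" .
  have P: "norm (P y v t) \<le> norm (P y v 0) + C * G"
    using PR(1) norm_triangle_sub[of "P y v t" "P y v 0"] by simp
  have eq: "y t + of_real (\<phi> t) * R y v 0
      = of_real (\<psi> t) * P y v t / of_real (D t) - of_real (\<phi> t) * (R y v t - R y v 0)"
    unfolding reconstruct(1)[of y t v] by (simp add: algebra_simps)
  have 1: "norm (of_real (\<psi> t) * P y v t / of_real (D t) - of_real (\<phi> t) * (R y v t - R y v 0))
      \<le> C * (norm (P y v 0) + C * G) + C * (3 * C ^ 3 * G + 2 * \<bar>\<epsilon>\<bar> * C\<^sup>2 * norm (P y v 0))"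
  proof (rule order_trans[OF norm_triangle_ineq4], rule add_mono)
    have "\<bar>\<psi> t\<bar> * norm (P y v t) / \<bar>D t\<bar> \<le> \<bar>\<psi> t\<bar> * norm (P y v t) / 1"
      using D_ge[of t] by (intro divide_left_mono) auto
    also have "\<dots> \<le> C * (norm (P y v 0) + C * G)"
      using bounds t P C_ge by (auto intro!: mult_mono)
    finally show "norm (of_real (\<psi> t) * P y v t / of_real (D t)) \<le> C * (norm (P y v 0) + C * G)"
      by (simp add: norm_divide norm_mult)
    show "norm (of_real (\<phi> t) * (R y v t - R y v 0)) \<le> C * (3 * C ^ 3 * G + 2 * \<bar>\<epsilon>\<bar> * C\<^sup>2 * norm (P y v 0))"
      unfolding norm_mult using bounds t PR(2) C_ge by (intro mult_mono) auto
  qed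
  have 2: "C * (norm (P y v 0) + C * G) + C * (3 * C ^ 3 * G + 2 * \<bar>\<epsilon>\<bar> * C\<^sup>2 * norm (P y v 0))
      = C * norm (P y v 0) + C\<^sup>2 * G + 3 * C ^ 4 * G + 2 * (\<bar>\<epsilon>\<bar> * (C ^ 3 * norm (P y v 0)))"
    by (simp add: algebra_simps power2_eq_square power3_eq_cube power4_eq_xxxx)
  have 3: "C * norm (P y v 0) + C\<^sup>2 * G + 3 * C ^ 4 * G + 2 * (\<bar>\<epsilon>\<bar> * (C ^ 3 * norm (P y v 0)))
      \<le> C ^ 3 * norm (P y v 0) + C ^ 4 * G + 3 * C ^ 4 * G + 2 * (1 * (C ^ 3 * norm (P y v 0)))"
    using C_ge \<epsilon>_le \<open>G \<ge> 0\<close> power_increasing[of 1 3 C] power_increasing[of 2 4 C]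
    by (intro add_mono mult_left_mono mult_right_mono) auto
  have "norm (y t + of_real (\<phi> t) * R y v 0) \<le> C ^ 3 * norm (P y v 0) + C ^ 4 * G + 3 * C ^ 4 * G
      + 2 * (1 * (C ^ 3 * norm (P y v 0)))"
    unfolding eq by (rule order_trans[OF 1 order_trans[OF eq_refl[OF 2] 3]])
  then show ?thesis unfolding G_def[symmetric] by (simp add: mult_ac)
qed

text \<open>The maximum of |y| also occurs on the right of the estimate, with coefficient 4 C^4 |b|,
  at most 1/2, and is absorbed.\<close>

lemma hill_bound:
  fixes y :: "real \<Rightarrow> 'a::{real_normed_field,banach}"
  assumes sol: "hill_solution \<epsilon> u b f y v" and t: "t \<in> {0..1}"
    and F: "\<And>s. s \<in> {0..1} \<Longrightarrow> norm (f s) \<le> F" and b: "8 * C ^ 4 * norm b \<le> 1"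
  shows "norm (y t) \<le> 6 * C ^ 3 * (norm (P y v 0) + norm (R y v 0)) + 8 * C ^ 4 * F"
proof -
  have "\<exists>s\<in>{0..1}. \<forall>r\<in>{0..1}. norm (y r) \<le> norm (y s)"
    by (intro continuous_attains_sup continuous_on_norm hill_continuous[OF sol]) auto
  then obtain s where s: "s \<in> {0..1}" "\<And>r. r \<in> {0..1} \<Longrightarrow> norm (y r) \<le> norm (y s)" by blast
  define N where "N = norm (y s)"
  have "C \<le> C ^ 3" using C_ge power_increasing[of 1 3 C] by simp
  have "N \<le> norm (y s + of_real (\<phi> s) * R y v 0) + norm (of_real (\<phi> s) * R y v 0)"
    unfolding N_def by (metis add_diff_cancel_right' norm_triangle_ineq4)
  also have "\<dots> \<le> (3 * C ^ 3 * norm (P y v 0) + 4 * C ^ 4 * (norm b * N + F)) + C ^ 3 * norm (R y v 0)"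
    using hill_approx[OF sol s(1) s(2) F, folded N_def] bounds(1)[OF s(1)] \<open>C \<le> C ^ 3\<close>
    by (intro add_mono) (auto simp: norm_mult intro!: mult_right_mono)
  also have "\<dots> \<le> (3 * C ^ 3 * norm (P y v 0) + 4 * C ^ 4 * (norm b * N + F)) + 3 * C ^ 3 * norm (R y v 0)"
    using C_ge by simp
  also have "\<dots> = 3 * C ^ 3 * (norm (P y v 0) + norm (R y v 0)) + 4 * C ^ 4 * F + (8 * C ^ 4 * norm b) * N / 2"
    by (simp add: algebra_simps)
  also have "\<dots> \<le> 3 * C ^ 3 * (norm (P y v 0) + norm (R y v 0)) + 4 * C ^ 4 * F + 1 * N / 2"
    using b by (intro add_left_mono divide_right_mono mult_right_mono) (auto simp: N_def)
  finally have "N \<le> 6 * C ^ 3 * (norm (P y v 0) + norm (R y v 0)) + 8 * C ^ 4 * F" by simp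
  then show ?thesis using s(2)[OF t] by (simp add: N_def)
qed

section \<open>Projection onto the orbit velocity\<close>

definition \<Phi> where "\<Phi> = integral {0..1} (\<lambda>t. (\<phi> t)\<^sup>2)"

text \<open>Virial identity: (u \<phi>)' = 3 \<phi>^2 + \<epsilon> u^2 - 4 h with h the energy, and
  u \<phi> has equal values at 0 and 1. This is where the factor 1/3 of the reduced equation comes
  from.\<close>

lemma \<Phi>_approx: "\<bar>\<Phi> - D 0 / 3\<bar> \<le> \<bar>\<epsilon>\<bar> * C\<^sup>2"
proof -
  define E where "E = 4 * hamiltonian \<epsilon> (u 0) (deriv u 0)"
  have "((\<lambda>t. 3 * (\<phi> t)\<^sup>2 + \<epsilon> * (u t)\<^sup>2 - E) has_integral u 1 * \<phi> 1 - u 0 * \<phi> 0) {0..1}"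
  proof (rule fundamental_theorem_of_calculus)
    fix t :: real
    have "((\<lambda>t. u t * \<phi> t) has_real_derivative \<phi> t * \<phi> t + \<phi>' t * u t) (at t)"
      by (intro DERIV_mult u_deriv \<phi>_deriv)
    moreover have "\<phi> t * \<phi> t + \<phi>' t * u t = 3 * (\<phi> t)\<^sup>2 + \<epsilon> * (u t)\<^sup>2 - E"
      unfolding E_def hamiltonian_const[OF u_sol, of t, symmetric]
      by (simp add: hamiltonian_def \<phi>'_def \<phi>_def[symmetric] field_simps power2_eq_square power3_eq_cube power4_eq_xxxx)
    ultimately show "((\<lambda>t. u t * \<phi> t) has_vector_derivative 3 * (\<phi> t)\<^sup>2 + \<epsilon> * (u t)\<^sup>2 - E) (at t within {0..1})"
      by (metis has_real_derivative_iff_has_vector_derivative has_vector_derivative_at_within)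
  qed simp
  then have 1: "integral {0..1} (\<lambda>t. 3 * (\<phi> t)\<^sup>2 + \<epsilon> * (u t)\<^sup>2 - E) = 0"
    by (simp add: boundary integral_unique)
  have \<phi>u: "(\<lambda>t. (\<phi> t)\<^sup>2) integrable_on {0..1}" "(\<lambda>t. (u t)\<^sup>2) integrable_on {0..1}"
    by (intro integrable_continuous_real continuous_intros)+
  define J where "J = integral {0..1} (\<lambda>t. (u t)\<^sup>2)"
  have "integral {0..1} (\<lambda>t. 3 * (\<phi> t)\<^sup>2 + \<epsilon> * (u t)\<^sup>2 - E)
      = 3 * \<Phi> + \<epsilon> * J - E"
  proof (rule integral_unique)
    have "((\<lambda>t. E) has_integral E) {0..1::real}"
      using has_integral_const_real[of E 0 1] by simp
    then show "((\<lambda>t. 3 * (\<phi> t)\<^sup>2 + \<epsilon> * (u t)\<^sup>2 - E) has_integral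
        3 * \<Phi> + \<epsilon> * J - E) {0..1}"
      unfolding \<Phi>_def J_def using \<phi>u
      by (intro has_integral_diff has_integral_add has_integral_mult_right integrable_integral)
  qed
  then have eq: "\<Phi> - D 0 / 3 = \<epsilon> * (((u 0)\<^sup>2 - J) / 3)" using 1 by (simp add: D_eq E_def field_simps)
  have u2: "(u t)\<^sup>2 \<le> C\<^sup>2" for t
    using abs_le_square_iff[of "u t" C] u_le[of t] C_ge by simp
  have "\<bar>J\<bar> \<le> C\<^sup>2"
    unfolding J_def real_norm_def[symmetric]
    by (rule abs_integral_unit_le) (auto intro!: continuous_intros u2)
  then have "- (C\<^sup>2) \<le> J" "J \<le> C\<^sup>2" by (auto simp: abs_le_iff)
  moreover have "\<bar>(a - j) / 3\<bar> \<le> c" if "0 \<le> a" "a \<le> c" "- c \<le> j" "j \<le> c" for a c j :: real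
    using that by (auto simp: abs_le_iff)
  ultimately have "\<bar>((u 0)\<^sup>2 - J) / 3\<bar> \<le> C\<^sup>2" using u2[of 0] zero_le_power2 by blast
  then show ?thesis unfolding eq abs_mult by (intro mult_left_mono) auto
qed

definition \<Psi> where "\<Psi> y = integral {0..1} (\<lambda>t. of_real (\<phi> t) * y t)"

lemma \<Psi>_le:
  fixes y :: "real \<Rightarrow> 'a::{real_normed_field,banach}"
  assumes "continuous_on {0..1} y" and N: "\<And>t. t \<in> {0..1} \<Longrightarrow> norm (y t) \<le> N"
  shows "norm (\<Psi> y) \<le> C * N"
  unfolding \<Psi>_def
proof (rule abs_integral_unit_le)
  show "continuous_on {0..1} (\<lambda>t. of_real (\<phi> t) * y t)" by (intro continuous_intros assms)
  show "norm (of_real (\<phi> t) * y t) \<le> C * N" if "t \<in> {0..1}" for t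
    unfolding norm_mult using bounds that N C_ge by (intro mult_mono) auto
qed

lemma P_total:
  fixes y :: "real \<Rightarrow> 'a::{real_normed_field,banach}"
  assumes sol: "hill_solution \<epsilon> u b (\<lambda>_. 0) y v"
  shows "P y v 1 - P y v 0 = b * \<Psi> y"
proof -
  have "((\<lambda>t. of_real (\<phi> t) * (b * y t + 0)) has_integral P y v 1 - P y v 0) {0..1}"
    by (intro fundamental_theorem_of_calculus P_deriv[OF sol]) auto
  from integral_unique[OF this, symmetric] show ?thesis
    by (simp add: \<Psi>_def mult.left_commute[of _ b])
qed

text \<open>When y is close to -R(0) \<phi>, its projection is close to -R(0) times the integral of
  \<phi>^2, hence to -R(0) D(0) / 3.\<close>

lemma \<Psi>_approx:
  fixes y :: "real \<Rightarrow> 'a::{real_normed_field,banach}"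
  assumes sol: "hill_solution \<epsilon> u b f y v"
    and M: "\<And>s. s \<in> {0..1} \<Longrightarrow> norm (y s + of_real (\<phi> s) * R y v 0) \<le> M"
  shows "norm (\<Psi> y / of_real (D 0) + R y v 0 / 3) \<le> C * M + \<bar>\<epsilon>\<bar> * C\<^sup>2 * norm (R y v 0)"
proof -
  have "M \<ge> 0" by (rule order_trans[OF norm_ge_zero M[of 0]]) simp
  have [continuous_intros]: "continuous_on {0..1} y" by (rule hill_continuous[OF sol])
  have "norm (integral {0..1} (\<lambda>t. of_real (\<phi> t) * (y t + of_real (\<phi> t) * R y v 0))) \<le> C * M"
  proof (rule abs_integral_unit_le)
    show "continuous_on {0..1} (\<lambda>t. of_real (\<phi> t) * (y t + of_real (\<phi> t) * R y v 0))"
      by (intro continuous_intros)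
    show "norm (of_real (\<phi> t) * (y t + of_real (\<phi> t) * R y v 0)) \<le> C * M" if "t \<in> {0..1}" for t
      unfolding norm_mult using bounds that M C_ge by (intro mult_mono) auto
  qed
  also have "integral {0..1} (\<lambda>t. of_real (\<phi> t) * (y t + of_real (\<phi> t) * R y v 0)) = \<Psi> y + of_real \<Phi> * R y v 0"
  proof (rule integral_unique)
    have "((\<lambda>t. of_real ((\<phi> t)\<^sup>2) * R y v 0) has_integral of_real \<Phi> * R y v 0) {0..1}"
      unfolding \<Phi>_def
      by (intro has_integral_mult_left has_integral_of_real integrable_integral integrable_continuous_real continuous_intros)
    moreover have "((\<lambda>t. of_real (\<phi> t) * y t) has_integral \<Psi> y) {0..1}"
      unfolding \<Psi>_def by (intro integrable_integral integrable_continuous_real continuous_intros)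
    ultimately show "((\<lambda>t. of_real (\<phi> t) * (y t + of_real (\<phi> t) * R y v 0)) has_integral \<Psi> y + of_real \<Phi> * R y v 0) {0..1}"
      by (auto simp: power2_eq_square algebra_simps dest: has_integral_add)
  qed
  finally have 1: "norm (\<Psi> y + of_real \<Phi> * R y v 0) \<le> C * M" .
  have eq: "\<Psi> y / of_real (D 0) + R y v 0 / 3
      = ((\<Psi> y + of_real \<Phi> * R y v 0) - of_real (\<Phi> - D 0 / 3) * R y v 0) / of_real (D 0)"
    using D_nonzero[of 0, where 'a='a] by (simp add: field_simps)
  have "norm (((\<Psi> y + of_real \<Phi> * R y v 0) - of_real (\<Phi> - D 0 / 3) * R y v 0) / of_real (D 0)) \<le> norm ((\<Psi> y + of_real \<Phi> * R y v 0) - of_real (\<Phi> - D 0 / 3) * R y v 0) / 1"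
    unfolding norm_divide using D_ge[of 0] by (intro divide_left_mono) auto
  also have "\<dots> \<le> C * M + \<bar>\<epsilon>\<bar> * C\<^sup>2 * norm (R y v 0)"
    using \<Phi>_approx 1 
    by (auto simp: norm_mult simp del: of_real_diff intro!: order_trans[OF norm_triangle_ineq4] add_mono mult_right_mono)
  finally show ?thesis unfolding eq .
qed

end

section \<open>Exclusion of unstable multipliers\<close>

lemma delay_characteristic_no_root:
  fixes w :: complex
  assumes K: "- (pi\<^sup>2 / 2) < K" "K < 0" and "w \<noteq> 0" "Re w \<ge> 0"
    and eq: "w\<^sup>2 = of_real K * (1 - exp (- w))"
  shows False
proof -
  define a b where "a = Re w" and "b = Im w"
  have "norm (exp (- w)) \<le> 1" using \<open>Re w \<ge> 0\<close> by simp
  then have "norm (1 - exp (- w)) \<le> 2" using norm_triangle_ineq4[of 1 "exp (- w)"] unfolding norm_one by linarith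
  then have "norm (w\<^sup>2) \<le> \<bar>K\<bar> * 2" unfolding eq norm_mult by (simp add: mult_left_mono)
  then have "(norm w)\<^sup>2 < pi\<^sup>2" using K by (simp add: norm_power)
  then have "norm w < pi" by (rule power2_less_imp_less) simp
  then have b: "\<bar>b\<bar> < pi" using abs_Im_le_cmod[of w] by (simp add: b_def)
  have "Im (w\<^sup>2) = K * (exp (- a) * sin b)"
    unfolding eq by (simp add: Im_exp a_def b_def)
  then have Im: "2 * a * b = K * (exp (- a) * sin b)"
    by (simp add: power2_eq_square a_def b_def mult_ac)
  have Re: "a\<^sup>2 - b\<^sup>2 = K * (1 - exp (- a) * cos b)"
    using arg_cong[OF eq, of Re] by (simp add: Re_exp a_def b_def power2_eq_square)
  show False
  proof (cases "b = 0")
    case True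
    then have "a\<^sup>2 = K * (1 - exp (- a))" using Re by simp
    also have "\<dots> \<le> 0" using K \<open>Re w \<ge> 0\<close> by (intro mult_nonpos_nonneg) (auto simp: a_def)
    finally have "a = 0" by simp
    then show False using True \<open>w \<noteq> 0\<close> by (simp add: a_def b_def complex_eq_iff)
  next
    case False
    \<comment> \<open>For |b| < pi the sine has the sign of b; multiplying the imaginary part by b
      makes its left side nonnegative and its right side negative.\<close>
    have "b * sin b > 0"
    proof (cases "b > 0")
      case True
      then show ?thesis using b sin_gt_zero[of b] by simp
    next
      assume "\<not> b > 0"
      then show ?thesis using b False sin_gt_zero[of "- b"] by (simp add: mult_neg_neg)
    qed
    then have "K * (exp (- a) * (b * sin b)) < 0" using K by (intro mult_neg_pos) auto
    moreover have "2 * a * b\<^sup>2 \<ge> 0" using \<open>Re w \<ge> 0\<close> by (simp add: a_def)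
    moreover have "2 * a * b\<^sup>2 = K * (exp (- a) * (b * sin b))"
      using arg_cong[OF Im, of "\<lambda>x. b * x"] by (simp add: power2_eq_square algebra_simps)
    ultimately show False by simp
  qed
qed

lemma norm_one_minus_power_le:
  fixes z :: complex
  assumes "norm z \<le> 1"
  shows "norm (1 - z ^ i) \<le> real i * norm (1 - z)"
proof -
  have "norm (1 ^ i - z ^ i) \<le> real i * norm (1 - z)"
    by (rule norm_power_diff) (use assms in auto)
  then show ?thesis by simp
qed

text \<open>
  With \<open>\<nu> = exp (w / n)\<close> the estimate becomes \<open>w\<^sup>2 = K (1 - exp (- w))\<close> as \<open>n \<rightarrow> \<infinity>\<close>.
  The limit does not vanish because for \<open>w \<rightarrow> 0\<close> the estimate divided by \<open>w\<close> would give \<open>K = 0\<close>.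
\<close>

lemma no_unstable_multiplier_sequence:
  fixes \<nu> :: "nat \<Rightarrow> complex" and n :: "nat \<Rightarrow> nat"
  assumes K: "- (pi\<^sup>2 / 2) < K" "K < 0" and "M \<ge> 0"
    and n: "\<And>j. n j \<ge> Suc j" and \<nu>: "\<And>j. norm (\<nu> j) \<ge> 1"
    and est: "\<And>j. norm ((\<nu> j - 1) - \<nu> j * of_real (K / (n j)\<^sup>2) * (\<Sum>i=1..n j. inverse (\<nu> j) ^ i))
       \<le> M * (norm (\<nu> j) + 1) / (n j)\<^sup>2"
  shows False
proof -
  \<comment> \<open>The inverses stay in the closed unit disk even if \<nu> is unbounded, and after
    multiplication by \<open>l\<close> the error bound no longer contains |\<nu>|.\<close>
  define l where "l j = inverse (\<nu> j)" for j
  define S where "S j = (\<Sum>i=1..n j. l j ^ i)" for j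
  have npos: "real (n j) > 0" for j using n[of j] by simp
  have \<nu>0: "\<nu> j \<noteq> 0" for j using \<nu>[of j] by auto
  have l0: "l j \<noteq> 0" and l1: "norm (l j) \<le> 1" for j
    using \<nu>0[of j] \<nu>[of j] by (auto simp: l_def norm_inverse intro!: inverse_le_1_iff[THEN iffD2])
  define B where "B = \<bar>K\<bar> + 2 * M"
  have "B > 0" using K \<open>M \<ge> 0\<close> by (simp add: B_def)
  have est1: "norm ((1 - l j) - of_real (K / (n j)\<^sup>2) * S j) \<le> 2 * M / (n j)\<^sup>2" for j
  proof -
    have "(1 - l j) - of_real (K / (n j)\<^sup>2) * S j
      = l j * ((\<nu> j - 1) - \<nu> j * of_real (K / (n j)\<^sup>2) * S j)"
      using \<nu>0[of j] by (simp add: l_def field_simps)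
    also have "norm (l j * ((\<nu> j - 1) - \<nu> j * of_real (K / (n j)\<^sup>2) * S j))
       \<le> norm (l j) * (M * (norm (\<nu> j) + 1) / (n j)\<^sup>2)"
      unfolding norm_mult[of "l j"] using est[of j] by (intro mult_left_mono) (auto simp: S_def l_def)
    also have "\<dots> = M * (1 + norm (l j)) / (n j)\<^sup>2"
      using \<nu>0[of j] by (simp add: l_def norm_inverse distrib_left mult_ac)
    also have "\<dots> \<le> M * (1 + 1) / (n j)\<^sup>2"
      using l1[of j] \<open>M \<ge> 0\<close> by (intro divide_right_mono mult_left_mono add_left_mono) auto
    finally show ?thesis by (simp add: mult.commute)
  qed
  have S_le: "norm (S j) \<le> n j" for j
  proof -
    have "norm (S j) \<le> (\<Sum>i=1..n j. 1)"
      unfolding S_def by (rule sum_norm_le) (simp add: norm_power power_le_one l1)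
    then show ?thesis by simp
  qed
  have S_approx: "norm (S j - n j) \<le> real (n j) * (real (n j) * norm (1 - l j))" for j
  proof -
    have "S j - n j = (\<Sum>i=1..n j. l j ^ i - 1)" by (simp add: S_def sum_subtractf)
    also have "norm (\<Sum>i=1..n j. l j ^ i - 1) \<le> (\<Sum>i=1..n j. real (n j) * norm (1 - l j))"
    proof (rule sum_norm_le)
      fix i assume "i \<in> {1..n j}"
      then have "real i * norm (1 - l j) \<le> real (n j) * norm (1 - l j)" by (intro mult_right_mono) auto
      then show "norm (l j ^ i - 1) \<le> real (n j) * norm (1 - l j)"
        using norm_one_minus_power_le[OF l1, of j i] by (simp add: norm_minus_commute)
    qed
    finally show ?thesis by simp
  qed
  \<comment> \<open>As S has norm at most n, the term K S / n^2 is of order 1/n, which forces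
    \<open>l\<close> to 1 at that rate.\<close>
  have l_near: "norm (1 - l j) \<le> B / n j" for j
  proof -
    have "norm (1 - l j) \<le> norm ((1 - l j) - of_real (K / (n j)\<^sup>2) * S j) + norm (of_real (K / (n j)\<^sup>2) * S j)"
      using norm_triangle_sub[of "1 - l j"] by (simp add: add.commute)
    also have "\<dots> \<le> 2 * M / (n j)\<^sup>2 + \<bar>K / (n j)\<^sup>2\<bar> * n j"
      using est1[of j] S_le[of j] unfolding norm_mult norm_of_real by (intro add_mono mult_left_mono) auto
    also have "\<bar>K / (n j)\<^sup>2\<bar> * n j = \<bar>K\<bar> / n j"
      using npos[of j] by (simp add: power2_eq_square)
    also have "2 * M / (n j)\<^sup>2 \<le> 2 * M / n j"
      using n[of j] \<open>M \<ge> 0\<close> by (intro divide_left_mono) (auto simp: power2_eq_square)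
    finally show ?thesis by (simp add: B_def add_divide_distrib)
  qed
  have n_lim: "filterlim n at_top at_top"
    by (rule filterlim_at_top_mono[OF filterlim_Suc]) (use n in auto)
  then have n_lim': "filterlim (\<lambda>j. real (n j)) at_top at_top"
    by (rule filterlim_compose[OF filterlim_real_sequentially])
  have inv_lim: "(\<lambda>j. c / real (n j)) \<longlonglongrightarrow> 0" for c
    by (rule real_tendsto_divide_at_top[OF tendsto_const n_lim'])
  \<comment> \<open>Two versions of the rescaled exponent: \<open>z\<close> fits the estimate
    algebraically, while \<open>w\<close> makes \<open>exp (- w j) = l j ^ n j\<close> exact. Their
    difference is of order 1/n, so they share their limit.\<close>
  define z where "z j = of_nat (n j) * (1 - l j)" for j
  define w where "w j = - of_nat (n j) * Ln (l j)" for j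
  have exp_w: "exp (- w j) = l j ^ n j" for j
    using l0[of j] by (simp add: w_def exp_of_nat_mult)
  have Re_w: "Re (w j) \<ge> 0" for j
    using l0[of j] l1[of j] by (auto simp: w_def mult_le_0_iff ln_le_zero_iff)
  have "\<forall>\<^sub>F j in sequentially. 2 * B < real (n j)"
    using n_lim' by (simp add: filterlim_at_top_dense)
  then have wz_le: "\<forall>\<^sub>F j in sequentially. norm (w j) \<le> 2 * B \<and> norm (w j - z j) \<le> 2 * B\<^sup>2 / n j"
  proof eventually_elim
    case (elim j)
    have small: "norm (l j - 1) < 1 / 2"
    proof -
      have "B / real (n j) < 1 / 2" using elim npos[of j] by (simp add: field_simps)
      then show ?thesis using l_near[of j] unfolding norm_minus_commute[of "l j"] by linarith
    qed
    have "norm (Ln (1 + (l j - 1))) \<le> 2 * norm (l j - 1)" by (rule norm_Ln_le) (rule small)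
    also have "\<dots> \<le> 2 * (B / n j)" using l_near[of j] by (simp add: norm_minus_commute)
    finally have 1: "norm (w j) \<le> 2 * B"
      using npos[of j] by (simp add: w_def norm_mult field_simps)
    have "w j - z j = - of_nat (n j) * (Ln (1 + (l j - 1)) - (l j - 1))"
      by (simp add: w_def z_def algebra_simps)
    moreover have "norm (Ln (1 + (l j - 1)) - (l j - 1)) \<le> 2 * (B / n j)\<^sup>2"
    proof -
      have "norm (Ln (1 + (l j - 1)) - (l j - 1)) \<le> (norm (l j - 1))\<^sup>2 / (1 - norm (l j - 1))"
        by (rule Ln_approx_linear) (use small in simp)
      also have "\<dots> \<le> (norm (l j - 1))\<^sup>2 / (1 / 2)"
        using small by (intro divide_left_mono) auto
      also have "\<dots> \<le> (B / n j)\<^sup>2 / (1 / 2)"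
        using l_near[of j] by (intro divide_right_mono power_mono) (auto simp: norm_minus_commute)
      finally show ?thesis by simp
    qed
    ultimately have "norm (w j - z j) \<le> real (n j) * (2 * (B / n j)\<^sup>2)"
      using npos[of j] by (simp add: norm_mult)
    then show ?case using 1 npos[of j] by (simp add: power2_eq_square)
  qed
  then obtain j0 where j0: "\<And>j. j \<ge> j0 \<Longrightarrow> norm (w j) \<le> 2 * B"
    "\<And>j. j \<ge> j0 \<Longrightarrow> norm (w j - z j) \<le> 2 * B\<^sup>2 / n j"
    unfolding eventually_sequentially by blast
  have "seq_compact (cball (0::complex) (2 * B))" by (simp add: compact_imp_seq_compact)
  moreover have "\<forall>i. w (i + j0) \<in> cball 0 (2 * B)" using j0(1) by simp
  ultimately obtain W r where r: "strict_mono r" and "((\<lambda>i. w (i + j0)) \<circ> r) \<longlonglongrightarrow> W"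
    using seq_compactE[of "cball 0 (2 * B)" "\<lambda>i. w (i + j0)"] by metis
  define s where "s i = r i + j0" for i
  have w_lim: "(\<lambda>i. w (s i)) \<longlonglongrightarrow> W"
    using \<open>((\<lambda>i. w (i + j0)) \<circ> r) \<longlonglongrightarrow> W\<close> by (simp add: o_def s_def)
  have s_lim: "filterlim s at_top at_top"
    unfolding s_def using filterlim_subseq[OF r] by (rule filterlim_at_top_mono) auto
  have inv_s: "(\<lambda>i. c / real (n (s i))) \<longlonglongrightarrow> 0" for c
    by (rule filterlim_compose[OF inv_lim s_lim])
  have "(\<lambda>i. w (s i) - z (s i)) \<longlonglongrightarrow> 0"
    by (rule tendsto_0_le[OF inv_s[of "2 * B\<^sup>2"], of _ 1])
      (auto simp: s_def intro!: always_eventually order_trans[OF j0(2)])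
  then have z_lim: "(\<lambda>i. z (s i)) \<longlonglongrightarrow> W"
    using tendsto_diff[OF w_lim] by fastforce
  have l_lim: "(\<lambda>i. 1 - l (s i)) \<longlonglongrightarrow> 0"
    by (rule tendsto_0_le[OF inv_s[of B], of _ 1])
      (use \<open>B > 0\<close> in \<open>auto intro!: always_eventually order_trans[OF l_near]\<close>)
  have l_lim': "(\<lambda>i. l (s i)) \<longlonglongrightarrow> 1"
    using tendsto_diff[OF tendsto_const[of 1] l_lim] by simp
  have "W \<noteq> 0"
  proof
    assume "W = 0"
    then have z0: "(\<lambda>i. z (s i)) \<longlonglongrightarrow> 0" using z_lim by simp
    have "(\<lambda>i. S (s i) / of_nat (n (s i)) - 1) \<longlonglongrightarrow> 0"
    proof (rule tendsto_0_le[OF z0, of _ 1], rule always_eventually, rule allI)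
      fix i
      have "S (s i) / of_nat (n (s i)) - 1 = (S (s i) - of_nat (n (s i))) / of_nat (n (s i))"
        using npos[of "s i"] by (simp add: field_simps)
      also have "norm \<dots> \<le> norm (z (s i)) * 1"
        using divide_right_mono[OF S_approx[of "s i"], of "real (n (s i))"] npos[of "s i"]
        by (simp add: norm_divide norm_mult z_def)
      finally show "norm (S (s i) / of_nat (n (s i)) - 1) \<le> norm (z (s i)) * 1" .
    qed
    then have "(\<lambda>i. S (s i) / of_nat (n (s i))) \<longlonglongrightarrow> 1"
      using LIM_zero_iff by blast
    then have "(\<lambda>i. z (s i) - of_real K * (S (s i) / of_nat (n (s i)))) \<longlonglongrightarrow> 0 - of_real K * 1"
      by (intro tendsto_intros z0)
    moreover have "(\<lambda>i. z (s i) - of_real K * (S (s i) / of_nat (n (s i)))) \<longlonglongrightarrow> 0"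
    proof (rule tendsto_0_le[OF inv_s[of "2 * M"], of _ 1], rule always_eventually, rule allI)
      fix i
      have "z (s i) - of_real K * (S (s i) / of_nat (n (s i)))
        = of_nat (n (s i)) * ((1 - l (s i)) - of_real (K / (n (s i))\<^sup>2) * S (s i))"
        using npos[of "s i"] by (simp add: z_def field_simps power2_eq_square)
      then have "norm (z (s i) - of_real K * (S (s i) / of_nat (n (s i)))) \<le> real (n (s i)) * (2 * M / (n (s i))\<^sup>2)"
        using mult_left_mono[OF est1[of "s i"], of "real (n (s i))"] by (simp add: norm_mult del: of_real_divide)
      also have "\<dots> = 2 * M / n (s i)" using npos[of "s i"] by (simp add: power2_eq_square)
      finally show "norm (z (s i) - of_real K * (S (s i) / of_nat (n (s i)))) \<le> norm (2 * M / n (s i)) * 1"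
        using \<open>M \<ge> 0\<close> by simp
    qed
    ultimately have "0 - of_real K * 1 = (0::complex)" by (rule LIMSEQ_unique)
    then show False using K by simp
  qed
  have "(\<lambda>i. (z (s i))\<^sup>2 - of_real K * (l (s i) * (1 - exp (- w (s i))))) \<longlonglongrightarrow> W\<^sup>2 - of_real K * (1 * (1 - exp (- W)))"
    by (intro tendsto_intros z_lim w_lim l_lim')
  \<comment> \<open>This is the estimate multiplied by n^2 (1 - l): telescoping turns S (1 - l) into
    l (1 - l^n), and the error 2 M |1 - l| tends to 0.\<close>
  moreover have "(\<lambda>i. (z (s i))\<^sup>2 - of_real K * (l (s i) * (1 - exp (- w (s i))))) \<longlonglongrightarrow> 0"
  proof (rule tendsto_0_le[OF l_lim, of _ "2 * M"], rule always_eventually, rule allI)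
    fix i
    let ?n = "of_nat (n (s i)) :: complex"
    have geo: "S (s i) * (1 - l (s i)) = l (s i) * (1 - l (s i) ^ n (s i))"
    proof -
      have "(\<Sum>i=1..m. x ^ i) * (1 - x) = x * (1 - x ^ m)" for x :: complex and m
      proof (induction m)
        case (Suc m)
        have "(\<Sum>i=1..Suc m. x ^ i) * (1 - x) = x * (1 - x ^ m) + x ^ Suc m * (1 - x)"
        proof -
          have "(\<Sum>i=1..Suc m. x ^ i) = (\<Sum>i=1..m. x ^ i) + x ^ Suc m" by simp
          then show ?thesis unfolding Suc[symmetric] by (simp only: distrib_right)
        qed
        also have "x * (1 - x ^ m) + x ^ Suc m * (1 - x) = x * (1 - x ^ Suc m)"
          by (simp add: algebra_simps)
        finally show ?case .
      qed simp
      then show ?thesis by (simp add: S_def)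
    qed
    have "(z (s i))\<^sup>2 - of_real K * (l (s i) * (1 - exp (- w (s i))))
      = (z (s i))\<^sup>2 - of_real K * (S (s i) * (1 - l (s i)))"
      by (simp add: exp_w geo)
    also have "\<dots> = ?n\<^sup>2 * (1 - l (s i)) * ((1 - l (s i)) - of_real (K / (n (s i))\<^sup>2) * S (s i))"
      using npos[of "s i"] by (simp add: z_def field_simps power2_eq_square)
    finally have "norm ((z (s i))\<^sup>2 - of_real K * (l (s i) * (1 - exp (- w (s i)))))
       = (real (n (s i)))\<^sup>2 * norm (1 - l (s i)) * norm ((1 - l (s i)) - of_real (K / (n (s i))\<^sup>2) * S (s i))"
      by (simp add: norm_mult norm_power del: of_real_divide)
    also have "\<dots> \<le> (real (n (s i)))\<^sup>2 * norm (1 - l (s i)) * (2 * M / (n (s i))\<^sup>2)"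
      by (intro mult_left_mono est1) auto
    also have "\<dots> = norm (1 - l (s i)) * (2 * M)"
      using npos[of "s i"] by simp
    finally show "norm ((z (s i))\<^sup>2 - of_real K * (l (s i) * (1 - exp (- w (s i))))) \<le> norm (1 - l (s i)) * (2 * M)" .
  qed
  ultimately have "W\<^sup>2 - of_real K * (1 * (1 - exp (- W))) = 0" by (rule LIMSEQ_unique)
  then have "W\<^sup>2 = of_real K * (1 - exp (- W))" by simp
  moreover have "Re W \<ge> 0"
    by (rule tendsto_lowerbound[OF tendsto_Re[OF w_lim]]) (auto simp: Re_w)
  ultimately show False
    using delay_characteristic_no_root[OF K \<open>W \<noteq> 0\<close>] by blast
qed

section \<open>The uncontrolled Hill problem and the multiplier estimate\<close>

context hill
begin

lemma \<Phi>_pos: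
  assumes "\<bar>\<epsilon>\<bar> * C\<^sup>2 < 1 / 3"
  shows "\<Phi> > 0"
  using \<Phi>_approx D_ge[of 0] assms by linarith

lemma homogeneous_zero_parameter:
  fixes y :: "real \<Rightarrow> 'a::{real_normed_field,banach}"
  assumes sol: "hill_solution \<epsilon> u 0 (\<lambda>_. 0) y v" and t: "t \<in> {0..1}"
  shows "P y v t = P y v 0" "norm (R y v t - R y v 0) \<le> 2 * \<bar>\<epsilon>\<bar> * C\<^sup>2 * norm (P y v 0)"
proof -
  have "bounded (y ` {0..1})"
    by (intro compact_imp_bounded compact_continuous_image hill_continuous[OF sol]) auto
  then obtain N where "\<And>s. s \<in> {0..1} \<Longrightarrow> norm (y s) \<le> N" unfolding bounded_iff by blast
  from P_increment[OF sol t this, of 0]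
  show "P y v t = P y v 0" "norm (R y v t - R y v 0) \<le> 2 * \<bar>\<epsilon>\<bar> * C\<^sup>2 * norm (P y v 0)" by auto
qed

text \<open>Antiperiodicity asks \<open>R\<close> to gain P(0)/D(0), but its drift is at most 2
  |\<epsilon>| C^2 |P(0)|. Since D(0) is at most 5 C^2, small \<epsilon> leaves only P(0) = 0, the
  multiples of \<open>\<phi>\<close>.\<close>

lemma antiperiodic_unique:
  fixes y :: "real \<Rightarrow> 'a::{real_normed_field,banach}"
  assumes sol: "hill_solution \<epsilon> u 0 (\<lambda>_. 0) y v" and "10 * C ^ 4 * \<bar>\<epsilon>\<bar> < 1"
    and bd: "y 1 = - y 0" "v 1 = - v 0"
  shows "\<exists>c. \<forall>t\<in>{0..1}. y t = c * of_real (\<phi> t) \<and> v t = c * of_real (\<phi>' t)"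
proof -
  have "R y v 1 = R y v 0 + P y v 0 / of_real (D 0)"
    using boundary_iff[of y 1 0 v] bd by simp
  then have "norm (P y v 0 / of_real (D 0)) = norm (R y v 1 - R y v 0)" by simp
  also have "\<dots> \<le> 2 * \<bar>\<epsilon>\<bar> * C\<^sup>2 * norm (P y v 0)" by (rule homogeneous_zero_parameter[OF sol]) simp
  finally have "norm (P y v 0) \<le> 2 * \<bar>\<epsilon>\<bar> * C\<^sup>2 * norm (P y v 0) * D 0"
    using D_ge[of 0] by (simp add: norm_divide field_simps)
  also have "\<dots> \<le> 2 * \<bar>\<epsilon>\<bar> * C\<^sup>2 * norm (P y v 0) * (5 * C\<^sup>2)"
    by (intro mult_left_mono D_le) auto
  also have "\<dots> = (10 * C ^ 4 * \<bar>\<epsilon>\<bar>) * norm (P y v 0)"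
    by (simp add: power2_eq_square power4_eq_xxxx)
  finally have "(1 - 10 * C ^ 4 * \<bar>\<epsilon>\<bar>) * norm (P y v 0) \<le> 0" by (simp add: algebra_simps)
  then have P0: "P y v 0 = 0" using assms(2) by (simp add: mult_le_0_iff)
  have "y t = - R y v 0 * of_real (\<phi> t) \<and> v t = - R y v 0 * of_real (\<phi>' t)" if "t \<in> {0..1}" for t
    using reconstruct[where y=y and v=v and t=t] homogeneous_zero_parameter[OF sol that] P0 by simp
  then show ?thesis by blast
qed

text \<open>For b = 0 the coordinate \<open>P\<close> is constant, so \<nu> \<noteq> 1 makes it
  vanish; then \<open>R\<close> is constant too and vanishes for the same reason.\<close>

lemma no_other_multiplier_zero_parameter:
  fixes y :: "real \<Rightarrow> 'a::{real_normed_field,banach}"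
  assumes sol: "hill_solution \<epsilon> u 0 (\<lambda>_. 0) y v" and "\<nu> \<noteq> 1"
    and bd: "y 1 = - \<nu> * y 0" "v 1 = - \<nu> * v 0" and t: "t \<in> {0..1}"
  shows "y t = 0"
proof -
  have PR: "P y v 1 = \<nu> * P y v 0" "R y v 1 = \<nu> * (R y v 0 + P y v 0 / of_real (D 0))"
    using boundary_iff[of y \<nu> 0 v] bd by auto
  have "P y v 1 = P y v 0" by (rule homogeneous_zero_parameter[OF sol]) simp
  then have P0: "P y v 0 = 0" using PR(1) \<open>\<nu> \<noteq> 1\<close> by simp
  then have R: "R y v s = R y v 0" if "s \<in> {0..1}" for s
    using homogeneous_zero_parameter(2)[OF sol that] by simp
  have "R y v 0 = 0" using PR(2) P0 R[of 1] \<open>\<nu> \<noteq> 1\<close> by simp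
  then show ?thesis
    using reconstruct(1)[of y t v] homogeneous_zero_parameter(1)[OF sol t] P0 R[OF t] by simp
qed

text \<open>Solvability condition: the forcing changes \<open>P\<close> by c times the integral of
  \<phi>^2, whereas the boundary condition, whatever d, returns \<open>P\<close> to its initial
  value.\<close>

lemma no_resonant_forcing:
  fixes y :: "real \<Rightarrow> 'a::{real_normed_field,banach}"
  assumes sol: "hill_solution \<epsilon> u 0 (\<lambda>t. c * of_real (\<phi> t)) y v" and "\<bar>\<epsilon>\<bar> * C\<^sup>2 < 1 / 3"
    and bd: "y 1 = - y 0 - d * of_real (\<phi> 0)" "v 1 = - v 0 - d * of_real (\<phi>' 0)"
  shows "c = 0"
proof -
  have "((\<lambda>t. of_real (\<phi> t) * (0 * y t + c * of_real (\<phi> t))) has_integral P y v 1 - P y v 0) {0..1}"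
    by (intro fundamental_theorem_of_calculus P_deriv[OF sol]) auto
  moreover have "((\<lambda>t. c * of_real ((\<phi> t)\<^sup>2)) has_integral c * of_real \<Phi>) {0..1}"
    unfolding \<Phi>_def
    by (intro has_integral_mult_right has_integral_of_real integrable_integral integrable_continuous_real continuous_intros)
  moreover have "(\<lambda>t. of_real (\<phi> t) * (0 * y t + c * of_real (\<phi> t))) = (\<lambda>t. c * of_real ((\<phi> t)\<^sup>2))"
    by (simp add: fun_eq_iff power2_eq_square algebra_simps)
  ultimately have "P y v 1 - P y v 0 = c * of_real \<Phi>" by (metis has_integral_unique)
  moreover have "P y v 1 = P y v 0"
    using boundary_iff[of y 1 d v] bd by simp
  ultimately show ?thesis using \<Phi>_pos[OF assms(2)] by simp
qed

text \<open>The first boundary relation is (\<nu> - 1) P(0) = b \<Psi>(y), and b = k S (\<nu> - 1)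
  with S the sum of the inverse powers. Cancelling gives P(0) = k S \<Psi>(y), so P(0) is small
  against R(0) uniformly near \<nu> = 1. The second relation, with \<Psi>(y)/D(0) replaced by
  -R(0)/3 up to an error and divided by R(0), is the estimate.\<close>

lemma multiplier_estimate:
  fixes \<nu> :: complex
  assumes sol: "hill_solution \<epsilon> u (of_real k * (1 - inverse \<nu> ^ n)) (\<lambda>_. 0) y v"
    and bd: "y 1 = - \<nu> * y 0" "v 1 = - \<nu> * v 0"
    and nontrivial: "t0 \<in> {0..1}" "y t0 \<noteq> 0"
    and \<nu>: "norm \<nu> \<ge> 1" "\<nu> \<noteq> 1"
    and k: "\<bar>k\<bar> \<le> k0 / (real n)\<^sup>2" "\<bar>\<epsilon>\<bar> \<le> k0 / (real n)\<^sup>2"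
    and n: "n \<ge> 1" "16 * C ^ 4 * k0 \<le> real n"
  shows "norm ((\<nu> - 1) - \<nu> * of_real k * (\<Sum>i=1..n. inverse \<nu> ^ i) / 3)
    \<le> (133 * C ^ 8 * k0\<^sup>2 * norm \<nu> + 74 * C ^ 6 * k0) / (real n)\<^sup>2"
proof -
  define b where "b = of_real k * (1 - inverse \<nu> ^ n)"
  define S where "S = (\<Sum>i=1..n. inverse \<nu> ^ i)"
  define p r where "p = norm (P y v 0)" and "r = norm (R y v 0)"
  \<comment> \<open>\<open>e\<close> bounds the norm of k S: each of the n powers is at most 1, and
    |k| is at most k0 / n^2.\<close>
  define e where "e = k0 / real n"
  note sol = sol[folded b_def]
  have npos: "real n \<ge> 1" using n by simp
  have "k0 \<ge> 0"
    using order_trans[OF abs_ge_zero k(1)] npos by (simp add: zero_le_divide_iff)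
  have k0n: "k0 / (real n)\<^sup>2 = e / real n" by (simp add: e_def power2_eq_square)
  have "e \<ge> 0" using \<open>k0 \<ge> 0\<close> by (simp add: e_def)
  have Ce: "16 * C ^ 4 * e \<le> 1" using n npos by (simp add: e_def field_simps)
  have en: "e / real n \<le> e" using divide_left_mono[of 1 "real n" e] \<open>e \<ge> 0\<close> npos by simp
  have Cpow: "C ^ i \<le> C ^ j" if "i \<le> j" for i j using that C_ge by (intro power_increasing) auto
  have C0: "C \<ge> 0" using C_ge by simp
  then have Cpos: "C ^ i \<ge> 0" for i by simp
  have inv: "norm (inverse \<nu>) \<le> 1" using \<nu> by (simp add: norm_inverse inverse_le_1_iff)
  have S_le: "norm S \<le> n"
  proof -
    have "norm S \<le> (\<Sum>i=1..n. 1)"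
      unfolding S_def by (rule sum_norm_le) (use inv in \<open>simp add: norm_power power_le_one\<close>)
    then show ?thesis by simp
  qed
  have kS: "norm (of_real k * S) \<le> e"
  proof -
    have "norm (of_real k * S) \<le> (e / real n) * n"
      unfolding norm_mult norm_of_real using k S_le \<open>e \<ge> 0\<close> by (intro mult_mono) (auto simp: k0n)
    then show ?thesis using npos by simp
  qed
  have \<nu>0: "\<nu> \<noteq> 0" using \<nu> by auto
  have b_S: "b = of_real k * S * (\<nu> - 1)"
  proof -
    have "(\<Sum>i=1..m. inverse \<nu> ^ i) * (\<nu> - 1) = 1 - inverse \<nu> ^ m" for m
    proof (induction m)
      case (Suc m)
      have "inverse \<nu> ^ Suc m * (\<nu> - 1) = inverse \<nu> ^ m - inverse \<nu> ^ Suc m"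
        using \<nu>0 by (simp add: field_simps)
      then show ?case using Suc by (simp add: distrib_right)
    qed simp
    then show ?thesis by (simp add: b_def S_def mult.assoc)
  qed
  have b_le: "norm b \<le> 2 * (e / real n)"
  proof -
    have "norm (inverse \<nu> ^ n) \<le> 1" using inv by (simp add: norm_power power_le_one)
    then have "norm (1 - inverse \<nu> ^ n) \<le> 2"
      using norm_triangle_ineq4[of 1 "inverse \<nu> ^ n"] by simp
    then have "\<bar>k\<bar> * norm (1 - inverse \<nu> ^ n) \<le> (e / real n) * 2"
      using k \<open>e \<ge> 0\<close> by (intro mult_mono) (auto simp: k0n)
    then show ?thesis by (simp add: b_def norm_mult mult.commute)
  qed
  have "8 * C ^ 4 * norm b \<le> 8 * C ^ 4 * (2 * e)"
    using b_le en Cpos by (intro mult_left_mono) auto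
  then have b_small: "8 * C ^ 4 * norm b \<le> 1" using Ce by linarith
  have N: "norm (y s) \<le> 6 * C ^ 3 * (p + r)" if "s \<in> {0..1}" for s
    using hill_bound[OF sol that _ b_small, of 0] by (simp add: p_def r_def)
  have PR: "P y v 1 = \<nu> * P y v 0" "R y v 1 = \<nu> * (R y v 0 + P y v 0 / of_real (D 0))"
    using boundary_iff[of y \<nu> 0 v] bd by auto
  have P0: "P y v 0 = of_real k * S * \<Psi> y"
  proof -
    have "(\<nu> - 1) * P y v 0 = (\<nu> - 1) * (of_real k * S * \<Psi> y)"
      using P_total[OF sol] unfolding PR b_S by (simp add: algebra_simps)
    then show ?thesis using \<nu> by simp
  qed
  have \<Psi>_le: "norm (\<Psi> y) \<le> C * (6 * C ^ 3 * (p + r))"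
    by (rule \<Psi>_le[OF hill_continuous(1)[OF sol] N])
  have p_le: "p \<le> 6 * C ^ 4 * e * (p + r)"
  proof -
    have "p \<le> e * (C * (6 * C ^ 3 * (p + r)))"
    proof -
      have "p = norm (of_real k * S) * norm (\<Psi> y)" by (simp add: p_def P0 norm_mult)
      then show ?thesis using kS \<Psi>_le \<open>e \<ge> 0\<close> by (simp only:) (intro mult_mono; simp)
    qed
    then show ?thesis by (simp add: power4_eq_xxxx power3_eq_cube mult_ac)
  qed
  \<comment> \<open>A coefficient of 1/2 suffices to absorb p and gives p \<le> r; reinserting this
    into \<open>p_le\<close> recovers the small factor e.\<close>
  have "6 * C ^ 4 * e \<le> 1 / 2" using Ce by linarith
  moreover have "p \<ge> 0" "r \<ge> 0" by (auto simp: p_def r_def)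
  ultimately have "6 * C ^ 4 * e * (p + r) \<le> 1 / 2 * (p + r)" by (intro mult_right_mono) auto
  then have pr: "p \<le> r" using p_le by simp
  then have "6 * C ^ 4 * e * (p + r) \<le> 6 * C ^ 4 * e * (2 * r)"
    using \<open>e \<ge> 0\<close> Cpos by (intro mult_left_mono) auto
  then have p_le': "p \<le> 12 * C ^ 4 * e * r" using p_le by linarith
  have N': "norm (y s) \<le> 12 * C ^ 3 * r" if "s \<in> {0..1}" for s
  proof -
    have "6 * C ^ 3 * (p + r) \<le> 6 * C ^ 3 * (2 * r)" using pr C_ge by (intro mult_left_mono) auto
    then show ?thesis using N[OF that] by linarith
  qed
  \<comment> \<open>R(0) cannot vanish, since it bounds all of y and y is not identically
    zero.\<close>
  have "r > 0"
    using N'[OF nontrivial(1)] nontrivial(2) \<open>r \<ge> 0\<close> by (cases "r = 0") auto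
  have M: "norm (y s + of_real (\<phi> s) * R y v 0) \<le> 132 * C ^ 7 * e * r" if "s \<in> {0..1}" for s
  proof -
    have "norm (y s + of_real (\<phi> s) * R y v 0) \<le> 3 * C ^ 3 * p + 4 * C ^ 4 * (norm b * (12 * C ^ 3 * r) + 0)"
      unfolding p_def by (rule hill_approx[OF sol that N']) auto
    also have "\<dots> \<le> 3 * C ^ 3 * (12 * C ^ 4 * e * r) + 4 * C ^ 4 * ((2 * e) * (12 * C ^ 3 * r) + 0)"
      using p_le' b_le en C0 \<open>e \<ge> 0\<close> \<open>r > 0\<close> by (intro add_mono mult_left_mono mult_right_mono) auto
    also have "\<dots> = 132 * (C ^ 3 * C ^ 4) * e * r" by (simp add: algebra_simps)
    also have "\<dots> = 132 * C ^ 7 * e * r" by (simp flip: power_add)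
    finally show ?thesis .
  qed
  have \<Psi>: "norm (\<Psi> y / of_real (D 0) + R y v 0 / 3) \<le> 133 * C ^ 8 * e * r"
  proof -
    have "norm (\<Psi> y / of_real (D 0) + R y v 0 / 3) \<le> C * (132 * C ^ 7 * e * r) + \<bar>\<epsilon>\<bar> * C\<^sup>2 * r"
      unfolding r_def by (rule \<Psi>_approx[OF sol M, unfolded r_def])
    also have "\<dots> \<le> C * (132 * C ^ 7 * e * r) + e * C ^ 8 * r"
      using k(2) en \<open>r > 0\<close> \<open>e \<ge> 0\<close> Cpow[of 2 8] unfolding k0n
      by (intro add_left_mono mult_right_mono mult_mono) auto
    also have "\<dots> = 133 * C ^ 8 * e * r"
      using power_add[of C 1 7] by (simp add: algebra_simps)
    finally show ?thesis .
  qed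
  have R: "norm (R y v 1 - R y v 0) \<le> 74 * C ^ 6 * (e / n) * r"
  proof -
    have "norm (R y v 1 - R y v 0) \<le> 3 * C ^ 3 * (norm b * (12 * C ^ 3 * r) + 0) + 2 * \<bar>\<epsilon>\<bar> * C\<^sup>2 * p"
      unfolding p_def by (rule P_increment(2)[OF sol _ N']) auto
    also have "\<dots> \<le> 3 * C ^ 3 * (2 * (e / n) * (12 * C ^ 3 * r) + 0) + 2 * (e / n) * C ^ 6 * r"
      using b_le C0 \<open>e \<ge> 0\<close> \<open>r > 0\<close> k(2) pr \<open>p \<ge> 0\<close> \<open>e \<ge> 0\<close> Cpow[of 2 6] unfolding k0n
      by (intro add_mono mult_left_mono mult_right_mono mult_mono) auto
    also have "\<dots> = 74 * C ^ 6 * (e / n) * r"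
      using power_add[of C 3 3] by (simp add: algebra_simps)
    finally show ?thesis .
  qed
  have eq: "((\<nu> - 1) - \<nu> * of_real k * S / 3) * R y v 0
      = (R y v 1 - R y v 0) - \<nu> * (of_real k * S) * (\<Psi> y / of_real (D 0) + R y v 0 / 3)"
    unfolding PR(2) P0 by (simp add: algebra_simps)
  have le: "norm ((R y v 1 - R y v 0) - \<nu> * (of_real k * S) * (\<Psi> y / of_real (D 0) + R y v 0 / 3))
     \<le> 74 * C ^ 6 * (e / n) * r + norm \<nu> * e * (133 * C ^ 8 * e * r)"
  proof (rule order_trans[OF norm_triangle_ineq4], rule add_mono[OF R])
    show "norm (\<nu> * (of_real k * S) * (\<Psi> y / of_real (D 0) + R y v 0 / 3)) \<le> norm \<nu> * e * (133 * C ^ 8 * e * r)"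
      unfolding norm_mult[of "\<nu> * (of_real k * S)"] norm_mult[of \<nu>]
      using \<Psi> kS \<open>e \<ge> 0\<close> by (intro mult_mono) auto
  qed
  have "norm ((\<nu> - 1) - \<nu> * of_real k * S / 3) * r = norm (((\<nu> - 1) - \<nu> * of_real k * S / 3) * R y v 0)"
    by (simp add: norm_mult r_def)
  also have "\<dots> \<le> 74 * C ^ 6 * (e / n) * r + norm \<nu> * e * (133 * C ^ 8 * e * r)"
    unfolding eq by (rule le)
  also have "\<dots> = (74 * C ^ 6 * (e / n) + norm \<nu> * e * (133 * C ^ 8 * e)) * r"
    by (simp only: distrib_right mult.assoc)
  finally have "norm ((\<nu> - 1) - \<nu> * of_real k * S / 3) * r
    \<le> (74 * C ^ 6 * (e / n) + norm \<nu> * e * (133 * C ^ 8 * e)) * r" .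
  then have "norm ((\<nu> - 1) - \<nu> * of_real k * S / 3) \<le> 74 * C ^ 6 * (e / n) + norm \<nu> * e * (133 * C ^ 8 * e)"
    using \<open>r > 0\<close> by simp
  also have "\<dots> = (133 * C ^ 8 * k0\<^sup>2 * norm \<nu> + 74 * C ^ 6 * k0) / (real n)\<^sup>2"
    using npos by (simp add: e_def field_simps power2_eq_square)
  finally show ?thesis by (simp add: S_def)
qed

end

section \<open>Existence of an unstable multiplier\<close>

context hill
begin

lemma hill_exists:
  fixes b p q :: real
  shows "\<exists>y v. hill_solution \<epsilon> u b (\<lambda>_. 0) y v \<and> P y v 0 = p \<and> R y v 0 = q"
proof -
  define f :: "real \<Rightarrow> real \<times> real \<Rightarrow> real \<times> real \<Rightarrow> real \<times> real"
    where "f t a c = (snd a, (b - (\<epsilon> + 3 * (u t)\<^sup>2)) * fst a)" for t a c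
  define M where "M = 1 + \<bar>b\<bar> + 1 + 3 * C\<^sup>2"
  \<comment> \<open>The initial values that \<open>reconstruct\<close> assigns to the coordinates P
    = p and R = q.\<close>
  define y0 where "y0 = \<psi> 0 * p / D 0 - \<phi> 0 * q"
  define v0 where "v0 = \<psi>' 0 * p / D 0 - \<phi>' 0 * q"
  obtain z where z: "z 0 = (y0, v0)"
    "\<And>t. t \<ge> 0 \<Longrightarrow> (z has_vector_derivative f t (z t) (z (t - 0))) (at t within {0..})"
  proof (rule delay_ivp_exists[where T=0 and M=M and f=f and \<phi>="\<lambda>_. (y0, v0)"])
    show "M > 0" by (simp add: M_def add_pos_nonneg)
    show "continuous_on {0..} (\<lambda>t. f t (v t) (w t))" if "continuous_on {0..} v" for v w
      unfolding f_def by (intro continuous_intros that)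
    show "norm (f t v w - f t v' w') \<le> M * (norm (v - v') + norm (w - w'))" for t v w v' w'
    proof -
      have "(u t)\<^sup>2 \<le> C\<^sup>2" using abs_le_square_iff[of "u t" C] u_le[of t] C_ge by simp
      then have coeff: "\<bar>b - (\<epsilon> + 3 * (u t)\<^sup>2)\<bar> \<le> \<bar>b\<bar> + 1 + 3 * C\<^sup>2"
        using \<epsilon>_le zero_le_power2[of "u t"] by linarith
      have "f t v w - f t v' w' = (snd (v - v'), (b - (\<epsilon> + 3 * (u t)\<^sup>2)) * fst (v - v'))"
        by (simp add: f_def right_diff_distrib)
      then have "norm (f t v w - f t v' w') \<le> norm (snd (v - v')) + \<bar>b - (\<epsilon> + 3 * (u t)\<^sup>2)\<bar> * norm (fst (v - v'))"
        using norm_Pair_le[of "snd (v - v')" "(b - (\<epsilon> + 3 * (u t)\<^sup>2)) * fst (v - v')"] by (simp add: abs_mult)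
      also have "\<dots> \<le> norm (v - v') + (\<bar>b\<bar> + 1 + 3 * C\<^sup>2) * norm (v - v')"
        using coeff norm_fst_le[of "fst (v - v')" "snd (v - v')"] norm_snd_le[of "snd (v - v')" "fst (v - v')"]
        unfolding prod.collapse
        by (intro add_mono mult_mono) auto
      also have "\<dots> = M * (norm (v - v') + 0)" by (simp add: M_def algebra_simps)
      also have "\<dots> \<le> M * (norm (v - v') + norm (w - w'))"
        by (intro mult_left_mono add_left_mono) (auto simp: M_def)
      finally show ?thesis .
    qed
  qed (auto simp: f_def zero_prod_def)
  have der: "(z has_vector_derivative (snd (z t), (b - (\<epsilon> + 3 * (u t)\<^sup>2)) * fst (z t))) (at t within {0..1})"
    if "t \<in> {0..1}" for t
    by (rule has_vector_derivative_within_subset[of _ _ _ "{0..}"]) (use z(2)[of t] that in \<open>auto simp: f_def\<close>)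
  have sol: "hill_solution \<epsilon> u b (\<lambda>_. 0) (\<lambda>t. fst (z t)) (\<lambda>t. snd (z t))"
    unfolding hill_solution_def
    using bounded_linear.has_vector_derivative[OF bounded_linear_fst der]
      bounded_linear.has_vector_derivative[OF bounded_linear_snd der] by simp
  have "P (\<lambda>t. fst (z t)) (\<lambda>t. snd (z t)) 0 = p / D 0 * (\<phi> 0 * \<psi>' 0 - \<phi>' 0 * \<psi> 0)"
    by (simp add: P_def z(1) y0_def v0_def algebra_simps)
  moreover have "\<psi> 0 * v0 - \<psi>' 0 * y0 = q * (\<phi> 0 * \<psi>' 0 - \<phi>' 0 * \<psi> 0)"
    by (simp add: y0_def v0_def algebra_simps)
  then have "R (\<lambda>t. fst (z t)) (\<lambda>t. snd (z t)) 0 = q * D 0 / D 0"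
    by (simp add: R_def z(1) D_def)
  ultimately show ?thesis using sol D_ge[of 0] unfolding D_def[symmetric] by auto
qed

lemma hill_solution_lincomb:
  assumes "hill_solution \<epsilon> u b (\<lambda>_. 0) y v" "hill_solution \<epsilon> u b (\<lambda>_. 0) y' v'"
  shows "hill_solution \<epsilon> u b (\<lambda>_. 0) (\<lambda>t. p * y t + q * y' t) (\<lambda>t. p * v t + q * v' t)"
  unfolding hill_solution_def
proof (intro ballI conjI)
  fix t :: real assume t: "t \<in> {0..1}"
  note d = assms[unfolded hill_solution_def, rule_format, OF t]
  show "((\<lambda>t. p * y t + q * y' t) has_vector_derivative p * v t + q * v' t) (at t within {0..1})"
    using d by (intro has_vector_derivative_add has_vector_derivative_mult_right) auto
  have "((\<lambda>t. p * v t + q * v' t) has_vector_derivative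
     p * ((b - of_real (\<epsilon> + 3 * (u t)\<^sup>2)) * y t + 0) + q * ((b - of_real (\<epsilon> + 3 * (u t)\<^sup>2)) * y' t + 0)) (at t within {0..1})"
    using d by (intro has_vector_derivative_add has_vector_derivative_mult_right) auto
  then show "((\<lambda>t. p * v t + q * v' t) has_vector_derivative
     (b - of_real (\<epsilon> + 3 * (u t)\<^sup>2)) * (p * y t + q * y' t) + 0) (at t within {0..1})"
    by (simp add: algebra_simps)
qed

lemma hill_solution_diff:
  assumes "hill_solution \<epsilon> u b (\<lambda>_. 0) y v" "hill_solution \<epsilon> u b' (\<lambda>_. 0) y' v'"
  shows "hill_solution \<epsilon> u b (\<lambda>t. (b - b') * y' t) (\<lambda>t. y t - y' t) (\<lambda>t. v t - v' t)"
  unfolding hill_solution_def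
proof (intro ballI conjI)
  fix t :: real assume t: "t \<in> {0..1}"
  note d = assms[unfolded hill_solution_def, rule_format, OF t]
  show "((\<lambda>t. y t - y' t) has_vector_derivative v t - v' t) (at t within {0..1})"
    using d by (intro has_vector_derivative_diff) auto
  have "((\<lambda>t. v t - v' t) has_vector_derivative
     ((b - of_real (\<epsilon> + 3 * (u t)\<^sup>2)) * y t + 0) - ((b' - of_real (\<epsilon> + 3 * (u t)\<^sup>2)) * y' t + 0)) (at t within {0..1})"
    using d by (intro has_vector_derivative_diff) auto
  then show "((\<lambda>t. v t - v' t) has_vector_derivative
     (b - of_real (\<epsilon> + 3 * (u t)\<^sup>2)) * (y t - y' t) + (b - b') * y' t) (at t within {0..1})"
    by (simp add: algebra_simps)
qed

lemma \<Psi>_diff: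
  fixes y :: "real \<Rightarrow> 'a::{real_normed_field,banach}"
  assumes "continuous_on {0..1} y" "continuous_on {0..1} y'"
  shows "\<Psi> (\<lambda>t. y t - y' t) = \<Psi> y - \<Psi> y'"
proof -
  have "integral {0..1} (\<lambda>t. of_real (\<phi> t) * y t - of_real (\<phi> t) * y' t) = \<Psi> y - \<Psi> y'"
    unfolding \<Psi>_def by (intro integral_diff integrable_continuous_real continuous_intros assms)
  then show ?thesis by (simp add: \<Psi>_def right_diff_distrib)
qed

lemma \<Psi>_lincomb:
  fixes y :: "real \<Rightarrow> 'a::{real_normed_field,banach}"
  assumes "continuous_on {0..1} y" "continuous_on {0..1} y'"
  shows "\<Psi> (\<lambda>t. p * y t + q * y' t) = p * \<Psi> y + q * \<Psi> y'"
proof -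
  have "integral {0..1} (\<lambda>t. p * (of_real (\<phi> t) * y t) + q * (of_real (\<phi> t) * y' t))
     = integral {0..1} (\<lambda>t. p * (of_real (\<phi> t) * y t)) + integral {0..1} (\<lambda>t. q * (of_real (\<phi> t) * y' t))"
    by (intro integral_add integrable_continuous_real continuous_intros assms)
  then show ?thesis by (simp add: \<Psi>_def algebra_simps)
qed

text \<open>The difference of the solutions starts with zero coordinates and is forced by
  \<open>(b - b') * y'\<close>, so \<open>hill_bound\<close> controls it linearly in b - b'. This
  provides the continuity in b for the intermediate value theorem.\<close>

lemma
  assumes sol: "hill_solution \<epsilon> u b (\<lambda>_. 0) y v" and sol': "hill_solution \<epsilon> u b' (\<lambda>_. 0) y' v'"
    and init: "P y v 0 = P y' v' 0" "R y v 0 = R y' v' 0" "\<bar>P y' v' 0\<bar> + \<bar>R y' v' 0\<bar> \<le> (1::real)"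
    and b: "8 * C ^ 4 * \<bar>b\<bar> \<le> 1" "8 * C ^ 4 * \<bar>b'\<bar> \<le> 1"
  shows \<Psi>_lipschitz: "\<bar>\<Psi> y - \<Psi> y'\<bar> \<le> 48 * C ^ 8 * \<bar>b - b'\<bar>"
    and R_lipschitz: "\<bar>R y v 1 - R y' v' 1\<bar> \<le> 48 * C ^ 8 * \<bar>b - b'\<bar>"
proof -
  have C0: "C \<ge> 0" using C_ge by simp
  note diff = hill_solution_diff[OF sol sol']
  define F where "F = \<bar>b - b'\<bar> * (6 * C ^ 3)"
  have "F \<ge> 0" using C0 by (simp add: F_def)
  have y': "norm (y' s) \<le> 6 * C ^ 3" if "s \<in> {0..1}" for s
  proof -
    have "norm (y' s) \<le> 6 * C ^ 3 * (\<bar>P y' v' 0\<bar> + \<bar>R y' v' 0\<bar>)"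
      using hill_bound[OF sol' that, of 0] b by simp
    also have "\<dots> \<le> 6 * C ^ 3 * 1" by (intro mult_left_mono init) (use C0 in simp)
    finally show ?thesis by simp
  qed
  have F: "norm ((b - b') * y' s) \<le> F" if "s \<in> {0..1}" for s
    unfolding F_def norm_mult using y'[OF that] by (intro mult_mono) auto
  have zero: "P (\<lambda>t. y t - y' t) (\<lambda>t. v t - v' t) 0 = 0" "R (\<lambda>t. y t - y' t) (\<lambda>t. v t - v' t) 0 = 0"
  proof -
    have "P (\<lambda>t. y t - y' t) (\<lambda>t. v t - v' t) t = P y v t - P y' v' t"
      "R (\<lambda>t. y t - y' t) (\<lambda>t. v t - v' t) t = R y v t - R y' v' t" for t
      by (simp_all add: P_def R_def diff_divide_distrib add_divide_distrib algebra_simps)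
    then show "P (\<lambda>t. y t - y' t) (\<lambda>t. v t - v' t) 0 = 0" "R (\<lambda>t. y t - y' t) (\<lambda>t. v t - v' t) 0 = 0"
      using init by auto
  qed
  have N: "norm (y s - y' s) \<le> 8 * C ^ 4 * F" if "s \<in> {0..1}" for s
    using hill_bound[OF diff that F] b(1) by (simp add: zero)
  have "\<bar>\<Psi> y - \<Psi> y'\<bar> \<le> C * (8 * C ^ 4 * F)"
    using \<Psi>_le[OF hill_continuous(1)[OF diff] N]
    by (simp add: \<Psi>_diff hill_continuous[OF sol] hill_continuous[OF sol'])
  also have "\<dots> = 48 * (C * C ^ 4 * C ^ 3) * \<bar>b - b'\<bar>" by (simp add: F_def)
  also have "C * C ^ 4 * C ^ 3 = C ^ 8" by (simp add: power4_eq_xxxx power3_eq_cube eval_nat_numeral)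
  finally show "\<bar>\<Psi> y - \<Psi> y'\<bar> \<le> 48 * C ^ 8 * \<bar>b - b'\<bar>" .
  have "R y v 1 - R y' v' 1 = R (\<lambda>t. y t - y' t) (\<lambda>t. v t - v' t) 1"
    by (simp add: R_def diff_divide_distrib add_divide_distrib algebra_simps)
  then have "\<bar>R y v 1 - R y' v' 1\<bar> \<le> 3 * C ^ 3 * (\<bar>b\<bar> * (8 * C ^ 4 * F) + F)"
    using P_increment(2)[OF diff _ N F, of 1] by (simp add: zero)
  also have "\<dots> = 3 * C ^ 3 * ((8 * C ^ 4 * \<bar>b\<bar>) * F + F)" by (simp add: algebra_simps)
  also have "\<dots> \<le> 3 * C ^ 3 * (1 * F + F)"
    using b \<open>F \<ge> 0\<close> C0 by (intro mult_left_mono add_right_mono mult_right_mono) auto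
  also have "\<dots> = 36 * (C ^ 3 * C ^ 3) * \<bar>b - b'\<bar>" by (simp add: F_def)
  also have "\<dots> \<le> 48 * C ^ 8 * \<bar>b - b'\<bar>"
  proof (rule mult_right_mono)
    have "C ^ 6 \<le> C ^ 8" using C_ge by (intro power_increasing) auto
    moreover have "C ^ 6 \<ge> 0" by simp
    ultimately have "36 * C ^ 6 \<le> 48 * C ^ 8" by linarith
    then show "36 * (C ^ 3 * C ^ 3) \<le> 48 * C ^ 8" by (simp flip: power_add)
  qed simp
  finally show "\<bar>R y v 1 - R y' v' 1\<bar> \<le> 48 * C ^ 8 * \<bar>b - b'\<bar>" .
qed

text \<open>
  The number \<open>F \<nu>\<close> below is the determinant of \<open>- M - \<nu>\<close>, where \<open>M\<close> is the monodromy matrix of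
  Hill's equation with parameter \<open>b = k (1 - \<nu>\<^sup>-\<^sup>n)\<close> in the coordinates \<open>(P, R)\<close>. To leading order
  it equals \<open>(\<nu> - 1)\<^sup>2 - b / 3\<close>, which changes sign on \<open>(1, 4)\<close>.
\<close>

lemma unstable_multiplier_exists:
  fixes k :: real
  assumes k: "0 < k" "1000 * C ^ 8 * k \<le> 1" and \<epsilon>: "100 * C ^ 4 * \<bar>\<epsilon>\<bar> \<le> 1" and n: "n \<ge> 1"
  obtains \<nu> :: real and y v where "\<nu> > 1" "hill_solution \<epsilon> u (k * (1 - inverse \<nu> ^ n)) (\<lambda>_. 0) y v"
    "y 1 = - \<nu> * y 0" "v 1 = - \<nu> * v 0" "y 0 \<noteq> 0 \<or> v 0 \<noteq> (0::real)"
proof -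
  have C0: "C \<ge> 0" using C_ge by simp
  have C1: "C ^ i \<ge> 1" for i using C_ge by simp
  have Cpow: "C ^ i \<le> C ^ j" if "i \<le> j" for i j using that C_ge by (intro power_increasing) auto
  have ex: "\<exists>y v. \<forall>b. hill_solution \<epsilon> u b (\<lambda>_. 0) (y b) (v b) \<and> P (y b) (v b) 0 = p \<and> R (y b) (v b) 0 = q" for p q :: real
    using hill_exists[of _ p q] by metis
  obtain y1 v1 where
    sol1: "\<And>b. hill_solution \<epsilon> u b (\<lambda>_. 0) (y1 b) (v1 b)" "\<And>b. P (y1 b) (v1 b) 0 = 1" "\<And>b. R (y1 b) (v1 b) 0 = (0::real)"
    using ex[of 1 0] by blast
  obtain y2 v2 where
    sol2: "\<And>b. hill_solution \<epsilon> u b (\<lambda>_. 0) (y2 b) (v2 b)" "\<And>b. P (y2 b) (v2 b) 0 = 0" "\<And>b. R (y2 b) (v2 b) 0 = (1::real)"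
    using ex[of 0 1] by blast
  \<comment> \<open>In the coordinates (P, R) the solution operator over the half period has the
    rows (1 + b a1, b a2) and (c1, 1 + c2).\<close>
  define a1 a2 c1 c2 where "a1 b = \<Psi> (y1 b)" and "a2 b = \<Psi> (y2 b)"
    and "c1 b = R (y1 b) (v1 b) 1" and "c2 b = R (y2 b) (v2 b) 1 - 1" for b
  have Cb: "C ^ i * b \<le> 1 / 1000" if "b \<in> {0..k}" "i \<le> 8" for b i
  proof -
    have "C ^ i * b \<le> C ^ 8 * k" using that Cpow[of i 8] C0 by (intro mult_mono) auto
    then show ?thesis using k by simp
  qed
  have Ce: "C ^ i * \<bar>\<epsilon>\<bar> \<le> 1 / 100" if "i \<le> 4" for i
  proof -
    have "C ^ i * \<bar>\<epsilon>\<bar> \<le> C ^ 4 * \<bar>\<epsilon>\<bar>" using that Cpow[of i 4] by (intro mult_right_mono) auto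
    then show ?thesis using \<epsilon> by simp
  qed
  have small: "8 * C ^ 4 * \<bar>b\<bar> \<le> 1" if "b \<in> {0..k}" for b
    using Cb[OF that, of 4] that by simp
  have lip: "(48 * C ^ 8)-lipschitz_on {0..k} f"
    if "\<And>b b'. b \<in> {0..k} \<Longrightarrow> b' \<in> {0..k} \<Longrightarrow> \<bar>f b - f b'\<bar> \<le> 48 * C ^ 8 * \<bar>b - b'\<bar>" for f :: "real \<Rightarrow> real"
    by (rule lipschitz_onI) (use that in \<open>auto simp: dist_real_def\<close>)
  have cont: "continuous_on {0..k} a1" "continuous_on {0..k} a2" "continuous_on {0..k} c1" "continuous_on {0..k} c2"
    unfolding a1_def a2_def c1_def c2_def
    by (intro lipschitz_on_continuous_on[OF lip] continuous_on_diff continuous_on_const;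
        auto intro!: \<Psi>_lipschitz R_lipschitz sol1 sol2 small simp: sol1 sol2)+
  have N1: "norm (y1 b t) \<le> 6 * C ^ 3" and N2: "norm (y2 b t) \<le> 6 * C ^ 3" if "b \<in> {0..k}" "t \<in> {0..1}" for b t
    using hill_bound[OF sol1(1) that(2), of 0 b] hill_bound[OF sol2(1) that(2), of 0 b] small[OF that(1)]
    by (simp_all add: sol1 sol2)
  \<comment> \<open>The off-diagonal product of the determinant has a part linear in \<nu>, which is
    moved into the second factor of \<open>F\<close>; \<open>E\<close> is what then multiplies b. It
    depends on b alone and is negative, with leading value -1/3.\<close>
  define E where "E b = a2 b / D 0 * (1 + b * a1 b - c1 b * D 0)" for b
  have D0: "D 0 > 0" using D_ge[of 0] by simp
  have est: "\<bar>b * a1 b\<bar> \<le> 24 * C ^ 6 * b" "\<bar>c2 b - b * a2 b / D 0\<bar> \<le> 24 * C ^ 6 * b"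
    "a2 b / D 0 < 0" "E b \<le> - 1 / 8" "E b \<ge> - 1" if b: "b \<in> {0..k}" for b
  proof -
    have "\<bar>a1 b\<bar> \<le> C * (6 * C ^ 3)"
      using \<Psi>_le[OF hill_continuous(1)[OF sol1(1)] N1[OF b]] by (simp add: a1_def)
    then have "\<bar>b * a1 b\<bar> \<le> b * (C * (6 * C ^ 3))"
      unfolding abs_mult using b by (intro mult_mono) auto
    also have "\<dots> = 6 * (C ^ 4 * b)" by (simp add: power4_eq_xxxx power3_eq_cube)
    finally have ba1: "\<bar>b * a1 b\<bar> \<le> 6 * (C ^ 4 * b)" .
    have "C ^ 4 * b \<le> C ^ 6 * b" using b Cpow[of 4 6] by (intro mult_right_mono) auto
    moreover have "C ^ 4 * b \<ge> 0" using b C0 by simp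
    ultimately show "\<bar>b * a1 b\<bar> \<le> 24 * C ^ 6 * b" using ba1 by linarith
    have "norm (y2 b t + of_real (\<phi> t) * R (y2 b) (v2 b) 0) \<le> 4 * C ^ 4 * (b * (6 * C ^ 3))" if "t \<in> {0..1}" for t
      using hill_approx[OF sol2(1) that N2[OF b], of 0] b by (simp add: sol2)
    from \<Psi>_approx[OF sol2(1) this]
    have "\<bar>a2 b / D 0 + 1 / 3\<bar> \<le> C * (4 * C ^ 4 * (b * (6 * C ^ 3))) + \<bar>\<epsilon>\<bar> * C\<^sup>2"
      by (simp add: a2_def sol2)
    also have "\<dots> = 24 * (C ^ 8 * b) + C\<^sup>2 * \<bar>\<epsilon>\<bar>"
      by (simp add: eval_nat_numeral)
    also have "\<dots> \<le> 1 / 12" using Cb[OF b, of 8] Ce[of 2] by simp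
    finally have a2: "a2 b / D 0 \<le> - 1 / 4" "a2 b / D 0 \<ge> - 5 / 12" by linarith+
    then show "a2 b / D 0 < 0" by simp
    have "\<bar>c2 b\<bar> \<le> 3 * C ^ 3 * (b * (6 * C ^ 3))"
      using P_increment(2)[OF sol2(1) _ N2[OF b], of 1 0] b by (simp add: c2_def sol2)
    also have "\<dots> = 18 * (C ^ 6 * b)" by (simp add: eval_nat_numeral)
    finally have "\<bar>c2 b\<bar> \<le> 18 * (C ^ 6 * b)" .
    moreover have "\<bar>b * a2 b / D 0\<bar> \<le> b * 1"
      unfolding times_divide_eq_right[symmetric] abs_mult using a2 b by (intro mult_mono) auto
    moreover have "b * 1 \<le> b * C ^ 6" using b C1[of 6] by (intro mult_left_mono) auto
    moreover have "0 \<le> b * C ^ 6" using b C0 by simp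
    moreover have "24 * C ^ 6 * b = 18 * (C ^ 6 * b) + b * C ^ 6 + 5 * (b * C ^ 6)" by simp
    ultimately have "\<bar>c2 b\<bar> + \<bar>b * a2 b / D 0\<bar> \<le> 24 * C ^ 6 * b" by linarith
    then show "\<bar>c2 b - b * a2 b / D 0\<bar> \<le> 24 * C ^ 6 * b"
      by (rule order_trans[OF abs_triangle_ineq4])
    have "\<bar>c1 b\<bar> \<le> 3 * C ^ 3 * (b * (6 * C ^ 3)) + 2 * \<bar>\<epsilon>\<bar> * C\<^sup>2"
      using P_increment(2)[OF sol1(1) _ N1[OF b], of 1 0] b by (simp add: c1_def sol1)
    then have "\<bar>c1 b * D 0\<bar> \<le> (3 * C ^ 3 * (b * (6 * C ^ 3)) + 2 * \<bar>\<epsilon>\<bar> * C\<^sup>2) * (5 * C\<^sup>2)"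
      unfolding abs_mult using D_le[of 0] D0 by (intro mult_mono) auto
    also have "\<dots> = 90 * (C ^ 8 * b) + 10 * (C ^ 4 * \<bar>\<epsilon>\<bar>)"
      by (simp add: algebra_simps eval_nat_numeral)
    also have "\<dots> \<le> 1 / 4" using Cb[OF b, of 8] Ce[of 4] by simp
    finally have "\<bar>c1 b * D 0\<bar> \<le> 1 / 4" .
    moreover have "\<bar>b * a1 b\<bar> \<le> 1 / 4" using ba1 Cb[OF b, of 4] by simp
    ultimately have f: "1 + b * a1 b - c1 b * D 0 \<ge> 1 / 2" "1 + b * a1 b - c1 b * D 0 \<le> 3 / 2" by linarith+
    have "(1 / 4) * (1 / 2) \<le> (- (a2 b / D 0)) * (1 + b * a1 b - c1 b * D 0)"
      using a2 f by (intro mult_mono; linarith)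
    then show "E b \<le> - 1 / 8" unfolding E_def mult_minus_left by linarith
    have "(- (a2 b / D 0)) * (1 + b * a1 b - c1 b * D 0) \<le> (5 / 12) * (3 / 2)"
      using a2 f by (intro mult_mono; linarith)
    then show "E b \<ge> - 1" unfolding E_def mult_minus_left by linarith
  qed
  define \<beta> where "\<beta> \<nu> = k * (1 - inverse \<nu> ^ n)" for \<nu> :: real
  have \<beta>_in: "\<beta> \<nu> \<in> {0..k}" if "\<nu> \<ge> 1" for \<nu>
  proof -
    have "inverse \<nu> ^ n \<le> 1" "inverse \<nu> ^ n \<ge> 0" using that by (auto intro!: power_le_one simp: inverse_le_1_iff)
    then show ?thesis using k by (auto simp: \<beta>_def intro: mult_left_le)
  qed
  have \<beta>_cont: "continuous_on {1..4} \<beta>"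
    unfolding \<beta>_def by (intro continuous_intros) auto
  define F where "F \<nu> = (1 + \<beta> \<nu> * a1 (\<beta> \<nu>) - \<nu>) * (1 + (c2 (\<beta> \<nu>) - \<beta> \<nu> * a2 (\<beta> \<nu>) / D 0) - \<nu>) + \<beta> \<nu> * E (\<beta> \<nu>)" for \<nu>
  have F_cont: "continuous_on {1..4} F"
  proof -
    have c: "continuous_on {1..4} (\<lambda>\<nu>. h (\<beta> \<nu>))" if "continuous_on {0..k} h" for h :: "real \<Rightarrow> real"
      by (rule continuous_on_compose2[OF that \<beta>_cont]) (use \<beta>_in in auto)
    show ?thesis
      unfolding F_def E_def using D0 by (intro continuous_intros c cont \<beta>_cont) auto
  qed
  define m where "m = 24 * C ^ 6"
  have m: "m \<ge> 0" using C0 by (simp add: m_def)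
  \<comment> \<open>At 4 both factors are at most -2, so their product is at least 4, while the
    remainder is at least -1.\<close>
  have F4: "F 4 > 0"
  proof -
    have b: "\<beta> 4 \<in> {0..k}" by (rule \<beta>_in) simp
    have "24 * C ^ 6 * \<beta> 4 \<le> 1" using Cb[OF b, of 6] by simp
    then have "- (1 + \<beta> 4 * a1 (\<beta> 4) - 4) \<ge> 2" "- (1 + (c2 (\<beta> 4) - \<beta> 4 * a2 (\<beta> 4) / D 0) - 4) \<ge> 2"
      using est(1,2)[OF b] by linarith+
    then have "2 * 2 \<le> (- (1 + \<beta> 4 * a1 (\<beta> 4) - 4)) * (- (1 + (c2 (\<beta> 4) - \<beta> 4 * a2 (\<beta> 4) / D 0) - 4))"
      by (intro mult_mono) auto
    moreover have "\<beta> 4 * E (\<beta> 4) \<ge> \<beta> 4 * (- 1)" using est(5)[OF b] b by (intro mult_left_mono) auto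
    moreover have "\<beta> 4 \<le> 1" using Cb[OF b, of 0] by simp
    ultimately show ?thesis unfolding F_def minus_mult_minus by linarith
  qed
  \<comment> \<open>At 1 + s the product is at most s^2 (1 + m k n)^2, because b \<le> k n s by
    Bernoulli; the remainder is at most -k s / 16, because b \<ge> k s / 2 and E \<le> -1/8. This
    \<open>s\<close> keeps the product below k s / 32.\<close>
  define s where "s = min 1 (k / (32 * (1 + m * k * n)\<^sup>2))"
  have mkn: "1 + m * k * n > 0" using m k by (intro add_pos_nonneg) auto
  have s: "0 < s" "s \<le> 1" "s * (1 + m * k * n)\<^sup>2 \<le> k / 32"
  proof -
    show "0 < s" "s \<le> 1" using k mkn by (auto simp: s_def)
    have "s \<le> k / (32 * (1 + m * k * n)\<^sup>2)" by (simp add: s_def)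
    then show "s * (1 + m * k * n)\<^sup>2 \<le> k / 32" using mkn by (simp add: field_simps)
  qed
  have Fs: "F (1 + s) < 0"
  proof -
    define b where "b = \<beta> (1 + s)"
    have b: "b \<in> {0..k}" unfolding b_def by (rule \<beta>_in) (use s in simp)
    define x where "x = inverse (1 + s)"
    have x: "0 < x" "x \<le> 1" "1 - x \<le> s" "1 - x \<ge> s / 2"
      using s by (auto simp: x_def field_simps intro: mult_right_le_one_le)
    have "x ^ n \<le> x ^ 1" using x n by (intro power_decreasing) auto
    then have "1 - x ^ n \<ge> s / 2" using x by simp
    then have b_ge: "b \<ge> k * (s / 2)" using k by (simp add: b_def \<beta>_def x_def)
    have "1 + real n * (x - 1) \<le> (1 + (x - 1)) ^ n"
      using x by (intro Bernoulli_inequality) auto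
    then have "1 - x ^ n \<le> real n * (1 - x)" by (simp add: algebra_simps)
    also have "\<dots> \<le> real n * s" using x by (intro mult_left_mono) auto
    finally have b_le: "b \<le> k * (real n * s)" using k by (simp add: b_def \<beta>_def x_def)
    have "\<bar>1 + b * a1 b - (1 + s)\<bar> \<le> s + m * b" "\<bar>1 + (c2 b - b * a2 b / D 0) - (1 + s)\<bar> \<le> s + m * b"
      using est(1,2)[OF b] s by (auto simp: m_def)
    then have "\<bar>(1 + b * a1 b - (1 + s)) * (1 + (c2 b - b * a2 b / D 0) - (1 + s))\<bar> \<le> (s + m * b) * (s + m * b)"
      unfolding abs_mult using s m b by (intro mult_mono) auto
    also have "\<dots> \<le> (s * (1 + m * k * n)) * (s * (1 + m * k * n))"
    proof -
      have "m * b \<le> m * (k * (real n * s))" by (intro mult_left_mono b_le m)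
      then have "s + m * b \<le> s * (1 + m * k * n)" by (simp add: algebra_simps)
      then show ?thesis using s m b mkn by (intro mult_mono) auto
    qed
    also have "\<dots> = s * (s * (1 + m * k * n)\<^sup>2)" by (simp add: power2_eq_square)
    also have "\<dots> \<le> s * (k / 32)" using s by (intro mult_left_mono) auto
    finally have "(1 + b * a1 b - (1 + s)) * (1 + (c2 b - b * a2 b / D 0) - (1 + s)) \<le> s * (k / 32)"
      by linarith
    moreover have "b * E b \<le> b * (- 1 / 8)" using est(4)[OF b] b by (intro mult_left_mono) auto
    moreover have "s * (k / 32) < k * (s / 2) * (1 / 8)" using s k by (simp add: mult.commute)
    ultimately show ?thesis unfolding F_def b_def[symmetric] using b_ge by linarith
  qed
  have "\<exists>\<nu>\<ge>1 + s. \<nu> \<le> 4 \<and> F \<nu> = 0"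
    by (rule IVT') (use Fs F4 s in \<open>auto intro: continuous_on_subset[OF F_cont]\<close>)
  then obtain \<nu> where \<nu>: "\<nu> \<ge> 1 + s" "\<nu> \<le> 4" "F \<nu> = 0" by blast
  define b where "b = \<beta> \<nu>"
  have b: "b \<in> {0..k}" unfolding b_def by (rule \<beta>_in) (use \<nu> s in simp)
  have "b > 0"
  proof -
    have "inverse \<nu> < 1" using \<nu> s by (simp add: field_simps)
    then have "inverse \<nu> ^ n < 1" using n \<nu> s by (intro power_less_one_iff[THEN iffD2]) auto
    then show ?thesis using k by (simp add: b_def \<beta>_def)
  qed
  \<comment> \<open>A kernel vector of the singular boundary system, read off from its first row;
    \<open>p\<close> is nonzero because b > 0 and \<open>a2 b\<close> is negative.\<close>
  define p q where "p = b * a2 b" and "q = - (1 + b * a1 b - \<nu>)"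
  define y where "y t = p * y1 b t + q * y2 b t" for t
  define v where "v t = p * v1 b t + q * v2 b t" for t
  have sol: "hill_solution \<epsilon> u b (\<lambda>_. 0) y v"
    unfolding y_def v_def by (rule hill_solution_lincomb[OF sol1(1) sol2(1)])
  have PR: "P y v t = p * P (y1 b) (v1 b) t + q * P (y2 b) (v2 b) t"
    "R y v t = p * R (y1 b) (v1 b) t + q * R (y2 b) (v2 b) t" for t
    by (simp_all add: P_def R_def y_def v_def add_divide_distrib diff_divide_distrib algebra_simps)
  have P0: "P y v 0 = p" "R y v 0 = q" by (simp_all add: PR sol1 sol2)
  have "\<Psi> y = p * a1 b + q * a2 b"
    unfolding y_def a1_def a2_def
    by (intro \<Psi>_lincomb hill_continuous(1)[OF sol1(1)] hill_continuous(1)[OF sol2(1)])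
  then have "P y v 1 = p * (1 + b * a1 b) + q * (b * a2 b)"
    using P_total[OF sol] by (simp add: P0 algebra_simps)
  also have "\<dots> = \<nu> * p" unfolding p_def[symmetric] by (simp add: q_def algebra_simps)
  finally have P1: "P y v 1 = \<nu> * p" .
  have "R y v 1 = p * c1 b + q * (1 + c2 b)" by (simp add: PR c1_def c2_def)
  also have "\<dots> = \<nu> * (q + p / D 0) - F \<nu>"
    unfolding F_def b_def[symmetric] E_def p_def q_def using D0 by (simp add: field_simps)
  finally have R1: "R y v 1 = \<nu> * (q + p / D 0)" using \<nu> by simp
  have bd: "y 1 = - \<nu> * y 0" "v 1 = - \<nu> * v 0"
    using boundary_iff[of y \<nu> 0 v] P1 R1 by (auto simp: P0)
  have "p \<noteq> 0" using \<open>b > 0\<close> est(3)[OF b] by (auto simp: p_def)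
  then have "y 0 \<noteq> 0 \<or> v 0 \<noteq> 0" using P0 by (auto simp: P_def)
  then show thesis
    using that[of \<nu> y v] \<nu> s sol bd by (simp add: b_def \<beta>_def)
qed

end

section \<open>The linearized delay equation\<close>

lemma norm_vector_2_le: "norm (vector [a, b] :: complex ^ 2) \<le> norm a + norm b"
proof -
  have "norm (vector [a, b] :: complex ^ 2) \<le> (\<Sum>i\<in>UNIV. norm ((vector [a, b] :: complex ^ 2) $ i))"
    unfolding norm_vec_def by (rule L2_set_le_sum) simp
  then show ?thesis by (simp add: sum_2)
qed

lemma vector_2_eq_iff: "(v :: complex ^ 2) = w \<longleftrightarrow> v $ 1 = w $ 1 \<and> v $ 2 = w $ 2"
  by (simp add: vec_eq_iff forall_2)

lemma bounded_linear_vector_2: "bounded_linear (\<lambda>p. vector [fst p, snd p] :: complex ^ 2)"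
  by (intro linear_conv_bounded_linear[THEN iffD1] linearI) (simp_all add: vector_2_eq_iff)

lemma bounded_linear_smult_vec: "bounded_linear (\<lambda>v. c *s v :: complex ^ 2)"
  by (intro linear_conv_bounded_linear[THEN iffD1] linearI) (simp_all add: vector_2_eq_iff algebra_simps)

lemma has_vector_derivative_vector_2:
  assumes "(a has_vector_derivative a') (at t within S)" "(b has_vector_derivative b') (at t within S)"
  shows "((\<lambda>t. vector [a t, b t] :: complex ^ 2) has_vector_derivative vector [a', b']) (at t within S)"
  using bounded_linear.has_vector_derivative[OF bounded_linear_vector_2 has_vector_derivative_Pair[OF assms]]
  by simp

lemmas has_vector_derivative_vec_nth = bounded_linear.has_vector_derivative[OF bounded_linear_vec_nth]

lemmas has_vector_derivative_smult_vec = bounded_linear.has_vector_derivative[OF bounded_linear_smult_vec]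

lemma has_vector_derivative_shift:
  assumes "(y has_vector_derivative d) (at (t + r) within {0..})" "t \<ge> 0" "r > 0"
  shows "((\<lambda>t. y (t + r)) has_vector_derivative d) (at t within S)"
proof -
  have "at (t + r) within {0..} = at (t + r)"
    by (rule at_within_interior) (use assms in \<open>simp add: interior_Ici[of _ "-1"]\<close>)
  then have "(y has_vector_derivative d) (at (t + r))" using assms by simp
  moreover have "((\<lambda>t. t + r) has_vector_derivative 1) (at t)"
    by (auto intro!: derivative_eq_intros)
  ultimately have "(y \<circ> (\<lambda>t. t + r) has_vector_derivative 1 *\<^sub>R d) (at t)"
    by (intro vector_diff_chain_at) auto
  then show ?thesis by (simp add: o_def has_vector_derivative_at_within)
qed

text \<open>With b = 0 this is an ordinary equation, so the delay equation and Hill's equation share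
  their Lipschitz, continuity and linearity lemmas.\<close>

definition second_order_system ::
  "(real \<Rightarrow> complex) \<Rightarrow> complex \<Rightarrow> real \<Rightarrow> complex ^ 2 \<Rightarrow> complex ^ 2 \<Rightarrow> complex ^ 2" where
  "second_order_system a b t v w = vector [v $ 2, a t * v $ 1 + b * w $ 1]"

lemma second_order_system_lipschitz:
  assumes "norm (a t) \<le> M"
  shows "norm (second_order_system a b t v w - second_order_system a b t v' w')
    \<le> (1 + M + norm b) * (norm (v - v') + norm (w - w'))"
proof -
  have "M \<ge> 0" using assms by (meson norm_ge_zero order_trans)
  have "second_order_system a b t v w - second_order_system a b t v' w'
     = vector [(v - v') $ 2, a t * (v - v') $ 1 + b * (w - w') $ 1]"
    by (simp add: second_order_system_def vector_2_eq_iff algebra_simps)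
  also have "norm (vector [(v - v') $ 2, a t * (v - v') $ 1 + b * (w - w') $ 1] :: complex ^ 2)
     \<le> norm ((v - v') $ 2) + norm (a t * (v - v') $ 1 + b * (w - w') $ 1)"
    by (rule norm_vector_2_le)
  also have "\<dots> \<le> norm (v - v') + (M * norm (v - v') + norm b * norm (w - w'))"
    using assms \<open>M \<ge> 0\<close>
    by (intro add_mono Finite_Cartesian_Product.norm_nth_le order_trans[OF norm_triangle_ineq] add_mono)
      (auto simp only: norm_mult intro!: mult_mono Finite_Cartesian_Product.norm_nth_le norm_ge_zero)
  also have "\<dots> \<le> (1 + M + norm b) * (norm (v - v') + norm (w - w'))"
    using \<open>M \<ge> 0\<close> by (simp add: algebra_simps)
  finally show ?thesis .
qed

lemma second_order_system_continuous:
  assumes "continuous_on S a" "continuous_on S v" "continuous_on S w"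
  shows "continuous_on S (\<lambda>t. second_order_system a b t (v t) (w t))"
proof -
  have "continuous_on S (\<lambda>t. (v t $ 2, a t * v t $ 1 + b * w t $ 1))"
    by (intro continuous_intros assms)
  from bounded_linear.continuous_on[OF bounded_linear_vector_2 this] show ?thesis
    by (simp add: second_order_system_def)
qed

lemma second_order_system_lincomb:
  "second_order_system a b t (c *s v + d *s v') (c *s w + d *s w')
    = c *s second_order_system a b t v w + d *s second_order_system a b t v' w'"
  by (simp add: second_order_system_def vector_2_eq_iff algebra_simps)

text \<open>The delay is a whole number of half periods q. The number 400 is a bound common to all
  orbits with |\<alpha> q^2| \<le> 1, see \<open>duffing_orbit_scaled_hill\<close>.\<close>

locale controlled_orbit =
  fixes \<alpha> \<kappa> T q :: real and n :: nat and x :: "real \<Rightarrow> real"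
  assumes T_eq: "T = real n * q" and q_pos: "q > 0" and n_ge: "n \<ge> 1"
    and x_sol: "duffing_solution \<alpha> x" and x_anti: "x (t + q) = - x t"
    and hill_x: "hill (\<alpha> * q\<^sup>2) 400 (\<lambda>t. q * x (q * t))"
begin

sublocale hill "\<alpha> * q\<^sup>2" 400 "\<lambda>t. q * x (q * t)" by (rule hill_x)

abbreviation u where "u \<equiv> \<lambda>t. q * x (q * t)"

lemma T_pos: "T > 0" using T_eq q_pos n_ge by simp

lemma x_le: "\<bar>x t\<bar> \<le> 400 / q"
  using u_le[of "t / q"] q_pos by (simp add: abs_mult field_simps)

definition stiffness where "stiffness \<beta> t = \<beta> - of_real \<alpha> - 3 * of_real ((x t)\<^sup>2)" for \<beta> :: complex

lemma stiffness_le: "norm (stiffness \<beta> t) \<le> norm \<beta> + \<bar>\<alpha>\<bar> + 3 * (400 / q)\<^sup>2"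
proof -
  have "(x t)\<^sup>2 \<le> (400 / q)\<^sup>2"
    using abs_le_square_iff[of "x t" "400 / q"] x_le[of t] q_pos by simp
  then have "norm (3 * of_real ((x t)\<^sup>2) :: complex) \<le> 3 * (400 / q)\<^sup>2"
    by (simp add: norm_mult norm_power)
  then show ?thesis
    unfolding stiffness_def
    by (intro order_trans[OF norm_triangle_ineq4] add_mono) auto
qed

lemma stiffness_continuous: "continuous_on S (stiffness \<beta>)"
  unfolding stiffness_def by (intro continuous_intros duffing_continuous[OF x_sol])

lemma stiffness_shift: "stiffness \<beta> (t + q) = stiffness \<beta> t"
  by (simp add: stiffness_def x_anti)

abbreviation sys where "sys \<beta> \<equiv> second_order_system (stiffness \<beta>)"

definition delay_gain where "delay_gain = - ((-1) ^ n * complex_of_real \<kappa>)"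

definition dde where
  "dde y \<longleftrightarrow> continuous_on {-T..} y \<and>
    (\<forall>t\<ge>0. (y has_vector_derivative sys (of_real \<kappa>) delay_gain t (y t) (y (t - T))) (at t within {0..}))"

definition ode where
  "ode \<beta> y \<longleftrightarrow> (\<forall>t\<ge>0. (y has_vector_derivative sys \<beta> 0 t (y t) 0) (at t within {0..}))"

lemma linearized_solution_iff:
  "linearized_solution \<alpha> \<kappa> T n x \<eta> y \<longleftrightarrow> dde y \<and> (\<forall>\<theta>\<in>{-T..0}. y \<theta> = \<eta> \<theta>)"
proof -
  have "vector [y t $ 2, - of_real (\<alpha> - \<kappa>) * y t $ 1 - (-1) ^ n * of_real \<kappa> * y (t - T) $ 1
       - 3 * of_real (x t ^ 2) * y t $ 1] = sys (of_real \<kappa>) delay_gain t (y t) (y (t - T))" for t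
    by (simp add: second_order_system_def stiffness_def delay_gain_def algebra_simps)
  then show ?thesis unfolding linearized_solution_def dde_def by auto
qed

lemma sys_lipschitz: "\<exists>M>0. \<forall>t v w v' w'.
    norm (sys \<beta> b t v w - sys \<beta> b t v' w') \<le> M * (norm (v - v') + norm (w - w'))"
  by (intro exI[of _ "1 + (norm \<beta> + \<bar>\<alpha>\<bar> + 3 * (400 / q)\<^sup>2) + norm b"] conjI allI
      second_order_system_lipschitz stiffness_le) (auto intro!: add_pos_nonneg)

lemma dde_exists:
  assumes "continuous_on {-T..0} \<eta>"
  shows "\<exists>y. dde y \<and> (\<forall>\<theta>\<in>{-T..0}. y \<theta> = \<eta> \<theta>)"
proof -
  obtain M where M: "M > 0" "\<And>t v w v' w'. norm (sys (of_real \<kappa>) delay_gain t v w - sys (of_real \<kappa>) delay_gain t v' w')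
      \<le> M * (norm (v - v') + norm (w - w'))"
    using sys_lipschitz by blast
  obtain y where "continuous_on UNIV y" "\<forall>\<theta>\<in>{-T..0}. y \<theta> = \<eta> \<theta>"
    "\<forall>t\<ge>0. (y has_vector_derivative sys (of_real \<kappa>) delay_gain t (y t) (y (t - T))) (at t within {0..})"
  proof (rule delay_ivp_exists[of T M "sys (of_real \<kappa>) delay_gain" \<eta>])
    show "sys (of_real \<kappa>) delay_gain t 0 0 = 0" for t
      by (simp add: second_order_system_def vector_2_eq_iff)
  qed (use T_pos M assms in \<open>auto intro!: second_order_system_continuous stiffness_continuous\<close>)
  then show ?thesis unfolding dde_def by (meson continuous_on_subset subset_UNIV)
qed

lemma dde_unique:
  assumes "dde y" "dde z" "\<And>s. s \<in> {-T..0} \<Longrightarrow> y s = z s" "t \<ge> - T"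
  shows "y t = z t"
proof -
  obtain M where "\<And>t v w v' w'. norm (sys (of_real \<kappa>) delay_gain t v w - sys (of_real \<kappa>) delay_gain t v' w')
      \<le> M * (norm (v - v') + norm (w - w'))"
    using sys_lipschitz by blast
  then show ?thesis
    by (rule delay_ivp_unique[OF T_pos]) (use assms in \<open>auto simp: dde_def\<close>)
qed

lemma ode_exists: "\<exists>y. ode \<beta> y \<and> y 0 = v0"
proof -
  obtain M where M: "M > 0" "\<And>t v w v' w'. norm (sys \<beta> 0 t v w - sys \<beta> 0 t v' w')
      \<le> M * (norm (v - v') + norm (w - w'))"
    using sys_lipschitz by blast
  obtain y where "\<forall>\<theta>\<in>{-0..0}. y \<theta> = v0"
    "\<forall>t\<ge>0. (y has_vector_derivative sys \<beta> 0 t (y t) (y (t - 0))) (at t within {0..})"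
  proof (rule delay_ivp_exists[of 0 M "sys \<beta> 0" "\<lambda>_. v0"])
    show "sys \<beta> 0 t 0 0 = 0" for t
      by (simp add: second_order_system_def vector_2_eq_iff)
  qed (use M in \<open>auto intro!: second_order_system_continuous stiffness_continuous\<close>)
  moreover have "sys \<beta> 0 t (y t) (y (t - 0)) = sys \<beta> 0 t (y t) 0" for t
    by (simp add: second_order_system_def)
  ultimately show ?thesis unfolding ode_def by auto
qed

lemma ode_unique:
  assumes y: "\<And>t. t \<in> {0..c} \<Longrightarrow> (y has_vector_derivative sys \<beta> 0 t (y t) 0) (at t within {0..c})"
    and z: "\<And>t. t \<in> {0..c} \<Longrightarrow> (z has_vector_derivative sys \<beta> 0 t (z t) 0) (at t within {0..c})"
    and "y 0 = z 0" "t \<in> {0..c}"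
  shows "y t = z t"
proof -
  obtain M where M: "\<And>t v w v' w'. norm (sys \<beta> 0 t v w - sys \<beta> 0 t v' w')
      \<le> M * (norm (v - v') + norm (w - w'))"
    using sys_lipschitz by blast
  have "y t - z t = 0"
  proof (rule gronwall_zero[where a=0 and b=c and w="\<lambda>t. y t - z t" and M=M])
    show "((\<lambda>t. y t - z t) has_vector_derivative sys \<beta> 0 t (y t) 0 - sys \<beta> 0 t (z t) 0) (at t within {0..c})"
      if "t \<in> {0..c}" for t
      by (intro has_vector_derivative_diff y z that)
    show "norm (sys \<beta> 0 t (y t) 0 - sys \<beta> 0 t (z t) 0) \<le> M * norm (y t - z t)" for t
      using M[of t "y t" 0 "z t" 0] by simp
  qed (use assms in auto)
  then show ?thesis by simp
qed

lemma ode_on_interval: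
  assumes "ode \<beta> y" "t \<in> {0..c}"
  shows "(y has_vector_derivative sys \<beta> 0 t (y t) 0) (at t within {0..c})"
  by (rule has_vector_derivative_within_subset[of _ _ _ "{0..}"]) (use assms in \<open>auto simp: ode_def\<close>)

lemma dde_lincomb:
  assumes "dde y" "dde z"
  shows "dde (\<lambda>t. a *s y t + b *s z t)"
  unfolding dde_def
proof (intro conjI allI impI)
  show "continuous_on {-T..} (\<lambda>t. a *s y t + b *s z t)"
    using assms unfolding dde_def
    by (intro continuous_on_add bounded_linear.continuous_on[OF bounded_linear_smult_vec]) auto
  fix t :: real assume "t \<ge> 0"
  then show "((\<lambda>t. a *s y t + b *s z t) has_vector_derivative
      sys (of_real \<kappa>) delay_gain t (a *s y t + b *s z t) (a *s y (t - T) + b *s z (t - T))) (at t within {0..})"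
    unfolding second_order_system_lincomb using assms unfolding dde_def
    by (intro has_vector_derivative_add has_vector_derivative_smult_vec) auto
qed

lemma ode_lincomb:
  assumes "ode \<beta> y" "ode \<beta> z"
  shows "ode \<beta> (\<lambda>t. a *s y t + b *s z t)"
  unfolding ode_def
proof (intro allI impI)
  fix t :: real assume "t \<ge> 0"
  then have "((\<lambda>t. a *s y t + b *s z t) has_vector_derivative
      sys \<beta> 0 t (a *s y t + b *s z t) (a *s 0 + b *s 0)) (at t within {0..})"
    unfolding second_order_system_lincomb using assms unfolding ode_def
    by (intro has_vector_derivative_add has_vector_derivative_smult_vec) auto
  then show "((\<lambda>t. a *s y t + b *s z t) has_vector_derivative sys \<beta> 0 t (a *s y t + b *s z t) 0) (at t within {0..})"
    by simp
qed

lemma dde_shift: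
  assumes "dde y"
  shows "dde (\<lambda>t. y (t + q))"
  unfolding dde_def
proof (intro conjI allI impI)
  show "continuous_on {-T..} (\<lambda>t. y (t + q))"
    using assms q_pos unfolding dde_def
    by (intro continuous_on_compose2[of "{-T..}" y _ "\<lambda>t. t + q"]) (auto intro!: continuous_intros)
  fix t :: real assume "t \<ge> 0"
  then have "(y has_vector_derivative sys (of_real \<kappa>) delay_gain (t + q) (y (t + q)) (y (t + q - T))) (at (t + q) within {0..})"
    using assms q_pos unfolding dde_def by simp
  note * = has_vector_derivative_shift[OF this \<open>t \<ge> 0\<close> q_pos]
  show "((\<lambda>t. y (t + q)) has_vector_derivative
      sys (of_real \<kappa>) delay_gain t (y (t + q)) (y (t - T + q))) (at t within {0..})"
  proof -
    have "t + q - T = t - T + q" by simp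
    with * show ?thesis by (simp add: second_order_system_def stiffness_shift)
  qed
qed

lemma ode_shift:
  assumes "ode \<beta> y"
  shows "ode \<beta> (\<lambda>t. y (t + q))"
  unfolding ode_def
proof (intro allI impI)
  fix t :: real assume "t \<ge> 0"
  then have "(y has_vector_derivative sys \<beta> 0 (t + q) (y (t + q)) 0) (at (t + q) within {0..})"
    using assms q_pos unfolding ode_def by simp
  from has_vector_derivative_shift[OF this \<open>t \<ge> 0\<close> q_pos]
  show "((\<lambda>t. y (t + q)) has_vector_derivative sys \<beta> 0 t (y (t + q)) 0) (at t within {0..})"
    by (simp add: second_order_system_def stiffness_shift)
qed

lemma iterate_shift:
  assumes "\<And>t. t \<ge> r \<Longrightarrow> y (t + q) = c *s (y t :: complex ^ 2)" "t \<ge> r"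
  shows "y (t + real j * q) = c ^ j *s y t"
proof (induction j)
  case (Suc j)
  have "y (t + real (Suc j) * q) = y ((t + real j * q) + q)" by (simp add: algebra_simps)
  also have "\<dots> = c *s y (t + real j * q)"
    using assms(2) q_pos by (intro assms(1)) (simp add: add_increasing2)
  finally show ?case by (simp add: Suc vector_2_eq_iff mult.assoc)
qed simp

text \<open>Positive times are reduced to [0, q] by going back; from negative times the relation is
  iterated forward into [0, q], and the power of c is divided out.\<close>

lemma zero_from_fundamental_interval:
  assumes shift: "\<And>t. t \<ge> -T \<Longrightarrow> y (t + q) = c *s (y t :: complex ^ 2)" and "c \<noteq> 0"
    and zero: "\<And>t. t \<in> {0..q} \<Longrightarrow> y t = 0" and t: "t \<ge> - T"
  shows "y t = 0"
proof (cases "t \<ge> 0")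
  case True
  define j where "j = nat \<lfloor>t / q\<rfloor>"
  have "real j \<le> t / q" "t / q < real j + 1" using True q_pos by (auto simp: j_def)
  then have "real j * q \<le> t" "t < (real j + 1) * q" using q_pos by (auto simp: field_simps)
  then have "t - real j * q \<in> {0..q}" by (auto simp: algebra_simps)
  then show ?thesis
    using iterate_shift[of "-T" y c "t - real j * q" j] shift T_pos zero by simp
next
  case False
  define j where "j = nat \<lceil>- t / q\<rceil>"
  have "- t / q > 0" using False q_pos by (simp add: divide_less_0_iff)
  then have "- t / q \<le> real j" "real j < - t / q + 1" unfolding j_def by linarith+
  then have "- t \<le> real j * q" "real j * q < - t + q" using q_pos by (auto simp: field_simps)
  then have "t + real j * q \<in> {0..q}" by (auto simp: algebra_simps)
  then have "c ^ j *s y t = 0"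
    using iterate_shift[of "-T" y c t j] shift t zero by simp
  then show ?thesis using \<open>c \<noteq> 0\<close> by (simp add: vector_2_eq_iff)
qed

lemma to_hill:
  fixes y :: "real \<Rightarrow> complex ^ 2"
  assumes y: "\<And>t. t \<in> {0..q} \<Longrightarrow>
    (y has_vector_derivative vector [y t $ 2, stiffness \<beta> t * y t $ 1 + g t]) (at t within {0..})"
  shows "hill_solution (\<alpha> * q\<^sup>2) u (of_real (q\<^sup>2) * \<beta>) (\<lambda>s. of_real (q\<^sup>2) * g (q * s))
    (\<lambda>s. y (q * s) $ 1) (\<lambda>s. of_real q * y (q * s) $ 2)"
  unfolding hill_solution_def
proof (intro ballI conjI)
  fix s :: real assume s: "s \<in> {0..1}"
  have qs: "q * s \<in> {0..q}" using s q_pos by (simp add: mult_left_le)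
  have "((\<lambda>s. q * s) has_vector_derivative q) (at s within {0..1})"
    by (auto intro!: derivative_eq_intros)
  moreover have "(\<lambda>s. q * s) ` {0..1} \<subseteq> {0..}" using q_pos by auto
  ultimately have "(y \<circ> (\<lambda>s. q * s) has_vector_derivative
      q *\<^sub>R vector [y (q * s) $ 2, stiffness \<beta> (q * s) * y (q * s) $ 1 + g (q * s)]) (at s within {0..1})"
    using has_vector_derivative_within_subset[OF y[OF qs]] by (intro vector_diff_chain_within) auto
  then have d: "((\<lambda>s. y (q * s)) has_vector_derivative
      q *\<^sub>R vector [y (q * s) $ 2, stiffness \<beta> (q * s) * y (q * s) $ 1 + g (q * s)]) (at s within {0..1})"
    by (simp add: o_def)
  show "((\<lambda>s. y (q * s) $ 1) has_vector_derivative of_real q * y (q * s) $ 2) (at s within {0..1})"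
    using has_vector_derivative_vec_nth[OF d, of 1]
    unfolding vector_scaleR_component by (simp add: scaleR_conv_of_real)
  have "((\<lambda>s. of_real q * y (q * s) $ 2) has_vector_derivative
      of_real q * (of_real q * (stiffness \<beta> (q * s) * y (q * s) $ 1 + g (q * s)))) (at s within {0..1})"
    using has_vector_derivative_mult_right[OF has_vector_derivative_vec_nth[OF d, of 2], of "of_real q"]
    unfolding vector_scaleR_component by (simp add: scaleR_conv_of_real)
  moreover have "of_real q * (of_real q * (stiffness \<beta> (q * s) * y (q * s) $ 1 + g (q * s)))
    = (of_real (q\<^sup>2) * \<beta> - of_real (\<alpha> * q\<^sup>2 + 3 * (u s)\<^sup>2)) * y (q * s) $ 1 + of_real (q\<^sup>2) * g (q * s)"
    by (simp add: stiffness_def power2_eq_square algebra_simps)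
  ultimately show "((\<lambda>s. of_real q * y (q * s) $ 2) has_vector_derivative
     (of_real (q\<^sup>2) * \<beta> - of_real (\<alpha> * q\<^sup>2 + 3 * (u s)\<^sup>2)) * y (q * s) $ 1 + of_real (q\<^sup>2) * g (q * s)) (at s within {0..1})"
    by simp
qed

text \<open>A Hill solution is given on [0, 1] only; the ordinary equation continues it to all
  positive times, and uniqueness identifies the two on the first half period.\<close>

lemma from_hill:
  fixes yh vh :: "real \<Rightarrow> real" and \<beta> :: real
  assumes sol: "hill_solution (\<alpha> * q\<^sup>2) u (q\<^sup>2 * \<beta>) (\<lambda>_. 0) yh vh"
  shows "\<exists>y. ode (of_real \<beta>) y \<and> (\<forall>t\<in>{0..q}. y t = vector [of_real (yh (t / q)), of_real (vh (t / q) / q)])"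
proof -
  define z :: "real \<Rightarrow> complex ^ 2" where "z t = vector [of_real (yh (t / q)), of_real (vh (t / q) / q)]" for t
  obtain y where y: "ode (of_real \<beta>) y" "y 0 = z 0" using ode_exists by blast
  have "y t = z t" if "t \<in> {0..q}" for t
  proof (rule ode_unique[where c=q and \<beta>="of_real \<beta>"])
    fix s :: real assume s: "s \<in> {0..q}"
    have sq: "s / q \<in> {0..1}" using s q_pos by simp
    have img: "(\<lambda>s. s / q) ` {0..q} \<subseteq> {0..1}" using q_pos by auto
    have c: "((\<lambda>s. s / q) has_vector_derivative 1 / q) (at s within {0..q})"
      by (auto intro!: derivative_eq_intros simp: divide_inverse scaleR_conv_of_real
          has_real_derivative_iff_has_vector_derivative[symmetric])
    have d: "(yh has_vector_derivative vh (s / q)) (at (s / q) within {0..1})"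
      "(vh has_vector_derivative (q\<^sup>2 * \<beta> - (\<alpha> * q\<^sup>2 + 3 * (u (s / q))\<^sup>2)) * yh (s / q)) (at (s / q) within {0..1})"
      using sol[unfolded hill_solution_def, rule_format, OF sq] by (simp_all only: of_real_eq_id id_apply add_0_right)
    have 1: "((\<lambda>s. yh (s / q)) has_vector_derivative (1 / q) *\<^sub>R vh (s / q)) (at s within {0..q})"
      using vector_diff_chain_within[OF c has_vector_derivative_within_subset[OF d(1) img]] by (simp add: o_def)
    have 2: "((\<lambda>s. vh (s / q)) has_vector_derivative
        (1 / q) *\<^sub>R ((q\<^sup>2 * \<beta> - (\<alpha> * q\<^sup>2 + 3 * (u (s / q))\<^sup>2)) * yh (s / q))) (at s within {0..q})"
      using vector_diff_chain_within[OF c has_vector_derivative_within_subset[OF d(2) img]] by (simp add: o_def)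
    have 3: "((\<lambda>s. vh (s / q) / q) has_vector_derivative
        (1 / q) *\<^sub>R ((q\<^sup>2 * \<beta> - (\<alpha> * q\<^sup>2 + 3 * (u (s / q))\<^sup>2)) * yh (s / q)) / q) (at s within {0..q})"
      by (rule has_vector_derivative_divide[OF 2])
    have "(z has_vector_derivative vector [of_real ((1 / q) *\<^sub>R vh (s / q)),
        of_real ((1 / q) *\<^sub>R ((q\<^sup>2 * \<beta> - (\<alpha> * q\<^sup>2 + 3 * (u (s / q))\<^sup>2)) * yh (s / q)) / q)]) (at s within {0..q})"
      unfolding z_def
      by (intro has_vector_derivative_vector_2 bounded_linear.has_vector_derivative[OF bounded_linear_of_real] 1 3)
    moreover have "vector [of_real ((1 / q) *\<^sub>R vh (s / q)),
        of_real ((1 / q) *\<^sub>R ((q\<^sup>2 * \<beta> - (\<alpha> * q\<^sup>2 + 3 * (u (s / q))\<^sup>2)) * yh (s / q)) / q)] = sys (of_real \<beta>) 0 s (z s) 0"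
    proof -
      have "(1 / q) *\<^sub>R ((q\<^sup>2 * \<beta> - (\<alpha> * q\<^sup>2 + 3 * (u (s / q))\<^sup>2)) * yh (s / q)) / q
         = (\<beta> - \<alpha> - 3 * (x s)\<^sup>2) * yh (s / q)"
        using q_pos by (simp add: field_simps power2_eq_square)
      then show ?thesis
        by (simp add: second_order_system_def z_def stiffness_def vector_2_eq_iff)
    qed
    ultimately show "(z has_vector_derivative sys (of_real \<beta>) 0 s (z s) 0) (at s within {0..q})" by simp
  qed (use y that ode_on_interval in auto)
  then show ?thesis using y(1) by (auto simp: z_def)
qed

section \<open>Histories of solutions and the time-p map\<close>

definition hist where "hist y = (\<lambda>\<theta>. if \<theta> \<in> {-T..0} then y \<theta> else (0 :: complex ^ 2))"

lemma hist_phase_space: "dde y \<Longrightarrow> hist y \<in> phase_space T"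
  unfolding phase_space_def hist_def dde_def
  by (auto intro!: continuous_on_eq[OF continuous_on_subset[of "{-T..}" y "{-T..0}"]])

lemma hist_cong: "(\<And>t. t \<in> {-T..0} \<Longrightarrow> y t = z t) \<Longrightarrow> hist y = hist z"
  by (auto simp: hist_def fun_eq_iff)

lemma hist_eq_iff:
  assumes "dde y" "dde z"
  shows "hist y = hist z \<longleftrightarrow> (\<forall>t\<ge>-T. y t = z t)"
proof
  assume "hist y = hist z"
  then have "y s = z s" if "s \<in> {-T..0}" for s
    using that by (metis hist_def)
  then show "\<forall>t\<ge>-T. y t = z t" using dde_unique[OF assms] by blast
qed (auto intro: hist_cong)

text \<open>Every phase point is the history of a solution on [-T, \<infinity>), so spectral
  statements about the time-p map become statements about time shifts of such solutions.\<close>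

lemma phase_space_hist:
  assumes "\<eta> \<in> phase_space T"
  obtains y where "dde y" "\<eta> = hist y"
proof -
  obtain y where "dde y" "\<forall>\<theta>\<in>{-T..0}. y \<theta> = \<eta> \<theta>"
    using dde_exists assms unfolding phase_space_def by blast
  moreover then have "\<eta> = hist y" using assms by (auto simp: hist_def phase_space_def fun_eq_iff)
  ultimately show thesis using that by blast
qed

lemma monodromy_hist:
  assumes "dde y"
  shows "monodromy \<alpha> \<kappa> T n (2 * q) x (hist y) = hist (\<lambda>t. y (t + 2 * q))"
proof -
  define z where "z = (SOME z. linearized_solution \<alpha> \<kappa> T n x (hist y) z)"
  have "linearized_solution \<alpha> \<kappa> T n x (hist y) y"
    unfolding linearized_solution_iff using assms by (simp add: hist_def)
  then have z: "linearized_solution \<alpha> \<kappa> T n x (hist y) z" unfolding z_def by (rule someI[where P="linearized_solution \<alpha> \<kappa> T n x (hist y)"])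
  have "z t = y t" if "t \<ge> - T" for t
    by (rule dde_unique[OF _ assms _ that]) (use z in \<open>auto simp: linearized_solution_iff hist_def\<close>)
  then show ?thesis
    unfolding monodromy_def z_def[symmetric] hist_def[of "\<lambda>t. y (t + 2 * q)"] using q_pos by (auto simp: fun_eq_iff add.commute)
qed

lemma dde_zero: "dde (\<lambda>_. 0)"
proof -
  have "(vector [0, 0] :: complex ^ 2) = 0" by (simp add: vector_2_eq_iff)
  then show ?thesis by (simp add: dde_def second_order_system_def has_vector_derivative_const)
qed

end

section \<open>Floquet multipliers of the orbit\<close>

lemma (in hill) hill_solution_zero_velocity:
  assumes sol: "hill_solution \<epsilon> u b (\<lambda>_. 0) y v" and zero: "\<And>t. t \<in> {0..1} \<Longrightarrow> y t = 0" and t: "t \<in> {0..1}"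
  shows "v t = 0"
proof -
  have "(y has_vector_derivative v t) (at t within {0..1})"
    using sol t by (simp add: hill_solution_def)
  moreover have "(y has_vector_derivative 0) (at t within {0..1})"
    by (rule has_vector_derivative_transform[OF t _ has_vector_derivative_const]) (use zero in auto)
  ultimately show ?thesis
    using vector_derivative_unique_within_closed_interval[of 0 1 t y "v t" 0] t by simp
qed

context controlled_orbit
begin

lemma stiffness_shift_T: "stiffness \<beta> (t + T) = stiffness \<beta> t"
proof -
  have "stiffness \<beta> (t + real j * q) = stiffness \<beta> t" for j
  proof (induction j)
    case (Suc j)
    have "stiffness \<beta> (t + real (Suc j) * q) = stiffness \<beta> ((t + real j * q) + q)"
      by (simp add: algebra_simps)
    then show ?case using Suc by (simp add: stiffness_shift)
  qed simp
  then show ?thesis by (simp add: T_eq)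
qed

text \<open>The delay consists of n shifts, so y(t) = (-\<nu>)^n y(t - T); the sign (-1)^n of the
  control cancels the one in (-\<nu>)^n, and the delayed term becomes instantaneous.\<close>

lemma delayed_value:
  assumes shift: "\<And>t. t \<ge> -T \<Longrightarrow> y (t + q) = (- \<nu>) *s (y t :: complex ^ 2)" and "\<nu> \<noteq> 0" "t \<ge> 0"
  shows "delay_gain * y (t - T) $ 1 = - of_real \<kappa> * inverse \<nu> ^ n * y t $ 1"
proof -
  have "y ((t - T) + real n * q) = (- \<nu>) ^ n *s y (t - T)"
    by (rule iterate_shift[where r="- T"]) (use shift \<open>t \<ge> 0\<close> in auto)
  then have "y t $ 1 = (- 1) ^ n * \<nu> ^ n * y (t - T) $ 1"
    by (simp add: T_eq power_minus[of \<nu>])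
  moreover have "(- 1) ^ n * ((- 1) ^ n * z) = z" for z :: complex
    by (simp flip: mult.assoc power_mult_distrib)
  ultimately show ?thesis
    using \<open>\<nu> \<noteq> 0\<close> by (simp add: delay_gain_def power_inverse mult.assoc mult.left_commute[of "inverse _"])
qed

lemma shift_imp_hill:
  assumes y: "dde y" and shift: "\<And>t. t \<ge> -T \<Longrightarrow> y (t + q) = (- \<nu>) *s y t" and \<nu>: "\<nu> \<noteq> 0"
  shows "hill_solution (\<alpha> * q\<^sup>2) u (of_real (\<kappa> * q\<^sup>2) * (1 - inverse \<nu> ^ n)) (\<lambda>_. 0)
      (\<lambda>s. y (q * s) $ 1) (\<lambda>s. of_real q * y (q * s) $ 2)"
    and "y (q * 1) $ 1 = - \<nu> * y (q * 0) $ 1" "of_real q * y (q * 1) $ 2 = - \<nu> * (of_real q * y (q * 0) $ 2)"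
proof -
  have "(y has_vector_derivative vector [y t $ 2, stiffness (of_real \<kappa> * (1 - inverse \<nu> ^ n)) t * y t $ 1 + 0]) (at t within {0..})"
    if "t \<in> {0..q}" for t
  proof -
    have "sys (of_real \<kappa>) delay_gain t (y t) (y (t - T))
       = vector [y t $ 2, stiffness (of_real \<kappa> * (1 - inverse \<nu> ^ n)) t * y t $ 1 + 0]"
      using delayed_value[of y \<nu> t] shift \<nu> that
      by (simp add: second_order_system_def stiffness_def algebra_simps)
    then show ?thesis using y that by (auto simp: dde_def)
  qed
  from to_hill[OF this]
  show "hill_solution (\<alpha> * q\<^sup>2) u (of_real (\<kappa> * q\<^sup>2) * (1 - inverse \<nu> ^ n)) (\<lambda>_. 0)
      (\<lambda>s. y (q * s) $ 1) (\<lambda>s. of_real q * y (q * s) $ 2)"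
    by (simp add: mult_ac)
  show "y (q * 1) $ 1 = - \<nu> * y (q * 0) $ 1" "of_real q * y (q * 1) $ 2 = - \<nu> * (of_real q * y (q * 0) $ 2)"
    using shift[of 0] T_pos by simp_all
qed

lemma dde_zero_from_hill:
  assumes y: "dde y" and shift: "\<And>t. t \<ge> -T \<Longrightarrow> y (t + q) = (- \<nu>) *s y t" and \<nu>: "\<nu> \<noteq> 0"
    and zero: "\<And>s. s \<in> {0..1} \<Longrightarrow> y (q * s) $ 1 = 0" and "t \<ge> - T"
  shows "y t = 0"
proof (rule zero_from_fundamental_interval[where y=y and c="- \<nu>"])
  fix t assume "t \<in> {0..q}"
  then have s: "t / q \<in> {0..1}" "q * (t / q) = t" using q_pos by auto
  have "of_real q * y (q * (t / q)) $ 2 = 0"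
    using hill_solution_zero_velocity[OF shift_imp_hill(1)[OF y shift \<nu>] zero s(1)] by simp
  then show "y t = 0" using zero[OF s(1)] s(2) q_pos by (simp add: vector_2_eq_iff)
qed (use \<nu> shift \<open>t \<ge> - T\<close> in auto)

text \<open>Here \<nu> is a square root of a multiplier. The value -1 is among those excluded: it
  would contribute to the multiplier 1 and spoil its simplicity.\<close>

definition no_unstable_multiplier where
  "no_unstable_multiplier \<longleftrightarrow> (\<forall>\<nu> y v. norm \<nu> \<ge> 1 \<and> \<nu> \<noteq> 1 \<and>
     hill_solution (\<alpha> * q\<^sup>2) u (of_real (\<kappa> * q\<^sup>2) * (1 - inverse \<nu> ^ n)) (\<lambda>_. 0) y v \<and>
     y 1 = - \<nu> * y 0 \<and> v 1 = - \<nu> * v 0 \<longrightarrow> (\<forall>s\<in>{0..1}. y s = (0 :: complex)))"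

lemma no_unstable_shift:
  assumes "no_unstable_multiplier" and y: "dde y"
    and shift: "\<And>t. t \<ge> -T \<Longrightarrow> y (t + q) = (- \<nu>) *s y t" and \<nu>: "norm \<nu> \<ge> 1" "\<nu> \<noteq> 1" and "t \<ge> - T"
  shows "y t = 0"
proof (rule dde_zero_from_hill[OF y shift _ _ \<open>t \<ge> - T\<close>])
  show "\<nu> \<noteq> 0" using \<nu> by auto
  show "y (q * s) $ 1 = 0" if "s \<in> {0..1}" for s
    using assms(1) shift_imp_hill[OF y shift \<open>\<nu> \<noteq> 0\<close>] \<nu> that unfolding no_unstable_multiplier_def by blast
qed auto

text \<open>The pair (x', x''), the trivial eigenfunction; being antiperiodic over q, it belongs to
  \<nu> = 1.\<close>

definition xdot :: "real \<Rightarrow> complex ^ 2" where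
  "xdot t = vector [of_real (deriv x t), of_real (- \<alpha> * x t - x t ^ 3)]"

lemma deriv_x_anti: "deriv x (t + q) = - deriv x t"
proof -
  have "((\<lambda>t. - x (t + q)) has_real_derivative - deriv x (t + q)) (at t)"
    using x_sol by (auto intro!: derivative_eq_intros DERIV_chain2[of x] simp: duffing_solution_def)
  moreover have "(\<lambda>t. - x (t + q)) = x" by (simp add: x_anti)
  ultimately show ?thesis by (simp add: DERIV_imp_deriv)
qed

lemma xdot_shift: "xdot (t + q) = (- 1) *s xdot t"
  by (simp add: xdot_def vector_2_eq_iff deriv_x_anti x_anti)

lemma xdot_shift_T: "xdot (t + T) = (- 1) ^ n *s xdot t"
  using iterate_shift[of t xdot "- 1" t n] xdot_shift by (simp add: T_eq)

lemma xdot_deriv: "(xdot has_vector_derivative sys 0 0 t (xdot t) w) (at t within S)"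
proof -
  have x: "(x has_real_derivative deriv x t) (at t)" "(deriv x has_real_derivative - \<alpha> * x t - x t ^ 3) (at t)"
    using x_sol by (auto simp: duffing_solution_def)
  have "((\<lambda>t. - \<alpha> * x t - x t ^ 3) has_real_derivative (- \<alpha> - 3 * (x t)\<^sup>2) * deriv x t) (at t)"
    by (auto intro!: derivative_eq_intros x simp: algebra_simps)
  then have "(xdot has_vector_derivative vector [of_real (- \<alpha> * x t - x t ^ 3),
      of_real ((- \<alpha> - 3 * (x t)\<^sup>2) * deriv x t)]) (at t within S)"
    unfolding xdot_def using x by (intro has_vector_derivative_vector_2 has_vector_derivative_of_real')
  moreover have "vector [of_real (- \<alpha> * x t - x t ^ 3), of_real ((- \<alpha> - 3 * (x t)\<^sup>2) * deriv x t)] = sys 0 0 t (xdot t) w"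
    by (simp add: second_order_system_def xdot_def stiffness_def vector_2_eq_iff)
  ultimately show ?thesis by simp
qed

lemma xdot_ode: "ode 0 xdot"
  using xdot_deriv by (simp add: ode_def)

lemma xdot_dde: "dde xdot"
  unfolding dde_def
proof (intro conjI allI impI)
  show "continuous_on {-T..} xdot"
    using xdot_deriv by (rule continuous_on_vector_derivative)
  fix t :: real assume "t \<ge> 0"
  have "delay_gain * xdot (t - T) $ 1 = - of_real \<kappa> * inverse 1 ^ n * xdot t $ 1"
    by (rule delayed_value) (use xdot_shift \<open>t \<ge> 0\<close> in auto)
  then have "sys (of_real \<kappa>) delay_gain t (xdot t) (xdot (t - T)) = sys 0 0 t (xdot t) 0"
    by (simp add: second_order_system_def stiffness_def algebra_simps)
  then show "(xdot has_vector_derivative sys (of_real \<kappa>) delay_gain t (xdot t) (xdot (t - T))) (at t within {0..})"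
    using xdot_deriv by simp
qed

lemma \<phi>_xdot: "\<phi> s = q\<^sup>2 * deriv x (q * s)" "\<phi>' s = q ^ 3 * (- \<alpha> * x (q * s) - x (q * s) ^ 3)"
proof -
  show "\<phi> s = q\<^sup>2 * deriv x (q * s)"
    using duffing_affine(2)[OF x_sol, of q 0] by (simp add: \<phi>_def)
  show "\<phi>' s = q ^ 3 * (- \<alpha> * x (q * s) - x (q * s) ^ 3)"
  proof -
    have "- (\<alpha> * q\<^sup>2) * (q * z) - (q * z) ^ 3 = q ^ 3 * (- \<alpha> * z - z ^ 3)" for z
      by (simp add: algebra_simps power2_eq_square power3_eq_cube)
    then show ?thesis unfolding \<phi>'_def .
  qed
qed

lemma xdot_\<phi>: "of_real (\<phi> s) = of_real (q\<^sup>2) * xdot (q * s) $ 1"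
  "of_real (\<phi>' s) = of_real (q ^ 3) * xdot (q * s) $ 2"
  by (simp_all add: \<phi>_xdot xdot_def)

text \<open>Otherwise \<open>\<phi>\<close> and \<open>\<phi>'\<close> would vanish at 0, and with
  them the Wronskian \<open>D 0\<close>.\<close>

lemma xdot_nonzero: "xdot 0 \<noteq> 0"
proof
  assume "xdot 0 = 0"
  then have "deriv x 0 = 0" "- \<alpha> * x 0 - x 0 ^ 3 = 0"
    by (simp_all add: xdot_def vector_2_eq_iff flip: of_real_power of_real_mult of_real_diff of_real_minus)
  then have "\<phi> 0 = 0" "\<phi>' 0 = 0" by (simp_all add: \<phi>_xdot)
  then show False using D_ge[of 0] by (simp add: D_def)
qed

text \<open>For \<nu> = 1 the factor 1 - \<nu>^-n is 0 and the control drops out, so uniqueness for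
  the uncontrolled Hill problem applies.\<close>

lemma antiperiodic_dde:
  assumes y: "dde y" and shift: "\<And>t. t \<ge> -T \<Longrightarrow> y (t + q) = (- 1) *s y t"
    and small: "10 * 400 ^ 4 * \<bar>\<alpha> * q\<^sup>2\<bar> < 1"
  shows "\<exists>c. \<forall>t\<ge>-T. y t = c *s xdot t"
proof -
  have "hill_solution (\<alpha> * q\<^sup>2) u 0 (\<lambda>_. 0) (\<lambda>s. y (q * s) $ 1) (\<lambda>s. of_real q * y (q * s) $ 2)"
    using shift_imp_hill(1)[OF y shift] by simp
  then have "\<exists>c. \<forall>s\<in>{0..1}. y (q * s) $ 1 = c * of_real (\<phi> s) \<and> of_real q * y (q * s) $ 2 = c * of_real (\<phi>' s)"
    by (rule antiperiodic_unique[OF _ small]) (use shift_imp_hill(2,3)[OF y shift] in simp_all)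
  then obtain c where c: "\<And>s. s \<in> {0..1} \<Longrightarrow> y (q * s) $ 1 = c * of_real (\<phi> s) \<and> of_real q * y (q * s) $ 2 = c * of_real (\<phi>' s)"
    by blast
  define w where "w t = 1 *s y t + (- c * of_real (q\<^sup>2)) *s xdot t" for t
  have "w t = 0" if "t \<ge> - T" for t
  proof (rule zero_from_fundamental_interval[where y=w and c="- 1"])
    show "w (t + q) = (- 1) *s w t" if "t \<ge> - T" for t
      using shift[OF that] by (simp add: w_def xdot_shift vector_2_eq_iff)
    fix t assume "t \<in> {0..q}"
    then have s: "t / q \<in> {0..1}" "q * (t / q) = t" using q_pos by auto
    have "y t $ 1 = c * of_real (q\<^sup>2) * xdot t $ 1" "of_real q * y t $ 2 = of_real q * (c * of_real (q\<^sup>2) * xdot t $ 2)"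
      using c[OF s(1)] unfolding xdot_\<phi> s(2) by (simp_all add: power2_eq_square power3_eq_cube mult.assoc)
    then show "w t = 0" using q_pos by (simp add: w_def vector_2_eq_iff)
  qed (use that in auto)
  then have "y t = (c * of_real (q\<^sup>2)) *s xdot t" if "t \<ge> - T" for t
    using that by (simp add: w_def vector_2_eq_iff)
  then show ?thesis by blast
qed

section \<open>Eigenfunctions and Jordan chains of the time-p map\<close>

lemma hist_smult: "cscale c (hist y) = hist (\<lambda>t. c *s y t)"
  by (auto simp: cscale_def hist_def fun_eq_iff)

lemma dde_smult: "dde y \<Longrightarrow> dde (\<lambda>t. c *s y t)"
  using dde_lincomb[of y y c 0] by simp

lemma dde_shift_period: "dde y \<Longrightarrow> dde (\<lambda>t. y (t + 2 * q))"
  using dde_shift[OF dde_shift[of y]] by (simp add: algebra_simps)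

lemma hist_zero_iff: "dde y \<Longrightarrow> hist y = 0 \<longleftrightarrow> (\<forall>t\<ge>-T. y t = 0)"
proof -
  assume "dde y"
  moreover have "hist (\<lambda>_. 0) = 0" by (simp add: hist_def zero_fun_def)
  ultimately show ?thesis using hist_eq_iff[OF _ dde_zero] by metis
qed

lemma floquet_multiplier_iff:
  "floquet_multiplier \<alpha> \<kappa> T n (2 * q) x \<mu> \<longleftrightarrow> \<mu> \<noteq> 0 \<and>
    (\<exists>y. dde y \<and> (\<exists>t\<ge>-T. y t \<noteq> 0) \<and> (\<forall>t\<ge>-T. y (t + 2 * q) = \<mu> *s y t))"
proof -
  have key: "hist y \<noteq> 0 \<and> monodromy \<alpha> \<kappa> T n (2 * q) x (hist y) = cscale \<mu> (hist y) \<longleftrightarrow>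
      (\<exists>t\<ge>-T. y t \<noteq> 0) \<and> (\<forall>t\<ge>-T. y (t + 2 * q) = \<mu> *s y t)" if "dde y" for y
    unfolding monodromy_hist[OF that] hist_smult hist_eq_iff[OF dde_shift_period[OF that] dde_smult[OF that]]
      hist_zero_iff[OF that] by auto
  have hist_iff: "(\<exists>\<phi>\<in>phase_space T. Q \<phi>) \<longleftrightarrow> (\<exists>y. dde y \<and> Q (hist y))" for Q
  proof
    assume "\<exists>\<phi>\<in>phase_space T. Q \<phi>"
    then obtain \<eta> where "\<eta> \<in> phase_space T" "Q \<eta>" by blast
    then show "\<exists>y. dde y \<and> Q (hist y)" by (elim phase_space_hist) auto
  qed (use hist_phase_space in blast)
  show ?thesis unfolding floquet_multiplier_def hist_iff by (simp add: key cong: conj_cong)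
qed

text \<open>With S the shift by q and r^2 = \<mu>, the hypothesis factors as (S - r)(S + r) y = 0:
  either (S + r) y is an eigenfunction of S for r, or it vanishes and y is one for -r.\<close>

lemma half_period_multiplier:
  assumes y: "dde y" "\<exists>t\<ge>-T. y t \<noteq> 0" and per: "\<And>t. t \<ge> -T \<Longrightarrow> y (t + 2 * q) = \<mu> *s y t"
  obtains \<nu> z where "\<nu>\<^sup>2 = \<mu>" "dde z" "\<exists>t\<ge>-T. z t \<noteq> 0" "\<And>t. t \<ge> -T \<Longrightarrow> z (t + q) = (- \<nu>) *s z t"
proof -
  define r where "r = csqrt \<mu>"
  have r: "r\<^sup>2 = \<mu>" "r * r = \<mu>" by (simp_all add: r_def flip: power2_eq_square)
  define z where "z t = 1 *s y (t + q) + r *s y t" for t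
  have z: "dde z" unfolding z_def by (rule dde_lincomb[OF dde_shift[OF y(1)] y(1)])
  have z_shift: "z (t + q) = r *s z t" if "t \<ge> - T" for t
    using per[OF that] r by (simp add: z_def vector_2_eq_iff algebra_simps flip: mult.assoc)
  show thesis
  proof (cases "\<exists>t\<ge>-T. z t \<noteq> 0")
    case True
    then show thesis using that[of "- r" z] r z z_shift by simp
  next
    case False
    then have "y (t + q) = (- r) *s y t" if "t \<ge> - T" for t
      using that by (auto simp: z_def vector_2_eq_iff add_eq_0_iff)
    then show thesis using that[of r y] r y by simp
  qed
qed

lemma xdot_shift_period: "xdot (t + 2 * q) = xdot t"
  using xdot_shift[of "t + q"] xdot_shift[of t] by (simp add: algebra_simps)

lemma floquet_multiplier_one: "floquet_multiplier \<alpha> \<kappa> T n (2 * q) x 1"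
proof -
  have "\<exists>t\<ge>-T. xdot t \<noteq> 0" using xdot_nonzero T_pos by (intro exI[of _ 0]) auto
  then show ?thesis unfolding floquet_multiplier_iff using xdot_dde xdot_shift_period by auto
qed

text \<open>The time-p map minus the identity, acting on solutions instead of histories.\<close>

definition \<Delta> where "\<Delta> y = (\<lambda>t. 1 *s y (t + 2 * q) + (- 1) *s (y t :: complex ^ 2))"

lemma dde_\<Delta>: "dde y \<Longrightarrow> dde (\<Delta> y)"
  unfolding \<Delta>_def by (intro dde_lincomb dde_shift_period)

lemma monodromy_minus_power:
  assumes "dde y"
  shows "((\<lambda>\<psi>. monodromy \<alpha> \<kappa> T n (2 * q) x \<psi> - cscale 1 \<psi>) ^^ k) (hist y) = hist ((\<Delta> ^^ k) y)"
    and "dde ((\<Delta> ^^ k) y)"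
proof -
  define N where "N = (\<lambda>\<psi>. monodromy \<alpha> \<kappa> T n (2 * q) x \<psi> - cscale 1 \<psi>)"
  have N: "N (hist z) = hist (\<Delta> z)" if "dde z" for z
    unfolding N_def monodromy_hist[OF that] by (auto simp: hist_def \<Delta>_def cscale_def fun_eq_iff)
  have "(N ^^ k) (hist y) = hist ((\<Delta> ^^ k) y) \<and> dde ((\<Delta> ^^ k) y)"
    by (induction k) (use assms N dde_\<Delta> in auto)
  then show "((\<lambda>\<psi>. monodromy \<alpha> \<kappa> T n (2 * q) x \<psi> - cscale 1 \<psi>) ^^ k) (hist y) = hist ((\<Delta> ^^ k) y)"
    "dde ((\<Delta> ^^ k) y)" unfolding N_def by auto
qed

lemma generalized_eigenspace_iff:
  assumes "dde y"
  shows "hist y \<in> generalized_eigenspace \<alpha> \<kappa> T n (2 * q) x 1 \<longleftrightarrow> (\<exists>k. \<forall>t\<ge>-T. (\<Delta> ^^ k) y t = 0)"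
  unfolding generalized_eigenspace_def
  using hist_phase_space[OF assms] hist_zero_iff[OF monodromy_minus_power(2)[OF assms]]
  by (simp only: mem_Collect_eq monodromy_minus_power(1)[OF assms]) blast

text \<open>For a solution y of period 2q and the shift S by q, the function S y + y is invariant
  under S. It belongs to \<nu> = -1, hence vanishes, and y is antiperiodic.\<close>

lemma \<Delta>_kernel:
  assumes "no_unstable_multiplier" and small: "10 * 400 ^ 4 * \<bar>\<alpha> * q\<^sup>2\<bar> < 1"
    and y: "dde y" and per: "\<And>t. t \<ge> - T \<Longrightarrow> \<Delta> y t = 0"
  shows "\<exists>c. \<forall>t\<ge>-T. y t = c *s xdot t"
proof (rule antiperiodic_dde[OF y _ small])
  fix t assume "t \<ge> - T"
  define z where "z t = 1 *s y (t + q) + 1 *s y t" for t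
  have "dde z" unfolding z_def by (rule dde_lincomb[OF dde_shift[OF y(1)] y(1)])
  moreover have "z (t + q) = (- (- 1)) *s z t" if "t \<ge> - T" for t
    using per[OF that] by (auto simp: z_def \<Delta>_def algebra_simps)
  ultimately have "z t = 0" using no_unstable_shift[OF assms(1), of z "- 1" t] \<open>t \<ge> - T\<close> by simp
  then show "y (t + q) = (- 1) *s y t" by (simp add: z_def add_eq_0_iff)
qed

text \<open>If \<Delta> y = c \<open>xdot\<close>, the shift by q sends y to -y - (c/2)
  \<open>xdot\<close>. After n shifts the delayed value differs by n (c/2) \<open>xdot\<close>, and
  the control feeds this back into Hill's equation as a resonant forcing proportional to \<kappa> n
  c, which has to be 0.\<close>

lemma no_jordan_block:
  assumes "no_unstable_multiplier" and small: "10 * 400 ^ 4 * \<bar>\<alpha> * q\<^sup>2\<bar> < 1" and "\<kappa> \<noteq> 0"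
    and y: "dde y" and \<Delta>2: "\<And>t. t \<ge> - T \<Longrightarrow> \<Delta> (\<Delta> y) t = 0" and t: "t \<ge> - T"
  shows "\<Delta> y t = 0"
proof -
  obtain c where c: "\<And>t. t \<ge> - T \<Longrightarrow> \<Delta> y t = c *s xdot t"
    using \<Delta>_kernel[OF assms(1) small dde_\<Delta>[OF y] \<Delta>2] by blast
  define d where "d = c / 2"
  \<comment> \<open>The coefficient c/2 is the one that makes \<open>w\<close> invariant under the
    shift by q, so that it belongs to \<nu> = -1 and vanishes.\<close>
  define w where "w t = 1 *s (1 *s y (t + q) + 1 *s y t) + d *s xdot t" for t
  have "dde w" unfolding w_def by (intro dde_lincomb dde_shift y xdot_dde)
  moreover have "w (t + q) = (- (- 1)) *s w t" if "t \<ge> - T" for t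
  proof -
    have "y (t + 2 * q) - y t = c *s xdot t" using c[OF that] by (simp add: \<Delta>_def)
    then have "y (t + 2 * q) = c *s xdot t + y t" by (simp only: diff_eq_eq)
    moreover have "t + 2 * q = t + q + q" by simp
    ultimately have y2: "y (t + q + q) = c *s xdot t + y t" by (simp only:)
    show ?thesis
      unfolding w_def xdot_shift y2 by (simp add: d_def vector_2_eq_iff)
  qed
  ultimately have w: "w t = 0" if "t \<ge> - T" for t
    using no_unstable_shift[OF assms(1), of w "- 1" t] that by simp
  have step: "y (t + q) = (- 1) *s y t + (- d) *s xdot t" if "t \<ge> - T" for t
  proof -
    have "y (t + q) + (y t + d *s xdot t) = 0" using w[OF that] by (simp add: w_def vector_2_eq_iff add.assoc)
    then have "y (t + q) = - (y t + d *s xdot t)" by (simp only: eq_neg_iff_add_eq_0)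
    then show ?thesis by (simp add: vector_2_eq_iff)
  qed
  have iterate: "y (t + real j * q) = (- 1) ^ j *s (y t + (of_nat j * d) *s xdot t)" if "t \<ge> - T" for t j
  proof (induction j)
    case (Suc j)
    have "y (t + real (Suc j) * q) = y ((t + real j * q) + q)" by (simp add: algebra_simps)
    also have "\<dots> = (- 1) *s y (t + real j * q) + (- d) *s xdot (t + real j * q)"
      using that q_pos by (intro step) (simp add: add_increasing2)
    also have "xdot (t + real j * q) = (- 1) ^ j *s xdot t"
      using iterate_shift[of t xdot "- 1" t j] xdot_shift by simp
    finally have eq: "y (t + real (Suc j) * q) = (- 1) *s y (t + real j * q) + (- d) *s ((- 1) ^ j *s xdot t)" .
    show ?case unfolding eq Suc by (simp add: vector_2_eq_iff algebra_simps)
  qed simp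
  define g where "g t = of_real \<kappa> * (of_nat n * d) * xdot t $ 1" for t
  have "(y has_vector_derivative vector [y t $ 2, stiffness 0 t * y t $ 1 + g t]) (at t within {0..})"
    if "t \<in> {0..q}" for t
  proof -
    have "t - T \<ge> - T" using that by simp
    have "xdot ((t - T) + T) = (- 1) ^ n *s xdot (t - T)" by (rule xdot_shift_T)
    moreover have "y ((t - T) + real n * q) = (- 1) ^ n *s (y (t - T) + (of_nat n * d) *s xdot (t - T))"
      using iterate[OF \<open>t - T \<ge> - T\<close>] .
    ultimately have "y t $ 1 = (- 1) ^ n * y (t - T) $ 1 + of_nat n * d * xdot t $ 1"
      by (simp add: T_eq algebra_simps)
    then have "delay_gain * y (t - T) $ 1 = - of_real \<kappa> * (y t $ 1 - of_nat n * d * xdot t $ 1)"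
      by (simp add: delay_gain_def)
    then have "sys (of_real \<kappa>) delay_gain t (y t) (y (t - T)) = vector [y t $ 2, stiffness 0 t * y t $ 1 + g t]"
      by (simp add: second_order_system_def stiffness_def g_def algebra_simps)
    then show ?thesis using y that by (auto simp: dde_def)
  qed
  note der = this
  have forcing: "(\<lambda>s. of_real (q\<^sup>2) * g (q * s)) = (\<lambda>s. (of_real \<kappa> * (of_nat n * d)) * of_real (\<phi> s))"
    unfolding g_def xdot_\<phi> by (simp only: mult_ac)
  have "hill_solution (\<alpha> * q\<^sup>2) u 0 (\<lambda>s. (of_real \<kappa> * (of_nat n * d)) * of_real (\<phi> s))
     (\<lambda>s. y (q * s) $ 1) (\<lambda>s. of_real q * y (q * s) $ 2)"
    using to_hill[OF der] unfolding forcing by simp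
  moreover have "\<bar>\<alpha> * q\<^sup>2\<bar> * 400\<^sup>2 < 1 / 3" using small by simp
  moreover have "y (0 + q) $ i = ((- 1) *s y 0 + (- d) *s xdot 0) $ i" for i
    using step[of 0] T_pos by simp
  then have comp: "y q $ i = - y 0 $ i - d * xdot 0 $ i" for i by simp
  have "y (q * 1) $ 1 = - y (q * 0) $ 1 - (d / of_real (q\<^sup>2)) * of_real (\<phi> 0)"
    "of_real q * y (q * 1) $ 2 = - (of_real q * y (q * 0) $ 2) - (d / of_real (q\<^sup>2)) * of_real (\<phi>' 0)"
    using q_pos unfolding xdot_\<phi> mult_1_right mult_zero_right comp
    by (simp_all add: power2_eq_square power3_eq_cube algebra_simps)
  ultimately have "of_real \<kappa> * (of_nat n * d) = 0"
    by (rule no_resonant_forcing)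
  then have "c = 0" using \<open>\<kappa> \<noteq> 0\<close> n_ge by (simp add: d_def)
  then show ?thesis using c[OF t] by simp
qed

text \<open>The kernels of the powers of \<open>\<Delta>\<close> stabilise at the first power, whose
  kernel consists of the multiples of \<open>xdot\<close>.\<close>

lemma generalized_eigenspace_one:
  assumes "no_unstable_multiplier" and small: "10 * 400 ^ 4 * \<bar>\<alpha> * q\<^sup>2\<bar> < 1" and "\<kappa> \<noteq> 0"
  shows "generalized_eigenspace \<alpha> \<kappa> T n (2 * q) x 1 = cfun.span {hist xdot}"
proof (intro equalityI subsetI)
  fix \<eta> assume \<eta>: "\<eta> \<in> generalized_eigenspace \<alpha> \<kappa> T n (2 * q) x 1"
  then have "\<eta> \<in> phase_space T" by (simp add: generalized_eigenspace_def)
  then obtain y where y: "dde y" "\<eta> = hist y" by (rule phase_space_hist)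
  obtain k where k: "\<forall>t\<ge>-T. (\<Delta> ^^ k) y t = 0" using \<eta> generalized_eigenspace_iff[OF y(1)] y(2) by blast
  have "(\<forall>t\<ge>-T. (\<Delta> ^^ k) y t = 0) \<Longrightarrow> dde y \<Longrightarrow> \<forall>t\<ge>-T. \<Delta> y t = 0" for y k
  proof (induction k arbitrary: y)
    case 0
    then show ?case using q_pos by (simp add: \<Delta>_def)
  next
    case (Suc k)
    have "\<forall>t\<ge>-T. \<Delta> (\<Delta> y) t = 0"
      using Suc.IH[of "\<Delta> y"] Suc.prems dde_\<Delta> by (simp add: funpow_swap1)
    then show ?case using no_jordan_block[OF assms Suc.prems(2)] by blast
  qed
  from this[OF k y(1)] obtain c where "\<forall>t\<ge>-T. y t = c *s xdot t"
    using \<Delta>_kernel[OF assms(1) small y(1)] by blast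
  then have "\<eta> = cscale c (hist xdot)"
    unfolding y(2) hist_smult by (intro hist_cong) simp
  then show "\<eta> \<in> cfun.span {hist xdot}" unfolding cfun.span_singleton by blast
next
  fix \<eta> assume "\<eta> \<in> cfun.span {hist xdot}"
  then obtain c where "\<eta> = hist (\<lambda>t. c *s xdot t)" by (auto simp: cfun.span_singleton hist_smult)
  moreover have "\<forall>t\<ge>-T. (\<Delta> ^^ 1) (\<lambda>t. c *s xdot t) t = 0"
    by (simp add: \<Delta>_def xdot_shift_period)
  ultimately show "\<eta> \<in> generalized_eigenspace \<alpha> \<kappa> T n (2 * q) x 1"
    using generalized_eigenspace_iff[OF dde_smult[OF xdot_dde]] by blast
qed

lemma hist_xdot_nonzero: "hist xdot \<noteq> 0"
  using hist_zero_iff[OF xdot_dde] xdot_nonzero T_pos by force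

lemma multiplier_inside:
  assumes "no_unstable_multiplier" "floquet_multiplier \<alpha> \<kappa> T n (2 * q) x \<mu>" "\<mu> \<noteq> 1"
  shows "norm \<mu> < 1"
proof (rule ccontr)
  assume "\<not> ?thesis"
  obtain y where y: "dde y" "\<exists>t\<ge>-T. y t \<noteq> 0" "\<And>t. t \<ge> -T \<Longrightarrow> y (t + 2 * q) = \<mu> *s y t"
    using assms(2) unfolding floquet_multiplier_iff by blast
  obtain \<nu> z where z: "\<nu>\<^sup>2 = \<mu>" "dde z" "\<exists>t\<ge>-T. z t \<noteq> 0" "\<And>t. t \<ge> -T \<Longrightarrow> z (t + q) = (- \<nu>) *s z t"
    using half_period_multiplier[OF y] by blast
  have "(norm \<nu>)\<^sup>2 \<ge> 1" using \<open>\<not> norm \<mu> < 1\<close> z(1) by (simp flip: norm_power)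
  then have "norm \<nu> \<ge> 1" using power2_le_imp_le[of 1 "norm \<nu>"] by simp
  moreover have "\<nu> \<noteq> 1" using z(1) \<open>\<mu> \<noteq> 1\<close> by auto
  ultimately show False using no_unstable_shift[OF assms(1) z(2,4)] z(3) by blast
qed

lemma linearly_stable_orbit:
  assumes "no_unstable_multiplier" and "10 * 400 ^ 4 * \<bar>\<alpha> * q\<^sup>2\<bar> < 1" and "\<kappa> \<noteq> 0"
  shows "linearly_stable \<alpha> \<kappa> T n (2 * q) x"
proof -
  have "cfun.independent {hist xdot}" using hist_xdot_nonzero by simp
  then have "cfun.dim (cfun.span {hist xdot}) = card {hist xdot}"
    by (rule cfun.dim_span_eq_card_independent)
  then show ?thesis
    unfolding linearly_stable_def algebraically_simple_def generalized_eigenspace_one[OF assms]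
    using floquet_multiplier_one multiplier_inside[OF assms(1)] by simp
qed

lemma not_linearly_unstable_orbit:
  assumes "no_unstable_multiplier"
  shows "\<not> linearly_unstable \<alpha> \<kappa> T n (2 * q) x"
  unfolding linearly_unstable_def using multiplier_inside[OF assms] by force

section \<open>Eigenfunctions built from Hill solutions: the cases \<kappa> > 0 and \<kappa> =
  0\<close>

lemma ode_continuous: "ode \<beta> y \<Longrightarrow> continuous_on {0..} y"
  by (rule continuous_on_vector_derivative[where f'="\<lambda>t. sys \<beta> 0 t (y t) 0"]) (simp add: ode_def)

text \<open>Solutions of the ordinary equation are given for t \<ge> 0 only; moved back by T, their
  first piece of length T serves as history. The assumption says that the delayed term amounts to a
  change of the parameter to \<beta>.\<close>

lemma ode_imp_dde:
  assumes y: "ode \<beta> y"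
    and eq: "\<And>t. t \<ge> 0 \<Longrightarrow> stiffness (of_real \<kappa>) t * y (t + T) $ 1 + delay_gain * y t $ 1 = stiffness \<beta> t * y (t + T) $ 1"
  shows "dde (\<lambda>t. y (t + T))"
  unfolding dde_def
proof (intro conjI allI impI)
  show "continuous_on {-T..} (\<lambda>t. y (t + T))"
    by (intro continuous_on_compose2[OF ode_continuous[OF y]] continuous_intros) auto
  fix t :: real assume "t \<ge> 0"
  then have "(y has_vector_derivative sys \<beta> 0 (t + T) (y (t + T)) 0) (at (t + T) within {0..})"
    using y T_pos unfolding ode_def by simp
  from has_vector_derivative_shift[OF this \<open>t \<ge> 0\<close> T_pos]
  show "((\<lambda>t. y (t + T)) has_vector_derivative
      sys (of_real \<kappa>) delay_gain t (y (t + T)) (y (t - T + T))) (at t within {0..})"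
    using eq[OF \<open>t \<ge> 0\<close>] by (simp add: second_order_system_def stiffness_shift_T)
qed

lemma ode_zero:
  assumes w: "ode \<beta> w" and "w 0 = 0" "t \<ge> 0"
  shows "w t = 0"
proof -
  have "(vector [0, 0] :: complex ^ 2) = 0" by (simp add: vector_2_eq_iff)
  then have zero: "ode \<beta> (\<lambda>_. 0)"
    by (simp add: ode_def second_order_system_def has_vector_derivative_const)
  have "w t = (\<lambda>_. 0) t"
    by (rule ode_unique[where c=t and \<beta>=\<beta>, OF ode_on_interval[OF w] ode_on_interval[OF zero]])
      (use assms in auto)
  then show ?thesis .
qed

text \<open>The real Hill solution with \<nu> > 1 is continued by the ordinary equation. The
  relation y(t + q) = -\<nu> y(t) holds at t = 0 and propagates by uniqueness, which turns the
  instantaneous term back into the delayed one. The multiplier is \<nu>^2.\<close>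

lemma linearly_unstable_orbit:
  assumes "\<kappa> > 0" "1000 * 400 ^ 8 * (\<kappa> * q\<^sup>2) \<le> 1" "100 * 400 ^ 4 * \<bar>\<alpha> * q\<^sup>2\<bar> \<le> 1"
  shows "linearly_unstable \<alpha> \<kappa> T n (2 * q) x"
proof -
  have "0 < \<kappa> * q\<^sup>2" using assms q_pos by simp
  from unstable_multiplier_exists[OF this assms(2,3) n_ge]
  obtain \<nu> :: real and yh vh where \<nu>: "\<nu> > 1"
    and sol: "hill_solution (\<alpha> * q\<^sup>2) u (\<kappa> * q\<^sup>2 * (1 - inverse \<nu> ^ n)) (\<lambda>_. 0) yh vh"
    and bd: "yh 1 = - \<nu> * yh 0" "vh 1 = - \<nu> * vh 0" "yh 0 \<noteq> 0 \<or> vh 0 \<noteq> (0::real)"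
    by metis
  define \<beta> where "\<beta> = \<kappa> * (1 - inverse \<nu> ^ n)"
  have "hill_solution (\<alpha> * q\<^sup>2) u (q\<^sup>2 * \<beta>) (\<lambda>_. 0) yh vh" using sol by (simp add: \<beta>_def mult_ac)
  then obtain y where y: "ode (of_real \<beta>) y"
    "\<And>t. t \<in> {0..q} \<Longrightarrow> y t = vector [of_real (yh (t / q)), of_real (vh (t / q) / q)]"
    using from_hill by blast
  have y0: "y q = (- of_real \<nu>) *s y 0" "y 0 \<noteq> 0"
    using y(2)[of 0] y(2)[of q] q_pos bd by (auto simp: vector_2_eq_iff)
  define w where "w t = 1 *s y (t + q) + of_real \<nu> *s y t" for t
  have w: "ode (of_real \<beta>) w" unfolding w_def by (intro ode_lincomb ode_shift y)
  have "w t = 0" if "t \<ge> 0" for t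
    by (rule ode_zero[OF w _ that]) (use y0(1) in \<open>simp add: w_def vector_2_eq_iff\<close>)
  then have shift: "y (t + q) = (- of_real \<nu>) *s y t" if "t \<ge> 0" for t
    using that by (auto simp: w_def vector_2_eq_iff add_eq_0_iff)
  have "dde (\<lambda>t. y (t + T))"
  proof (rule ode_imp_dde[OF y(1)])
    fix t :: real assume "t \<ge> 0"
    have "y (t + real n * q) = (- of_real \<nu>) ^ n *s y t" by (rule iterate_shift[where r=0]) (use shift \<open>t \<ge> 0\<close> in auto)
    then have "y (t + T) $ 1 = (- 1) ^ n * of_real \<nu> ^ n * y t $ 1"
      by (simp add: T_eq power_minus[of "of_real \<nu>"])
    moreover have "(- 1) ^ n * ((- 1) ^ n * z) = z" for z :: complex
      by (simp flip: mult.assoc power_mult_distrib)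
    ultimately have "delay_gain * y t $ 1 = - of_real (\<kappa> * inverse \<nu> ^ n) * y (t + T) $ 1"
      using \<nu> by (simp add: delay_gain_def power_inverse mult.assoc mult.left_commute[of "inverse _"])
    then show "stiffness (of_real \<kappa>) t * y (t + T) $ 1 + delay_gain * y t $ 1 = stiffness (of_real \<beta>) t * y (t + T) $ 1"
      by (simp add: stiffness_def \<beta>_def algebra_simps)
  qed
  moreover have "y (t + 2 * q + T) = of_real (\<nu>\<^sup>2) *s y (t + T)" if "t \<ge> - T" for t
  proof -
    have "y ((t + T + q) + q) = of_real (\<nu>\<^sup>2) *s y (t + T)"
      using shift[of "t + T + q"] shift[of "t + T"] that q_pos by (simp add: vector_2_eq_iff power2_eq_square)
    then show ?thesis by (simp add: algebra_simps)
  qed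
  moreover have "\<exists>t\<ge>-T. y (t + T) \<noteq> 0" using y0(2) by (intro exI[of _ "- T"]) auto
  ultimately have "floquet_multiplier \<alpha> \<kappa> T n (2 * q) x (of_real (\<nu>\<^sup>2))"
    unfolding floquet_multiplier_iff using \<nu> by auto
  moreover have "norm (complex_of_real (\<nu>\<^sup>2)) > 1" using \<nu> by (simp add: norm_power one_less_power)
  ultimately show ?thesis unfolding linearly_unstable_def by blast
qed

lemma no_unstable_multiplier_uncontrolled:
  assumes "\<kappa> = 0"
  shows "no_unstable_multiplier"
  unfolding no_unstable_multiplier_def
proof (intro allI impI ballI, elim conjE)
  fix \<nu> :: complex and y v s
  assume "hill_solution (\<alpha> * q\<^sup>2) u (of_real (\<kappa> * q\<^sup>2) * (1 - inverse \<nu> ^ n)) (\<lambda>_. 0) y v"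
  then have "hill_solution (\<alpha> * q\<^sup>2) u 0 (\<lambda>_. 0) y v" using assms by simp
  then show "\<nu> \<noteq> 1 \<Longrightarrow> y 1 = - \<nu> * y 0 \<Longrightarrow> v 1 = - \<nu> * v 0 \<Longrightarrow> s \<in> {0..1} \<Longrightarrow> y s = 0"
    by (rule no_other_multiplier_zero_parameter)
qed

text \<open>Without control the solution with P = 1 and R = 0, a perturbation of a multiple of
  \<open>\<psi>\<close>, is killed by the square of \<open>\<Delta>\<close>. It is independent of
  \<open>xdot\<close> because \<open>P\<close> vanishes on multiples of \<open>\<phi>\<close>, so a
  second dimension appears whether or not the chain is genuine.\<close>

lemma generalized_eigenspace_uncontrolled:
  assumes "\<kappa> = 0"
  shows "cfun.dim (generalized_eigenspace \<alpha> \<kappa> T n (2 * q) x 1) \<noteq> 1"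
proof -
  obtain yh vh :: "real \<Rightarrow> real" where sol: "hill_solution (\<alpha> * q\<^sup>2) u 0 (\<lambda>_. 0) yh vh"
    and PR: "P yh vh 0 = 1" "R yh vh 0 = 0"
    using hill_exists[of 0 1 0] by blast
  define c where "c = R yh vh 0 + P yh vh 0 / D 0 - R yh vh 1"
  have "P yh vh 1 = P yh vh 0" by (rule homogeneous_zero_parameter(1)[OF sol]) simp
  then have bd: "yh 1 = - yh 0 - c * \<phi> 0" "vh 1 = - vh 0 - c * \<phi>' 0"
    using boundary_iff[of yh 1 c vh] by (simp_all add: c_def)
  obtain y where y: "ode (of_real 0) y"
    "\<And>t. t \<in> {0..q} \<Longrightarrow> y t = vector [of_real (yh (t / q)), of_real (vh (t / q) / q)]"
    using from_hill[of 0 yh vh] sol by auto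
  define d where "d = of_real (c * q\<^sup>2) * (1 :: complex)"
  have y0: "y 0 = vector [of_real (yh 0), of_real (vh 0 / q)]" "y q = (- 1) *s y 0 + (- d) *s xdot 0"
  proof -
    show y0: "y 0 = vector [of_real (yh 0), of_real (vh 0 / q)]" using y(2)[of 0] q_pos by simp
    have yq: "y q = vector [of_real (yh 1), of_real (vh 1 / q)]" using y(2)[of q] q_pos by simp
    have "of_real (yh 1) = - of_real (yh 0) - of_real c * (of_real (q\<^sup>2) * xdot (q * 0) $ 1)"
      unfolding xdot_\<phi>[symmetric] bd by simp
    moreover have "of_real (vh 1 / q) = - of_real (vh 0 / q) - of_real c * (of_real (q ^ 3) * xdot (q * 0) $ 2) / of_real q"
      unfolding xdot_\<phi>[symmetric] bd by (simp add: diff_divide_distrib)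
    ultimately show "y q = (- 1) *s y 0 + (- d) *s xdot 0"
      unfolding y0 yq using q_pos by (simp add: vector_2_eq_iff d_def power2_eq_square power3_eq_cube)
  qed
  define w where "w t = 1 *s (1 *s y (t + q) + 1 *s y t) + d *s xdot t" for t
  have w: "ode 0 w" unfolding w_def using y by (intro ode_lincomb ode_shift xdot_ode) auto
  have w0: "w t = 0" if "t \<ge> 0" for t
    by (rule ode_zero[OF w _ that]) (use y0(2) in \<open>simp add: w_def vector_2_eq_iff\<close>)
  have shift: "y (t + q) = (- 1) *s y t + (- d) *s xdot t" if "t \<ge> 0" for t
  proof -
    have "y (t + q) + (y t + d *s xdot t) = 0" using w0[OF that] by (simp add: w_def vector_2_eq_iff add.assoc)
    then have "y (t + q) = - (y t + d *s xdot t)" by (simp only: eq_neg_iff_add_eq_0)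
    then show ?thesis by (simp add: vector_2_eq_iff)
  qed
  define z where "z t = y (t + T)" for t
  have z: "dde z"
    unfolding z_def
  proof (rule ode_imp_dde[OF y(1)])
    have "delay_gain = 0" by (simp add: delay_gain_def) (simp add: assms)
    then have "delay_gain * v = 0" for v by simp
    then show "stiffness (of_real \<kappa>) t * y (t + T) $ 1 + delay_gain * y t $ 1 = stiffness (of_real 0) t * y (t + T) $ 1" for t
      by (simp only: add_0_right) (simp add: assms)
  qed
  have \<Delta>z: "\<Delta> z t = (2 * d) *s xdot (t + T)" if "t \<ge> - T" for t
  proof -
    have "y ((t + T + q) + q) = y (t + T) + (2 * d) *s xdot (t + T)"
      using shift[of "t + T + q"] shift[of "t + T"] that q_pos by (simp add: vector_2_eq_iff xdot_shift)
    then show ?thesis by (simp add: \<Delta>_def z_def algebra_simps)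
  qed
  have "\<forall>t\<ge>-T. (\<Delta> ^^ 2) z t = 0"
  proof (intro allI impI)
    fix t assume "t \<ge> - T"
    then have "\<Delta> z (t + 2 * q) = (2 * d) *s xdot ((t + T) + 2 * q)" "\<Delta> z t = (2 * d) *s xdot (t + T)"
      using \<Delta>z[of "t + 2 * q"] \<Delta>z[of t] q_pos by (simp_all add: algebra_simps)
    then show "(\<Delta> ^^ 2) z t = 0"
      by (simp add: numeral_2_eq_2 xdot_shift_period) (simp add: \<Delta>_def[of "\<Delta> z"])
  qed
  then have z_in: "hist z \<in> generalized_eigenspace \<alpha> \<kappa> T n (2 * q) x 1"
    using generalized_eigenspace_iff[OF z] by blast
  have "\<forall>t\<ge>-T. (\<Delta> ^^ 1) xdot t = 0"
    by (simp add: \<Delta>_def xdot_shift_period)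
  then have x_in: "hist xdot \<in> generalized_eigenspace \<alpha> \<kappa> T n (2 * q) x 1"
    using generalized_eigenspace_iff[OF xdot_dde] by blast
  have indep: "hist z \<noteq> cscale a (hist xdot)" for a
  proof
    assume "hist z = cscale a (hist xdot)"
    then have "z (- T) = a *s xdot (- T)"
      unfolding hist_smult hist_eq_iff[OF z dde_smult[OF xdot_dde]] using T_pos by blast
    moreover have "xdot 0 = (- 1) ^ n *s xdot (- T)" using xdot_shift_T[of "- T"] by simp
    moreover have "(- 1) ^ n * ((- 1) ^ n * z) = z" for z :: complex
      by (simp flip: mult.assoc power_mult_distrib)
    ultimately have "y 0 = (a * (- 1) ^ n) *s xdot 0"
      by (simp add: z_def vector_2_eq_iff mult.assoc)
    then obtain e where e: "y 0 = e *s xdot 0" by blast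
    have "of_real (P yh vh 0) = of_real (\<phi> 0) * (of_real q * y 0 $ 2) - of_real (\<phi>' 0) * y 0 $ 1"
      using q_pos by (simp add: P_def y0(1))
    also have "\<dots> = 0"
      unfolding e xdot_\<phi> by (simp add: power2_eq_square power3_eq_cube)
    finally show False by (simp add: PR)
  qed
  show ?thesis
  proof
    assume dim: "cfun.dim (generalized_eigenspace \<alpha> \<kappa> T n (2 * q) x 1) = 1"
    obtain B where B: "generalized_eigenspace \<alpha> \<kappa> T n (2 * q) x 1 \<subseteq> cfun.span B" "card B = 1"
      using cfun.basis_exists[of "generalized_eigenspace \<alpha> \<kappa> T n (2 * q) x 1"] dim by metis
    obtain b where "B = {b}" using B(2) by (auto simp: card_1_singleton_iff)
    then obtain r s where r: "hist z = cscale r b" and s: "hist xdot = cscale s b"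
      using B(1) z_in x_in unfolding \<open>B = {b}\<close> cfun.span_singleton by blast
    have "s \<noteq> 0" using s hist_xdot_nonzero by auto
    then have "hist z = cscale (r / s) (hist xdot)" unfolding r s by simp
    then show False using indep by blast
  qed
qed

lemma not_linearly_stable_uncontrolled:
  "\<kappa> = 0 \<Longrightarrow> \<not> linearly_stable \<alpha> \<kappa> T n (2 * q) x"
  using generalized_eigenspace_uncontrolled by (simp add: linearly_stable_def algebraically_simple_def)

lemma not_stable_if_unstable:
  "linearly_unstable \<alpha> \<kappa> T n (2 * q) x \<Longrightarrow> \<not> linearly_stable \<alpha> \<kappa> T n (2 * q) x"
  unfolding linearly_stable_def linearly_unstable_def by force

lemma orbit_controlled_solution: "controlled_solution \<alpha> \<kappa> T n x"
proof -
  have iter: "x (t + real j * q) = (- 1) ^ j * x t" for t j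
  proof (induction j)
    case (Suc j)
    have "x (t + real (Suc j) * q) = x ((t + real j * q) + q)" by (simp add: algebra_simps)
    then show ?case using Suc by (simp add: x_anti)
  qed simp
  have zero: "x t - (- 1) ^ n * x (t - T) = 0" for t
    using iter[of "t - T" n] by (simp add: T_eq)
  show ?thesis unfolding controlled_solution_def zero using x_sol by (simp add: duffing_solution_def)
qed

end

section \<open>Stability for large n\<close>

text \<open>The bounds on the half period confine the rescaled amplitude a: pi^2 \<le> \<epsilon> +
  a^2 and \<epsilon> + a^2/2 \<le> pi^2. With 3 < pi < 4 and |\<epsilon>| \<le> 1 this gives
  numerical constants independent of the orbit.\<close>

lemma duffing_orbit_scaled_hill:
  assumes orbit: "duffing_periodic_orbit \<alpha> (2 * q) x" and small: "\<bar>\<alpha> * q\<^sup>2\<bar> \<le> 1"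
  shows "q > 0" "x (t + q) = - x t" "hill (\<alpha> * q\<^sup>2) 400 (\<lambda>t. q * x (q * t))"
proof -
  obtain A s where amp: "duffing_amplitude \<alpha> A" and q: "2 * q = 2 * half_period \<alpha> A"
    and x_eq: "\<And>t. x t = duffing_orbit \<alpha> A (t + s)"
    using duffing_periodic_orbit_classification[OF orbit] by blast
  interpret duffing_amplitude \<alpha> A by (rule amp)
  have q_eq: "q = \<rho>" using q by simp
  show q_pos: "q > 0" using \<rho>_pos q_eq by simp
  have x_anti: "x (t + q) = - x t" for t
    using orbit_antiperiodic[of "t + s"] by (simp add: x_eq q_eq algebra_simps)
  then show "x (t + q) = - x t" .
  have x_sol: "duffing_solution \<alpha> x" using orbit by (simp add: duffing_periodic_orbit_def)
  define u where "u t = q * x (q * t)" for t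
  define \<epsilon> where "\<epsilon> = \<alpha> * q\<^sup>2"
  define a where "a = A * q"
  have u_sol: "duffing_solution \<epsilon> u" and u_deriv: "deriv u = (\<lambda>t. q\<^sup>2 * deriv x (q * t))"
    using duffing_affine[OF x_sol, of q 0] by (simp_all add: u_def[abs_def] \<epsilon>_def)
  have x_energy: "hamiltonian \<alpha> (x t) (deriv x t) = \<alpha> * A\<^sup>2 / 2 + A ^ 4 / 4" for t
  proof -
    have x_fun: "x = (\<lambda>t. X (t + s))" by (rule ext) (rule x_eq)
    have "deriv x = (\<lambda>t. deriv X (t + s))"
      unfolding x_fun using duffing_affine(2)[OF orbit_solution, of 1 s] by simp
    then show ?thesis using orbit_hamiltonian[of "t + s"] by (simp add: x_eq)
  qed
  define h where "h = \<epsilon> * a\<^sup>2 / 2 + a ^ 4 / 4"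
  have energy: "hamiltonian \<epsilon> (u t) (deriv u t) = h" for t
  proof -
    have "hamiltonian \<epsilon> (u t) (deriv u t) = q ^ 4 * hamiltonian \<alpha> (x (q * t)) (deriv x (q * t))"
      by (simp add: hamiltonian_def u_deriv u_def \<epsilon>_def power_mult_distrib algebra_simps
          power2_eq_square power4_eq_xxxx)
    also have "\<dots> = h"
      unfolding x_energy by (simp add: h_def \<epsilon>_def a_def power_mult_distrib algebra_simps
          power2_eq_square power4_eq_xxxx)
    finally show ?thesis .
  qed
  have pos: "\<alpha> + A\<^sup>2 > 0" using \<alpha>A_pos zero_le_power2[of A] by linarith
  have "pi \<le> q * sqrt (\<alpha> + A\<^sup>2)" "q * sqrt (\<alpha> + A\<^sup>2 / 2) \<le> pi"
    using half_period_bounds pos \<alpha>A_pos by (simp_all add: q_eq field_simps)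
  then have "pi\<^sup>2 \<le> (q * sqrt (\<alpha> + A\<^sup>2))\<^sup>2" "(q * sqrt (\<alpha> + A\<^sup>2 / 2))\<^sup>2 \<le> pi\<^sup>2"
    using q_pos pi_gt_zero \<alpha>A_pos by (intro power_mono; simp)+
  then have pi2: "pi\<^sup>2 \<le> \<epsilon> + a\<^sup>2" "\<epsilon> + a\<^sup>2 / 2 \<le> pi\<^sup>2"
    using pos \<alpha>A_pos by (simp_all add: power_mult_distrib \<epsilon>_def a_def algebra_simps)
  have "pi > 3" by (rule pi_gt3)
  then have "3\<^sup>2 \<le> pi\<^sup>2" by (intro power_mono) auto
  moreover have "pi\<^sup>2 \<le> 4\<^sup>2" using pi_less_4 pi_gt_zero by (intro power_mono) auto
  moreover have \<epsilon>: "\<bar>\<epsilon>\<bar> \<le> 1" using small by (simp add: \<epsilon>_def)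
  \<comment> \<open>These bounds give h \<le> 34/2 + 34^2/4 = 306, a Wronskian of at least 6 a^2 -
    a^2, and, from h \<le> 400, a squared velocity of at most 2 h + a^2 < 900.\<close>
  ultimately have a2: "8 \<le> a\<^sup>2" "a\<^sup>2 \<le> 34" using pi2 by auto
  have a4: "a ^ 4 = a\<^sup>2 * a\<^sup>2" by (simp add: power2_eq_square power4_eq_xxxx)
  have \<epsilon>_mult: "\<bar>\<epsilon> * z\<bar> \<le> z" if "z \<ge> 0" for z
    using mult_right_mono[OF \<epsilon> that] that by (simp add: abs_mult)
  have "a\<^sup>2 * a\<^sup>2 \<le> 34 * 34" "8 * a\<^sup>2 \<le> a\<^sup>2 * a\<^sup>2" using a2 by (intro mult_mono mult_right_mono; simp)+
  then have h_bounds: "4 * h \<ge> 6 * a\<^sup>2" "h \<le> 400"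
    using \<epsilon>_mult[of "a\<^sup>2"] a2 unfolding h_def a4 by (auto simp: abs_le_iff)
  have u2: "(u t)\<^sup>2 \<le> a\<^sup>2" for t
  proof -
    have "\<bar>x (q * t)\<bar> \<le> A" using A_pos by (simp add: x_eq duffing_orbit_def abs_mult)
    then have "\<bar>u t\<bar> \<le> \<bar>a\<bar>" using q_pos A_pos by (simp add: u_def a_def abs_mult mult.commute)
    then show ?thesis by (simp add: abs_le_square_iff)
  qed
  have u_le: "\<bar>u t\<bar> \<le> 6" for t
  proof -
    have "(u t)\<^sup>2 \<le> 6\<^sup>2" using u2[of t] a2 by simp
    then show ?thesis using abs_le_square_iff[of "u t" 6] by simp
  qed
  have \<epsilon>u: "\<bar>\<epsilon> * (u t)\<^sup>2\<bar> \<le> a\<^sup>2" for t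
    using \<epsilon>_mult[of "(u t)\<^sup>2"] u2[of t] by simp
  have du_le: "\<bar>deriv u t\<bar> \<le> 30" for t
  proof -
    have "(deriv u t)\<^sup>2 = 2 * h - \<epsilon> * (u t)\<^sup>2 - (u t) ^ 4 / 2"
      using energy[of t] by (simp add: hamiltonian_def field_simps)
    moreover have "(u t) ^ 4 \<ge> 0" by simp
    moreover have "- (\<epsilon> * (u t)\<^sup>2) \<le> a\<^sup>2" using \<epsilon>u[of t] by (simp add: abs_le_iff)
    ultimately have "(deriv u t)\<^sup>2 \<le> 900" using h_bounds(2) a2 by linarith
    then show ?thesis using abs_le_square_iff[of "deriv u t" 30] by simp
  qed
  have "hill \<epsilon> 400 u"
  proof
    show "duffing_solution \<epsilon> u" by (rule u_sol)
    show "u (t + 1) = - u t" for t using x_anti[of "q * t"] by (simp add: u_def algebra_simps)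
    show "\<bar>u t\<bar> \<le> 400" for t using u_le[of t] by simp
    show "\<bar>deriv u t\<bar> \<le> 400" for t using du_le[of t] by simp
    show "\<bar>u t + t * deriv u t\<bar> \<le> 400" if "t \<in> {0..1}" for t
    proof -
      have "\<bar>t * deriv u t\<bar> \<le> 1 * 30" unfolding abs_mult using that du_le by (intro mult_mono) auto
      then show ?thesis using u_le[of t] by linarith
    qed
    show "1 \<le> 4 * hamiltonian \<epsilon> (u 0) (deriv u 0) - \<epsilon> * (u t)\<^sup>2" for t
      using \<epsilon>u[of t] h_bounds(1) a2(1) unfolding energy abs_le_iff by linarith
    show "hamiltonian \<epsilon> (u 0) (deriv u 0) \<le> 400" unfolding energy by (rule h_bounds)
  qed (use \<epsilon> in auto)
  then show "hill (\<alpha> * q\<^sup>2) 400 (\<lambda>t. q * x (q * t))"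
    by (simp add: u_def[abs_def] \<epsilon>_def)
qed

text \<open>Failures for arbitrarily large n would supply a sequence that
  \<open>no_unstable_multiplier_sequence\<close> rules out. With K = \<kappa> T^2 / 3 the hypothesis
  on \<kappa> is exactly K > -pi^2/2.\<close>

lemma no_unstable_multiplier_eventually:
  assumes "T > 0" "\<kappa> < 0" "- \<kappa> * T\<^sup>2 < 3 / 2 * pi\<^sup>2"
  shows "\<forall>\<^sub>F n in sequentially. \<forall>q x. controlled_orbit \<alpha> T q n x \<longrightarrow>
    controlled_orbit.no_unstable_multiplier \<alpha> \<kappa> q n x"
proof (rule ccontr)
  assume "\<not> ?thesis"
  then have ex: "\<exists>n\<ge>N. \<exists>q x. controlled_orbit \<alpha> T q n x \<and>
      \<not> controlled_orbit.no_unstable_multiplier \<alpha> \<kappa> q n x" for N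
    by (auto simp: eventually_sequentially)
  \<comment> \<open>Since q = T / n, this bounds both |\<kappa> q^2| and |\<alpha> q^2| after
    multiplication by n^2.\<close>
  define k0 where "k0 = (\<bar>\<kappa>\<bar> + \<bar>\<alpha>\<bar>) * T\<^sup>2"
  have "k0 \<ge> 0" by (simp add: k0_def)
  define K where "K = \<kappa> * T\<^sup>2 / 3"
  define M where "M = 133 * 400 ^ 8 * k0\<^sup>2 + 74 * 400 ^ 6 * k0"
  have "M \<ge> 0" using \<open>k0 \<ge> 0\<close> by (simp add: M_def)
  have "\<exists>n (\<nu> :: complex). n \<ge> Suc j \<and> norm \<nu> \<ge> 1 \<and> norm ((\<nu> - 1) - \<nu> * of_real (K / (real n)\<^sup>2) * (\<Sum>i=1..n. inverse \<nu> ^ i))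
      \<le> M * (norm \<nu> + 1) / (real n)\<^sup>2" for j
  proof -
    define N where "N = max (Suc j) (nat \<lceil>16 * 400 ^ 4 * k0\<rceil>)"
    obtain n q x where n: "n \<ge> N" and orbit: "controlled_orbit \<alpha> T q n x"
      and bad: "\<not> controlled_orbit.no_unstable_multiplier \<alpha> \<kappa> q n x"
      using ex by blast
    interpret controlled_orbit \<alpha> \<kappa> T q n x by (rule orbit)
    from bad obtain \<nu> y v t0 where \<nu>: "norm \<nu> \<ge> 1" "\<nu> \<noteq> 1"
      and sol: "hill_solution (\<alpha> * q\<^sup>2) u (of_real (\<kappa> * q\<^sup>2) * (1 - inverse \<nu> ^ n)) (\<lambda>_. 0) y v"
      and bd: "y 1 = - \<nu> * y 0" "v 1 = - \<nu> * v 0" and t0: "t0 \<in> {0..1}" "y t0 \<noteq> (0 :: complex)"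
      unfolding no_unstable_multiplier_def by blast
    have n1: "n \<ge> Suc j" "16 * 400 ^ 4 * k0 \<le> real n" using n unfolding N_def by linarith+
    have q: "q\<^sup>2 = T\<^sup>2 / (real n)\<^sup>2" using T_eq n_ge by (simp add: power_mult_distrib)
    have k: "\<bar>\<kappa> * q\<^sup>2\<bar> \<le> k0 / (real n)\<^sup>2" "\<bar>\<alpha> * q\<^sup>2\<bar> \<le> k0 / (real n)\<^sup>2"
      by (simp_all add: q k0_def abs_mult divide_right_mono mult_right_mono)
    have "norm ((\<nu> - 1) - \<nu> * of_real (K / (real n)\<^sup>2) * (\<Sum>i=1..n. inverse \<nu> ^ i))
      = norm ((\<nu> - 1) - \<nu> * of_real (\<kappa> * q\<^sup>2) * (\<Sum>i=1..n. inverse \<nu> ^ i) / 3)"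
      by (simp add: K_def q mult_ac)
    also have "\<dots> \<le> (133 * 400 ^ 8 * k0\<^sup>2 * norm \<nu> + 74 * 400 ^ 6 * k0) / (real n)\<^sup>2"
      by (rule multiplier_estimate[OF sol bd t0 \<nu> k n_ge n1(2)])
    also have "\<dots> \<le> M * (norm \<nu> + 1) / (real n)\<^sup>2"
      using \<open>k0 \<ge> 0\<close> by (intro divide_right_mono) (auto simp: M_def algebra_simps)
    finally show ?thesis using \<nu>(1) n1(1) by (intro exI[of _ n] exI[of _ \<nu>] conjI)
  qed
  then obtain n :: "nat \<Rightarrow> nat" and \<nu> :: "nat \<Rightarrow> complex" where seq: "\<And>j. n j \<ge> Suc j" "\<And>j. norm (\<nu> j) \<ge> 1"
    "\<And>j. norm ((\<nu> j - 1) - \<nu> j * of_real (K / (real (n j))\<^sup>2) * (\<Sum>i=1..n j. inverse (\<nu> j) ^ i))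
      \<le> M * (norm (\<nu> j) + 1) / (real (n j))\<^sup>2"
    by metis
  have K: "- (pi\<^sup>2 / 2) < K" "K < 0" using assms by (auto simp: K_def mult_neg_pos)
  show False by (rule no_unstable_multiplier_sequence[OF K \<open>M \<ge> 0\<close> seq(1,2)]) (use seq(3) in \<open>simp only: of_nat_power\<close>)
qed

lemma eventually_mult_inverse_power_less:
  fixes c T d :: real
  assumes "d > 0" "m > 0"
  shows "\<forall>\<^sub>F n in sequentially. c * (T / real n) ^ m < d"
proof -
  have "(\<lambda>n. c * (T / real n) ^ m) \<longlonglongrightarrow> c * 0 ^ m"
    by (intro tendsto_intros lim_const_over_n)
  then have "(\<lambda>n. c * (T / real n) ^ m) \<longlonglongrightarrow> 0" using assms by (simp add: zero_power)
  then show ?thesis by (rule order_tendstoD(2)) fact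
qed

theorem corollary1p3:
  fixes \<alpha> \<kappa> T :: real
  assumes "T > 0" and "- \<kappa> * T\<^sup>2 < 3 / 2 * pi\<^sup>2"
  shows "\<exists>n0::nat. real n0 > 1 / pi * T * sqrt (max 0 \<alpha>) \<and>
    (\<forall>n\<ge>n0.
       (\<exists>x. duffing_periodic_orbit \<alpha> (2 * T / real n) x) \<and>
       (\<forall>x z. duffing_periodic_orbit \<alpha> (2 * T / real n) x \<and>
              duffing_periodic_orbit \<alpha> (2 * T / real n) z \<longrightarrow> (\<exists>s. \<forall>t. z t = x (t + s))) \<and>
       (\<forall>x. duffing_periodic_orbit \<alpha> (2 * T / real n) x \<longrightarrow>
              controlled_solution \<alpha> \<kappa> T n x \<and>
              minimal_period (2 * T / real n) x \<and>
              (linearly_stable \<alpha> \<kappa> T n (2 * T / real n) x \<longleftrightarrow> \<kappa> < 0) \<and>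
              (linearly_unstable \<alpha> \<kappa> T n (2 * T / real n) x \<longleftrightarrow> \<kappa> > 0)))"
proof -
  have no_unstable: "\<forall>\<^sub>F n in sequentially. \<kappa> < 0 \<longrightarrow> (\<forall>q x. controlled_orbit \<alpha> T q n x \<longrightarrow>
      controlled_orbit.no_unstable_multiplier \<alpha> \<kappa> q n x)"
    using no_unstable_multiplier_eventually[of T \<kappa> \<alpha>] assms by (cases "\<kappa> < 0") auto
  \<comment> \<open>Each requirement on n holds for all large n, the smallness conditions because q
    = T / n tends to 0; \<open>n0\<close> is chosen to meet them all.\<close>
  have "\<forall>\<^sub>F n in sequentially. 1 / pi * T * sqrt (max 0 \<alpha>) < real n"
    using filterlim_real_sequentially by (simp add: filterlim_at_top_dense)
  moreover have "\<forall>\<^sub>F n in sequentially. sqrt (3 * \<bar>\<alpha>\<bar> + 1) * (T / real n) ^ 1 < pi"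
    by (intro eventually_mult_inverse_power_less) auto
  moreover have "\<forall>\<^sub>F n in sequentially. (100 * 400 ^ 4 * \<bar>\<alpha>\<bar>) * (T / real n) ^ 2 < 1"
    by (intro eventually_mult_inverse_power_less) auto
  moreover have "\<forall>\<^sub>F n in sequentially. (1000 * 400 ^ 8 * \<kappa>) * (T / real n) ^ 2 < 1"
    by (intro eventually_mult_inverse_power_less) auto
  moreover note no_unstable eventually_ge_at_top[of "1::nat"]
  ultimately have "\<forall>\<^sub>F n in sequentially. 1 / pi * T * sqrt (max 0 \<alpha>) < real n \<and> n \<ge> 1 \<and>
      sqrt (3 * \<bar>\<alpha>\<bar> + 1) * (T / real n) < pi \<and> (100 * 400 ^ 4 * \<bar>\<alpha>\<bar>) * (T / real n)\<^sup>2 < 1 \<and>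
      (1000 * 400 ^ 8 * \<kappa>) * (T / real n)\<^sup>2 < 1 \<and>
      (\<kappa> < 0 \<longrightarrow> (\<forall>q x. controlled_orbit \<alpha> T q n x \<longrightarrow> controlled_orbit.no_unstable_multiplier \<alpha> \<kappa> q n x))"
    by eventually_elim simp
  then obtain n0 where n0: "\<And>n. n \<ge> n0 \<Longrightarrow> 1 / pi * T * sqrt (max 0 \<alpha>) < real n"
    "\<And>n. n \<ge> n0 \<Longrightarrow> n \<ge> 1" "\<And>n. n \<ge> n0 \<Longrightarrow> sqrt (3 * \<bar>\<alpha>\<bar> + 1) * (T / real n) < pi"
    "\<And>n. n \<ge> n0 \<Longrightarrow> (100 * 400 ^ 4 * \<bar>\<alpha>\<bar>) * (T / real n)\<^sup>2 < 1"
    "\<And>n. n \<ge> n0 \<Longrightarrow> (1000 * 400 ^ 8 * \<kappa>) * (T / real n)\<^sup>2 < 1"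
    "\<And>n q x. n \<ge> n0 \<Longrightarrow> \<kappa> < 0 \<Longrightarrow> controlled_orbit \<alpha> T q n x \<Longrightarrow> controlled_orbit.no_unstable_multiplier \<alpha> \<kappa> q n x"
    unfolding eventually_sequentially by blast
  show ?thesis
  proof (intro exI[of _ n0] conjI allI impI)
    show "1 / pi * T * sqrt (max 0 \<alpha>) < real n0" by (rule n0) simp
    fix n assume n: "n \<ge> n0"
    define q where "q = T / real n"
    have q: "q > 0" "T = real n * q" "2 * T / real n = 2 * q"
      using n0(2)[OF n] \<open>T > 0\<close> by (simp_all add: q_def)
    show "\<exists>x. duffing_periodic_orbit \<alpha> (2 * T / real n) x"
      unfolding q(3) using n0(3)[OF n] q(1)
      by (intro duffing_periodic_orbit_exists) (simp_all add: q_def mult.commute)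
    show "\<exists>s. \<forall>t. z t = x (t + s)"
      if "duffing_periodic_orbit \<alpha> (2 * T / real n) x \<and> duffing_periodic_orbit \<alpha> (2 * T / real n) z" for x z
      using duffing_periodic_orbit_unique that by blast
    fix x assume orbit: "duffing_periodic_orbit \<alpha> (2 * T / real n) x"
    then show "minimal_period (2 * T / real n) x" by (simp add: duffing_periodic_orbit_def)
    have \<alpha>: "100 * 400 ^ 4 * \<bar>\<alpha> * q\<^sup>2\<bar> < 1"
      using n0(4)[OF n] by (simp add: q_def[symmetric] abs_mult)
    then have "\<bar>\<alpha> * q\<^sup>2\<bar> \<le> 1" by simp
    note scaled = duffing_orbit_scaled_hill[OF orbit[unfolded q(3)] this]
    interpret controlled_orbit \<alpha> \<kappa> T q n x
      using scaled q n0(2)[OF n] orbit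
      by (intro controlled_orbit.intro) (auto simp: duffing_periodic_orbit_def)
    show "controlled_solution \<alpha> \<kappa> T n x" by (rule orbit_controlled_solution)
    have small: "10 * 400 ^ 4 * \<bar>\<alpha> * q\<^sup>2\<bar> < 1" using \<alpha> by simp
    have neg: "linearly_stable \<alpha> \<kappa> T n (2 * q) x" "\<not> linearly_unstable \<alpha> \<kappa> T n (2 * q) x" if "\<kappa> < 0"
    proof -
      have "no_unstable_multiplier" using n0(6)[OF n that] controlled_orbit_axioms by blast
      then show "linearly_stable \<alpha> \<kappa> T n (2 * q) x" "\<not> linearly_unstable \<alpha> \<kappa> T n (2 * q) x"
        using linearly_stable_orbit[OF _ small] not_linearly_unstable_orbit that by auto
    qed
    have pos: "linearly_unstable \<alpha> \<kappa> T n (2 * q) x" if "\<kappa> > 0"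
      using linearly_unstable_orbit[OF that] n0(5)[OF n] \<alpha> by (simp add: q_def[symmetric] mult.assoc)
    \<comment> \<open>Both equivalences also demand that at \<kappa> = 0 neither property holds: no
      multiplier lies outside the unit disk, but 1 is not simple.\<close>
    have zero: "\<not> linearly_stable \<alpha> \<kappa> T n (2 * q) x" "\<not> linearly_unstable \<alpha> \<kappa> T n (2 * q) x" if "\<kappa> = 0"
      using not_linearly_stable_uncontrolled[OF that] not_linearly_unstable_orbit
        no_unstable_multiplier_uncontrolled[OF that] by auto
    show "linearly_stable \<alpha> \<kappa> T n (2 * T / real n) x \<longleftrightarrow> \<kappa> < 0"
      "linearly_unstable \<alpha> \<kappa> T n (2 * T / real n) x \<longleftrightarrow> \<kappa> > 0"
      unfolding q(3) using neg pos zero not_stable_if_unstable by (metis linorder_neqE_linordered_idom)+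
  qed
qed

end
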